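(* Let $G$ be a finite group, let $\mathcal{O}$ be a $G$-transfer system, and let $H\subseteq G$ be a subgroup with $H\to G$ in $\mathcal{O}$. For any rational above-$[H]^{\mathcal{O}}$-Mackey functor $\underline{M}$, the composite of the counit of the adjunction $\mathrm{Ind}_{[H]^{\mathcal{O}}}\dashv\mathrm{Res}_{[H]^{\mathcal{O}}}$ followed by the unit of the adjunction $\mathrm{Res}_{[H]^{\mathcal{O}}}\dashv\mathrm{CoInd}_{[H]^{\mathcal{O}}}$, $$\mathrm{Ind}_{[H]^{\mathcal{O}}}\mathrm{Res}_{[H]^{\mathcal{O}}}\underline{M}\longrightarrow\underline{M}\longrightarrow\mathrm{CoInd}_{[H]^{\mathcal{O}}}\mathrm{Res}_{[H]^{\mathcal{O}}}\underline{M},$$ is an isomorphism.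
   Context: A $G$-transfer system $\mathcal{O}$ is a partial order on the set $\mathrm{Sub}(G)$ of subgroups of $G$, written $K\to H$, which refines inclusion and satisfies: $K\to H$ implies $gKg^{-1}\to gHg^{-1}$ for all $g\in G$; and $K\to H$, $L\subseteq H$ imply $K\cap L\to L$. $\mathrm{Sub}^{\mathcal{O}}(G)$ is the set of subgroups $H$ with $H\to G$ in $\mathcal{O}$. For every subgroup $J$ there is a unique smallest element $H_{\mathcal{O}}(J)$ of $\mathrm{Sub}^{\mathcal{O}}(G)$ containing $J$. Subgroups $J,K$ are inseparable if $H_{\mathcal{O}}(J)$ and $H_{\mathcal{O}}(K)$ are conjugate in $G$; $[H]^{\mathcal{O}}$ is the inseparability class of $H$. A subgroup $L$ is above $[H]^{\mathcal{O}}$, written $L\geq[H]^{\mathcal{O}}$, if some $K\in[H]^{\mathcal{O}}$ satisfies $K\subseteq L$. $\mathrm{Fin}^G_{\mathcal{O}}$ is the wide subcategory of finite $G$-sets consisting of equivariant maps $f\colon S\to T$ with $\mathrm{Stab}(s)\to\mathrm{Stab}(f(s))$ in $\mathcal{O}$ for all $s$. The Lindner category $\mathcal{A}^{\mathcal{O}}$ has objects the finite $G$-sets and morphisms from $S$ to $T$ the isomorphism classes of spans $S\leftarrow U\xrightarrow{h}T$ with $h\in\mathrm{Fin}^G_{\mathcal{O}}$, composed by pullback; disjoint union is the biproduct. $\mathcal{O}$-Mackey functors are product preserving functors $\mathcal{A}^{\mathcal{O}}\to\mathrm{Ab}$; rational means values in $\mathbb{Q}$-vector spaces. Above-$[H]^{\mathcal{O}}$-Mackey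 functors are the $\mathcal{O}$-Mackey functors $\underline{M}$ with $\underline{M}(G/K)=0$ unless $K\geq[H]^{\mathcal{O}}$ (a full subcategory). $\mathcal{A}^{\mathcal{O}}_{(H)}$ is the full subcategory of $\mathcal{A}^{\mathcal{O}}$ spanned by the finite $G$-sets all of whose stabilizers are subconjugate to $H$. $[H]^{\mathcal{O}}\text{-}\mathrm{Mackey}^G$ is the full subcategory of product preserving functors $\mathcal{A}^{\mathcal{O}}_{(H)}\to\mathrm{Ab}$ spanned by those vanishing on $G/K$ for $K\notin[H]^{\mathcal{O}}$. $\mathrm{Res}_{[H]^{\mathcal{O}}}$ is the functor from above-$[H]^{\mathcal{O}}$-Mackey functors to $[H]^{\mathcal{O}}\text{-}\mathrm{Mackey}^G$ given by precomposition with the inclusion $\mathcal{A}^{\mathcal{O}}_{(H)}\hookrightarrow\mathcal{A}^{\mathcal{O}}$; $\mathrm{Ind}_{[H]^{\mathcal{O}}}$ and $\mathrm{CoInd}_{[H]^{\mathcal{O}}}$ are its left and right adjoints (obtained by left and right Kan extension along the inclusion). *)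

theory Defs
  imports Complex_Main "HOL-Library.Countable"
    "HOL-Algebra.Group_Action" "HOL-Algebra.Left_Coset" "HOL-Algebra.Module"
begin

section \<open>Categories, functors, adjunctions\<close>

text \<open>
  Hom-sets are indexed by source and target and need not be disjoint, so identities and composition
  carry the objects as arguments: \<open>Cmp C X Y Z g f\<close> is the composite of \<open>f : X \<rightarrow> Y\<close> and \<open>g : Y \<rightarrow> Z\<close>.
\<close>

record ('o, 'a) cat =
  Obj :: "'o set"
  Hom :: "'o \<Rightarrow> 'o \<Rightarrow> 'a set"
  Idt :: "'o \<Rightarrow> 'a"
  Cmp :: "'o \<Rightarrow> 'o \<Rightarrow> 'o \<Rightarrow> 'a \<Rightarrow> 'a \<Rightarrow> 'a"

locale category =
  fixes C :: "('o, 'a) cat"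
  assumes idt_in_hom: "X \<in> Obj C \<Longrightarrow> Idt C X \<in> Hom C X X"
    and cmp_in_hom: "\<lbrakk>X \<in> Obj C; Y \<in> Obj C; Z \<in> Obj C; f \<in> Hom C X Y; g \<in> Hom C Y Z\<rbrakk>
      \<Longrightarrow> Cmp C X Y Z g f \<in> Hom C X Z"
    and cmp_idt_right: "\<lbrakk>X \<in> Obj C; Y \<in> Obj C; f \<in> Hom C X Y\<rbrakk> \<Longrightarrow> Cmp C X X Y f (Idt C X) = f"
    and cmp_idt_left: "\<lbrakk>X \<in> Obj C; Y \<in> Obj C; f \<in> Hom C X Y\<rbrakk> \<Longrightarrow> Cmp C X Y Y (Idt C Y) f = f"
    and cmp_assoc: "\<lbrakk>W \<in> Obj C; X \<in> Obj C; Y \<in> Obj C; Z \<in> Obj C;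
        f \<in> Hom C W X; g \<in> Hom C X Y; h \<in> Hom C Y Z\<rbrakk>
      \<Longrightarrow> Cmp C W Y Z h (Cmp C W X Y g f) = Cmp C W X Z (Cmp C X Y Z h g) f"

definition full_subcategory :: "('o, 'a) cat \<Rightarrow> ('o \<Rightarrow> bool) \<Rightarrow> ('o, 'a) cat" where
  "full_subcategory C P = C\<lparr>Obj := {X \<in> Obj C. P X}\<rparr>"

definition is_isomorphism :: "('o, 'a) cat \<Rightarrow> 'o \<Rightarrow> 'o \<Rightarrow> 'a \<Rightarrow> bool" where
  "is_isomorphism C X Y f \<longleftrightarrow> X \<in> Obj C \<and> Y \<in> Obj C \<and> f \<in> Hom C X Y \<and>
     (\<exists>g \<in> Hom C Y X. Cmp C X Y X g f = Idt C X \<and> Cmp C Y X Y f g = Idt C Y)"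

definition is_terminal :: "('o, 'a) cat \<Rightarrow> 'o \<Rightarrow> bool" where
  "is_terminal C T \<longleftrightarrow> T \<in> Obj C \<and> (\<forall>X \<in> Obj C. \<exists>!f. f \<in> Hom C X T)"

definition is_product :: "('o, 'a) cat \<Rightarrow> 'o \<Rightarrow> 'o \<Rightarrow> 'o \<Rightarrow> 'a \<Rightarrow> 'a \<Rightarrow> bool" where
  "is_product C X Y P p q \<longleftrightarrow> X \<in> Obj C \<and> Y \<in> Obj C \<and> P \<in> Obj C \<and>
     p \<in> Hom C P X \<and> q \<in> Hom C P Y \<and>
     (\<forall>Z \<in> Obj C. \<forall>f \<in> Hom C Z X. \<forall>g \<in> Hom C Z Y.
        \<exists>!h. h \<in> Hom C Z P \<and> Cmp C Z P X p h = f \<and> Cmp C Z P Y q h = g)"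

record ('o, 'a, 'p, 'b) functr =
  FObj :: "'o \<Rightarrow> 'p"
  FArr :: "'o \<Rightarrow> 'o \<Rightarrow> 'a \<Rightarrow> 'b"

definition is_functor :: "('o, 'a) cat \<Rightarrow> ('p, 'b) cat \<Rightarrow> ('o, 'a, 'p, 'b) functr \<Rightarrow> bool" where
  "is_functor C D F \<longleftrightarrow>
     (\<forall>X \<in> Obj C. FObj F X \<in> Obj D) \<and>
     (\<forall>X \<in> Obj C. \<forall>Y \<in> Obj C. \<forall>f \<in> Hom C X Y. FArr F X Y f \<in> Hom D (FObj F X) (FObj F Y)) \<and>
     (\<forall>X \<in> Obj C. FArr F X X (Idt C X) = Idt D (FObj F X)) \<and>
     (\<forall>X \<in> Obj C. \<forall>Y \<in> Obj C. \<forall>Z \<in> Obj C. \<forall>f \<in> Hom C X Y. \<forall>g \<in> Hom C Y Z.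
        FArr F X Z (Cmp C X Y Z g f) =
        Cmp D (FObj F X) (FObj F Y) (FObj F Z) (FArr F Y Z g) (FArr F X Y f))"

definition functor_id :: "('o, 'a, 'o, 'a) functr" where
  "functor_id = \<lparr>FObj = (\<lambda>X. X), FArr = (\<lambda>X Y f. f)\<rparr>"

definition functor_comp ::
    "('p, 'b, 'q, 'c) functr \<Rightarrow> ('o, 'a, 'p, 'b) functr \<Rightarrow> ('o, 'a, 'q, 'c) functr" where
  "functor_comp K F =
     \<lparr>FObj = (\<lambda>X. FObj K (FObj F X)),
      FArr = (\<lambda>X Y f. FArr K (FObj F X) (FObj F Y) (FArr F X Y f))\<rparr>"

definition nat_trans ::
    "('o, 'a) cat \<Rightarrow> ('p, 'b) cat \<Rightarrow> ('o, 'a, 'p, 'b) functr \<Rightarrow> ('o, 'a, 'p, 'b) functr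
      \<Rightarrow> ('o \<Rightarrow> 'b) set" where
  "nat_trans C D F K = {\<tau> \<in> extensional (Obj C).
     (\<forall>X \<in> Obj C. \<tau> X \<in> Hom D (FObj F X) (FObj K X)) \<and>
     (\<forall>X \<in> Obj C. \<forall>Y \<in> Obj C. \<forall>f \<in> Hom C X Y.
        Cmp D (FObj F X) (FObj F Y) (FObj K Y) (\<tau> Y) (FArr F X Y f) =
        Cmp D (FObj F X) (FObj K X) (FObj K Y) (FArr K X Y f) (\<tau> X))}"

definition functor_category ::
    "('o, 'a) cat \<Rightarrow> ('p, 'b) cat \<Rightarrow> (('o, 'a, 'p, 'b) functr, 'o \<Rightarrow> 'b) cat" where
  "functor_category C D =
     \<lparr>Obj = {F. is_functor C D F},
      Hom = nat_trans C D,
      Idt = (\<lambda>F. \<lambda>X \<in> Obj C. Idt D (FObj F X)),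
      Cmp = (\<lambda>F K L \<tau> \<sigma>. \<lambda>X \<in> Obj C. Cmp D (FObj F X) (FObj K X) (FObj L X) (\<tau> X) (\<sigma> X))\<rparr>"

definition preserves_finite_products ::
    "('o, 'a) cat \<Rightarrow> ('p, 'b) cat \<Rightarrow> ('o, 'a, 'p, 'b) functr \<Rightarrow> bool" where
  "preserves_finite_products C D F \<longleftrightarrow>
     (\<forall>T. is_terminal C T \<longrightarrow> is_terminal D (FObj F T)) \<and>
     (\<forall>X Y P p q. is_product C X Y P p q \<longrightarrow>
        is_product D (FObj F X) (FObj F Y) (FObj F P) (FArr F P X p) (FArr F P Y q))"

text \<open>
  \<open>adjunction C D L R \<eta> \<epsilon>\<close>: the functor \<open>L : C \<rightarrow> D\<close> is left adjoint to \<open>R : D \<rightarrow> C\<close> with unit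
  \<open>\<eta> : 1 \<rightarrow> R L\<close> and counit \<open>\<epsilon> : L R \<rightarrow> 1\<close>.
\<close>

definition adjunction ::
    "('o, 'a) cat \<Rightarrow> ('p, 'b) cat \<Rightarrow> ('o, 'a, 'p, 'b) functr \<Rightarrow> ('p, 'b, 'o, 'a) functr
      \<Rightarrow> ('o \<Rightarrow> 'a) \<Rightarrow> ('p \<Rightarrow> 'b) \<Rightarrow> bool" where
  "adjunction C D L R \<eta> \<epsilon> \<longleftrightarrow>
     is_functor C D L \<and> is_functor D C R \<and>
     \<eta> \<in> nat_trans C C functor_id (functor_comp R L) \<and>
     \<epsilon> \<in> nat_trans D D (functor_comp L R) functor_id \<and>
     (\<forall>X \<in> Obj C.
        Cmp D (FObj L X) (FObj L (FObj R (FObj L X))) (FObj L X)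
          (\<epsilon> (FObj L X)) (FArr L X (FObj R (FObj L X)) (\<eta> X)) = Idt D (FObj L X)) \<and>
     (\<forall>Y \<in> Obj D.
        Cmp C (FObj R Y) (FObj R (FObj L (FObj R Y))) (FObj R Y)
          (FArr R (FObj L (FObj R Y)) Y (\<epsilon> Y)) (\<eta> (FObj R Y)) = Idt C (FObj R Y))"


section \<open>Abelian groups\<close>

text \<open>
  Abelian groups whose elements are drawn from a fixed type \<open>'u\<close>, which plays the role of the
  universe; homomorphisms are made extensional so that they are equal when they agree on the carrier.
\<close>

definition Ab :: "('u monoid, 'u \<Rightarrow> 'u) cat" where
  "Ab = \<lparr>Obj = {A. comm_group A},
         Hom = (\<lambda>A B. hom A B \<inter> extensional (carrier A)),
         Idt = (\<lambda>A. \<lambda>x \<in> carrier A. x),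
         Cmp = (\<lambda>A B C g f. compose (carrier A) g f)\<rparr>"

definition rat_ring :: "rat ring" where
  "rat_ring = \<lparr>carrier = UNIV, mult = (*), one = 1, zero = 0, add = (+)\<rparr>"

text \<open>
  \<open>A\<close> is (the underlying group of) a rational vector space. Such a structure is unique if it exists,
  and all homomorphisms respect it. The multiplicative fields of a module record play no role in
  \<open>module\<close>.
\<close>

definition rational_group :: "'u monoid \<Rightarrow> bool" where
  "rational_group A \<longleftrightarrow> (\<exists>s :: rat \<Rightarrow> 'u \<Rightarrow> 'u.
     module rat_ring
       \<lparr>carrier = carrier A, mult = undefined, one = undefined,
        zero = one A, add = mult A, smult = s\<rparr>)"


section \<open>Transfer systems\<close>

abbreviation conj_subgroup :: "('g, 'e) monoid_scheme \<Rightarrow> 'g \<Rightarrow> 'g set \<Rightarrow> 'g set" where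
  "conj_subgroup G g K \<equiv> g <#\<^bsub>G\<^esub> K #>\<^bsub>G\<^esub> inv\<^bsub>G\<^esub> g"

locale transfer_system =
  fixes G (structure) and \<O> :: "('g set \<times> 'g set) set"
  assumes partial_order: "partial_order_on {K. subgroup K G} \<O>"
    and refines_inclusion: "(K, H) \<in> \<O> \<Longrightarrow> K \<subseteq> H"
    and conjugation: "\<lbrakk>(K, H) \<in> \<O>; g \<in> carrier G\<rbrakk>
      \<Longrightarrow> (conj_subgroup G g K, conj_subgroup G g H) \<in> \<O>"
    and restriction: "\<lbrakk>(K, H) \<in> \<O>; subgroup L G; L \<subseteq> H\<rbrakk> \<Longrightarrow> (K \<inter> L, L) \<in> \<O>"

text \<open>The smallest \<open>H \<rightarrow> G\<close> containing \<open>J\<close>.\<close>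

definition ts_hull :: "('g, 'e) monoid_scheme \<Rightarrow> ('g set \<times> 'g set) set \<Rightarrow> 'g set \<Rightarrow> 'g set" where
  "ts_hull G \<O> J = (THE H. (H, carrier G) \<in> \<O> \<and> J \<subseteq> H \<and>
     (\<forall>H'. (H', carrier G) \<in> \<O> \<and> J \<subseteq> H' \<longrightarrow> H \<subseteq> H'))"

definition inseparable ::
    "('g, 'e) monoid_scheme \<Rightarrow> ('g set \<times> 'g set) set \<Rightarrow> 'g set \<Rightarrow> 'g set \<Rightarrow> bool" where
  "inseparable G \<O> J K \<longleftrightarrow>
     (\<exists>g \<in> carrier G. ts_hull G \<O> K = conj_subgroup G g (ts_hull G \<O> J))"

definition insep_class ::
    "('g, 'e) monoid_scheme \<Rightarrow> ('g set \<times> 'g set) set \<Rightarrow> 'g set \<Rightarrow> 'g set set" where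
  "insep_class G \<O> H = {K. subgroup K G \<and> inseparable G \<O> H K}"

definition above_class ::
    "('g, 'e) monoid_scheme \<Rightarrow> ('g set \<times> 'g set) set \<Rightarrow> 'g set \<Rightarrow> 'g set \<Rightarrow> bool" where
  "above_class G \<O> H L \<longleftrightarrow> (\<exists>K \<in> insep_class G \<O> H. K \<subseteq> L)"

definition subconjugate :: "('g, 'e) monoid_scheme \<Rightarrow> 'g set \<Rightarrow> 'g set \<Rightarrow> bool" where
  "subconjugate G K H \<longleftrightarrow> (\<exists>g \<in> carrier G. K \<subseteq> conj_subgroup G g H)"


section \<open>Finite \<open>G\<close>-sets and spans\<close>

record ('g, 'x) gset =
  points :: "'x set"
  act :: "'g \<Rightarrow> 'x \<Rightarrow> 'x"

definition is_finite_gset :: "('g, 'e) monoid_scheme \<Rightarrow> ('g, 'x) gset \<Rightarrow> bool" where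
  "is_finite_gset G S \<longleftrightarrow> finite (points S) \<and> group_action G (points S) (act S)"

definition stab :: "('g, 'e) monoid_scheme \<Rightarrow> ('g, 'x) gset \<Rightarrow> 'x \<Rightarrow> 'g set" where
  "stab G S x = stabilizer G (act S) x"

definition equivariant ::
    "('g, 'e) monoid_scheme \<Rightarrow> ('g, 'x) gset \<Rightarrow> ('g, 'y) gset \<Rightarrow> ('x \<Rightarrow> 'y) \<Rightarrow> bool" where
  "equivariant G S T f \<longleftrightarrow> f \<in> points S \<rightarrow> points T \<and>
     (\<forall>g \<in> carrier G. \<forall>x \<in> points S. f (act S g x) = act T g (f x))"

definition gset_iso ::
    "('g, 'e) monoid_scheme \<Rightarrow> ('g, 'x) gset \<Rightarrow> ('g, 'y) gset \<Rightarrow> bool" where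
  "gset_iso G S T \<longleftrightarrow> (\<exists>k. equivariant G S T k \<and> bij_betw k (points S) (points T))"

definition coset_gset :: "('g, 'e) monoid_scheme \<Rightarrow> 'g set \<Rightarrow> ('g, 'g set) gset" where
  "coset_gset G K = \<lparr>points = lcosets\<^bsub>G\<^esub> K, act = (\<lambda>g. \<lambda>A \<in> lcosets\<^bsub>G\<^esub> K. g <#\<^bsub>G\<^esub> A)\<rparr>"

text \<open>Morphisms of the wide subcategory of finite \<open>G\<close>-sets determined by \<open>\<O>\<close>.\<close>

definition ts_map ::
    "('g, 'e) monoid_scheme \<Rightarrow> ('g set \<times> 'g set) set \<Rightarrow> ('g, 'x) gset \<Rightarrow> ('g, 'y) gset
      \<Rightarrow> ('x \<Rightarrow> 'y) \<Rightarrow> bool" where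
  "ts_map G \<O> S T f \<longleftrightarrow> equivariant G S T f \<and>
     (\<forall>x \<in> points S. (stab G S x, stab G T (f x)) \<in> \<O>)"

text \<open>Spans \<open>S \<leftarrow> U \<rightarrow> T\<close> with apex \<open>U\<close>; the feet \<open>S\<close> and \<open>T\<close> are not part of the record.\<close>

record ('g, 'x, 'y) span =
  apex :: "('g, 'x) gset"
  lleg :: "'x \<Rightarrow> 'y"
  rleg :: "'x \<Rightarrow> 'y"

definition is_ts_span ::
    "('g, 'e) monoid_scheme \<Rightarrow> ('g set \<times> 'g set) set \<Rightarrow> ('g, 'y) gset \<Rightarrow> ('g, 'y) gset
      \<Rightarrow> ('g, 'x, 'y) span \<Rightarrow> bool" where
  "is_ts_span G \<O> S T u \<longleftrightarrow> is_finite_gset G (apex u) \<and>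
     equivariant G (apex u) S (lleg u) \<and> ts_map G \<O> (apex u) T (rleg u)"

definition span_iso ::
    "('g, 'e) monoid_scheme \<Rightarrow> ('g, 'x, 'y) span \<Rightarrow> ('g, 'z, 'y) span \<Rightarrow> bool" where
  "span_iso G u v \<longleftrightarrow> (\<exists>k. equivariant G (apex u) (apex v) k \<and>
     bij_betw k (points (apex u)) (points (apex v)) \<and>
     (\<forall>x \<in> points (apex u). lleg v (k x) = lleg u x \<and> rleg v (k x) = rleg u x))"

definition span_id :: "('g, 'y) gset \<Rightarrow> ('g, 'y, 'y) span" where
  "span_id S = \<lparr>apex = S, lleg = (\<lambda>x. x), rleg = (\<lambda>x. x)\<rparr>"

text \<open>The composite of \<open>S \<leftarrow> U \<rightarrow> T\<close> and \<open>T \<leftarrow> V \<rightarrow> W\<close>, with apex the fibre product of \<open>U\<close> and \<open>V\<close> over \<open>T\<close>.\<close>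

definition span_pullback ::
    "('g, 'x, 'y) span \<Rightarrow> ('g, 'z, 'y) span \<Rightarrow> ('g, 'x \<times> 'z, 'y) span" where
  "span_pullback u v =
     (let P = {(x, z) \<in> points (apex u) \<times> points (apex v). rleg u x = lleg v z} in
      \<lparr>apex = \<lparr>points = P, act = (\<lambda>g. \<lambda>(x, z) \<in> P. (act (apex u) g x, act (apex v) g z))\<rparr>,
       lleg = (\<lambda>(x, z). lleg u x),
       rleg = (\<lambda>(x, z). rleg v z)\<rparr>)"


section \<open>The Lindner category\<close>

text \<open>
  Every finite \<open>G\<close>-set is isomorphic to one whose points are natural numbers, so the finite \<open>G\<close>-sets
  on sets of natural numbers form a (small) category equivalent to that of all finite \<open>G\<close>-sets.
  A morphism is an isomorphism class of spans, all of whose apices are again such \<open>G\<close>-sets. Fibre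
  products live on pairs of naturals; the composite consists of the spans isomorphic to them.
\<close>

type_synonym 'g lobj = "('g, nat) gset"
type_synonym 'g lmor = "('g, nat, nat) span set"

definition span_class ::
    "('g, 'e) monoid_scheme \<Rightarrow> ('g set \<times> 'g set) set \<Rightarrow> 'g lobj \<Rightarrow> 'g lobj
      \<Rightarrow> ('g, 'x, nat) span \<Rightarrow> 'g lmor" where
  "span_class G \<O> S T u = {v. is_ts_span G \<O> S T v \<and> span_iso G u v}"

definition lindner ::
    "('g, 'e) monoid_scheme \<Rightarrow> ('g set \<times> 'g set) set \<Rightarrow> ('g lobj, 'g lmor) cat" where
  "lindner G \<O> =
     \<lparr>Obj = {S. is_finite_gset G S},
      Hom = (\<lambda>S T. {span_class G \<O> S T u | u :: ('g, nat, nat) span. is_ts_span G \<O> S T u}),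
      Idt = (\<lambda>S. span_class G \<O> S S (span_id S)),
      Cmp = (\<lambda>S T W \<beta> \<alpha>. \<Union>u \<in> \<alpha>. \<Union>v \<in> \<beta>. span_class G \<O> S W (span_pullback u v))\<rparr>"

definition lindner_sub ::
    "('g, 'e) monoid_scheme \<Rightarrow> ('g set \<times> 'g set) set \<Rightarrow> 'g set \<Rightarrow> ('g lobj, 'g lmor) cat" where
  "lindner_sub G \<O> H = full_subcategory (lindner G \<O>)
     (\<lambda>S. \<forall>x \<in> points S. subconjugate G (stab G S x) H)"

definition lindner_incl :: "('g lobj, 'g lmor, 'g lobj, 'g lmor) functr" where
  "lindner_incl = \<lparr>FObj = (\<lambda>S. S), FArr = (\<lambda>S T \<alpha>. \<alpha>)\<rparr>"


section \<open>Mackey functors\<close>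

type_synonym ('g, 'u) mackey = "('g lobj, 'g lmor, 'u monoid, 'u \<Rightarrow> 'u) functr"
type_synonym ('g, 'u) mackey_hom = "'g lobj \<Rightarrow> 'u \<Rightarrow> 'u"

definition product_functor_category :: "('o, 'a) cat \<Rightarrow> ('p, 'b) cat
      \<Rightarrow> (('o, 'a, 'p, 'b) functr, 'o \<Rightarrow> 'b) cat" where
  "product_functor_category C D =
     full_subcategory (functor_category C D) (preserves_finite_products C D)"

text \<open>
  \<open>M(G/K) = 0\<close>, where \<open>M\<close> is a functor on a full subcategory \<open>C\<close> of the Lindner category; the
  \<open>G\<close>-set \<open>G/K\<close> is represented in \<open>C\<close> by the objects isomorphic to it.
\<close>

definition vanishes_at ::
    "('g, 'e) monoid_scheme \<Rightarrow> ('g lobj, 'g lmor) cat \<Rightarrow> ('g, 'u) mackey \<Rightarrow> 'g set \<Rightarrow> bool" where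
  "vanishes_at G C M K \<longleftrightarrow>
     (\<forall>X \<in> Obj C. gset_iso G (coset_gset G K) X \<longrightarrow> carrier (FObj M X) = {\<one>\<^bsub>FObj M X\<^esub>})"

definition Mackey ::
    "('g, 'e) monoid_scheme \<Rightarrow> ('g set \<times> 'g set) set
      \<Rightarrow> (('g, 'u) mackey, ('g, 'u) mackey_hom) cat" where
  "Mackey G \<O> = product_functor_category (lindner G \<O>) Ab"

definition Above_Mackey ::
    "('g, 'e) monoid_scheme \<Rightarrow> ('g set \<times> 'g set) set \<Rightarrow> 'g set
      \<Rightarrow> (('g, 'u) mackey, ('g, 'u) mackey_hom) cat" where
  "Above_Mackey G \<O> H = full_subcategory (Mackey G \<O>)
     (\<lambda>M. \<forall>K. subgroup K G \<and> \<not> above_class G \<O> H K \<longrightarrow> vanishes_at G (lindner G \<O>) M K)"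

definition Class_Mackey ::
    "('g, 'e) monoid_scheme \<Rightarrow> ('g set \<times> 'g set) set \<Rightarrow> 'g set
      \<Rightarrow> (('g, 'u) mackey, ('g, 'u) mackey_hom) cat" where
  "Class_Mackey G \<O> H = full_subcategory (product_functor_category (lindner_sub G \<O> H) Ab)
     (\<lambda>N. \<forall>K. subgroup K G \<and> K \<notin> insep_class G \<O> H \<longrightarrow> vanishes_at G (lindner_sub G \<O> H) N K)"

definition rational_mackey ::
    "('g, 'e) monoid_scheme \<Rightarrow> ('g set \<times> 'g set) set \<Rightarrow> ('g, 'u) mackey \<Rightarrow> bool" where
  "rational_mackey G \<O> M \<longleftrightarrow> (\<forall>X \<in> Obj (lindner G \<O>). rational_group (FObj M X))"

definition Res ::
    "('g, 'e) monoid_scheme \<Rightarrow> ('g set \<times> 'g set) set \<Rightarrow> 'g set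
      \<Rightarrow> (('g, 'u) mackey, ('g, 'u) mackey_hom, ('g, 'u) mackey, ('g, 'u) mackey_hom) functr" where
  "Res G \<O> H =
     \<lparr>FObj = (\<lambda>M. functor_comp M lindner_incl),
      FArr = (\<lambda>M N \<tau>. \<lambda>X \<in> Obj (lindner_sub G \<O> H). \<tau> (FObj lindner_incl X))\<rparr>"


section \<open>The category axioms\<close>

lemma is_finite_gsetI:
  assumes "group G" "finite (points S)"
    "\<And>g. g \<in> carrier G \<Longrightarrow> act S g \<in> extensional (points S)"
    "\<And>g x. g \<in> carrier G \<Longrightarrow> x \<in> points S \<Longrightarrow> act S g x \<in> points S"
    "\<And>x. x \<in> points S \<Longrightarrow> act S \<one>\<^bsub>G\<^esub> x = x"
    "\<And>g h x. g \<in> carrier G \<Longrightarrow> h \<in> carrier G \<Longrightarrow> x \<in> points S \<Longrightarrow>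
       act S (g \<otimes>\<^bsub>G\<^esub> h) x = act S g (act S h x)"
  shows "is_finite_gset G S"
proof -
  interpret group G by fact
  have bij: "act S g \<in> Bij (points S)" if g: "g \<in> carrier G" for g
  proof -
    have "bij_betw (act S g) (points S) (points S)"
    proof (rule bij_betw_byWitness[where f' = "act S (inv\<^bsub>G\<^esub> g)"])
      show "\<forall>a\<in>points S. act S (inv\<^bsub>G\<^esub> g) (act S g a) = a"
        using g assms(5) assms(6)[of "inv\<^bsub>G\<^esub> g" g] by simp
      show "\<forall>a\<in>points S. act S g (act S (inv\<^bsub>G\<^esub> g) a) = a"
        using g assms(5) assms(6)[of g "inv\<^bsub>G\<^esub> g"] by simp
    qed (use g assms(4) in auto)
    then show ?thesis using assms(3) g by (auto simp: Bij_def)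
  qed
  have "act S \<in> hom G (BijGroup (points S))"
  proof (rule homI)
    fix g h assume gh: "g \<in> carrier G" "h \<in> carrier G"
    have "act S (g \<otimes>\<^bsub>G\<^esub> h) = compose (points S) (act S g) (act S h)"
      using assms(3)[of "g \<otimes>\<^bsub>G\<^esub> h"] assms(6) gh
      by (auto simp: compose_def extensional_def fun_eq_iff)
    then show "act S (g \<otimes>\<^bsub>G\<^esub> h) = act S g \<otimes>\<^bsub>BijGroup (points S)\<^esub> act S h"
      using bij gh by (simp add: BijGroup_def)
  qed (use bij in \<open>simp add: BijGroup_def\<close>)
  then show ?thesis
    unfolding is_finite_gset_def group_action_def group_hom_def group_hom_axioms_def
    using assms(1,2) group_BijGroup by blast
qed

lemma fin_gset_props:
  assumes "is_finite_gset G S"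
  shows "finite (points S)" "group G"
    "\<And>g. g \<in> carrier G \<Longrightarrow> act S g \<in> extensional (points S)"
    "\<And>g x. g \<in> carrier G \<Longrightarrow> x \<in> points S \<Longrightarrow> act S g x \<in> points S"
    "\<And>x. x \<in> points S \<Longrightarrow> act S \<one>\<^bsub>G\<^esub> x = x"
    "\<And>g h x. g \<in> carrier G \<Longrightarrow> h \<in> carrier G \<Longrightarrow> x \<in> points S \<Longrightarrow>
       act S (g \<otimes>\<^bsub>G\<^esub> h) x = act S g (act S h x)"
proof -
  interpret group_action G "points S" "act S" using assms by (simp add: is_finite_gset_def)
  show "finite (points S)" using assms by (simp add: is_finite_gset_def)
  show "group G" using group_hom group_hom.axioms(1) by blast
  show "act S g \<in> extensional (points S)" if "g \<in> carrier G" for g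
    using bij_prop0[OF that] by (simp add: Bij_def)
  show "act S g x \<in> points S" if "g \<in> carrier G" "x \<in> points S" for g x
    using element_image that by blast
  show "act S \<one>\<^bsub>G\<^esub> x = x" if "x \<in> points S" for x
    using id_eq_one that by (metis restrict_apply')
  show "act S (g \<otimes>\<^bsub>G\<^esub> h) x = act S g (act S h x)"
    if "g \<in> carrier G" "h \<in> carrier G" "x \<in> points S" for g h x
    using composition_rule that by blast
qed

lemma stab_subgroup:
  assumes "is_finite_gset G S" "x \<in> points S"
  shows "subgroup (stab G S x) G"
  using assms group_action.stabilizer_subgroup[of G "points S" "act S" x]
  by (simp add: is_finite_gset_def stab_def)

lemma stab_mono:
  assumes "equivariant G S T f" "x \<in> points S"
  shows "stab G S x \<subseteq> stab G T (f x)"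
  using assms by (fastforce simp: equivariant_def stab_def stabilizer_def)

lemma stab_bij:
  assumes "equivariant G S T k" "bij_betw k (points S) (points T)" "x \<in> points S"
    "is_finite_gset G S"
  shows "stab G T (k x) = stab G S x"
proof
  show "stab G S x \<subseteq> stab G T (k x)" by (rule stab_mono[OF assms(1,3)])
  show "stab G T (k x) \<subseteq> stab G S x"
  proof
    fix g assume "g \<in> stab G T (k x)"
    then have g: "g \<in> carrier G" "act T g (k x) = k x" by (auto simp: stab_def stabilizer_def)
    have "k (act S g x) = k x" using assms g by (simp add: equivariant_def)
    then have "act S g x = x"
      using assms(2,3) fin_gset_props(4)[OF assms(4) g(1) assms(3)]
      by (meson bij_betw_imp_inj_on inj_on_eq_iff)
    then show "g \<in> stab G S x" using g by (simp add: stab_def stabilizer_def)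
  qed
qed

lemma span_iso_refl: "span_iso G u u"
  unfolding span_iso_def by (rule exI[of _ "\<lambda>x. x"]) (auto simp: equivariant_def bij_betw_def)

lemma span_iso_sym:
  assumes "span_iso G u v" "is_finite_gset G (apex u)"
  shows "span_iso G v u"
proof -
  obtain k where k: "equivariant G (apex u) (apex v) k" "bij_betw k (points (apex u)) (points (apex v))"
    "\<And>x. x \<in> points (apex u) \<Longrightarrow> lleg v (k x) = lleg u x \<and> rleg v (k x) = rleg u x"
    using assms unfolding span_iso_def by blast
  let ?i = "inv_into (points (apex u)) k"
  have i: "?i y \<in> points (apex u)" "k (?i y) = y" if "y \<in> points (apex v)" for y
    using k(2) that by (metis bij_betw_def inv_into_into, metis bij_betw_def f_inv_into_f)
  have ik: "?i (k x) = x" if "x \<in> points (apex u)" for x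
    using k(2) that by (simp add: bij_betw_def)
  have "?i (act (apex v) g y) = act (apex u) g (?i y)"
    if "g \<in> carrier G" "y \<in> points (apex v)" for g y
  proof -
    have "k (act (apex u) g (?i y)) = act (apex v) g y"
      using k(1) i[OF that(2)] that(1) by (simp add: equivariant_def)
    then show ?thesis using ik fin_gset_props(4)[OF assms(2) that(1) i(1)[OF that(2)]] by metis
  qed
  then have "equivariant G (apex v) (apex u) ?i" using i by (simp add: equivariant_def)
  moreover have "bij_betw ?i (points (apex v)) (points (apex u))"
    using k(2) bij_betw_inv_into by blast
  moreover have "lleg u (?i y) = lleg v y \<and> rleg u (?i y) = rleg v y"
    if "y \<in> points (apex v)" for y using k(3)[OF i(1)[OF that]] i[OF that] by simp
  ultimately show ?thesis unfolding span_iso_def by blast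
qed

lemma span_iso_trans:
  assumes "span_iso G u v" "span_iso G v w"
  shows "span_iso G u w"
proof -
  obtain k where k: "equivariant G (apex u) (apex v) k" "bij_betw k (points (apex u)) (points (apex v))"
    "\<And>x. x \<in> points (apex u) \<Longrightarrow> lleg v (k x) = lleg u x \<and> rleg v (k x) = rleg u x"
    using assms unfolding span_iso_def by blast
  obtain l where l: "equivariant G (apex v) (apex w) l" "bij_betw l (points (apex v)) (points (apex w))"
    "\<And>x. x \<in> points (apex v) \<Longrightarrow> lleg w (l x) = lleg v x \<and> rleg w (l x) = rleg v x"
    using assms unfolding span_iso_def by blast
  have kv: "k x \<in> points (apex v)" if "x \<in> points (apex u)" for x
    using k(1) that by (auto simp: equivariant_def)
  show ?thesis unfolding span_iso_def
    by (rule exI[of _ "l \<circ> k"])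
       (use k l kv bij_betw_trans[OF k(2) l(2)] in \<open>auto simp: equivariant_def\<close>)
qed

lemma span_class_eq:
  assumes "span_iso G u v" "is_finite_gset G (apex u)"
  shows "span_class G \<O> S T u = span_class G \<O> S T v"
  unfolding span_class_def
  using span_iso_trans[OF assms(1)] span_iso_trans[OF span_iso_sym[OF assms]] by (intro Collect_cong) auto

lemma points_pb: "points (apex (span_pullback u v)) =
  {(x, z) \<in> points (apex u) \<times> points (apex v). rleg u x = lleg v z}"
  by (simp add: span_pullback_def Let_def)

lemma act_pb: "(x, z) \<in> points (apex (span_pullback u v)) \<Longrightarrow>
  act (apex (span_pullback u v)) g (x, z) = (act (apex u) g x, act (apex v) g z)"
  by (simp add: span_pullback_def Let_def)

lemma legs_pb: "lleg (span_pullback u v) (x, z) = lleg u x" "rleg (span_pullback u v) (x, z) = rleg v z"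
  by (simp_all add: span_pullback_def Let_def)

context
  fixes G :: "('g, 'e) monoid_scheme" and \<O>
  assumes G: "group G" and TS: "transfer_system G \<O>"
begin

lemma O_refl: "subgroup K G \<Longrightarrow> (K, K) \<in> \<O>"
  using transfer_system.partial_order[OF TS]
  by (auto simp: partial_order_on_def preorder_on_def refl_on_def)

lemma O_trans: "(K, L) \<in> \<O> \<Longrightarrow> (L, J) \<in> \<O> \<Longrightarrow> (K, J) \<in> \<O>"
  using transfer_system.partial_order[OF TS]
  by (meson partial_order_on_def preorder_on_def transD)

lemma pb_gset:
  assumes u: "is_ts_span G \<O> S T u" and v: "is_ts_span G \<O> T W v"
  shows "is_finite_gset G (apex (span_pullback u v))"
proof (rule is_finite_gsetI[OF G])
  let ?P = "apex (span_pullback u v)"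
  have fu: "is_finite_gset G (apex u)" and fv: "is_finite_gset G (apex v)"
    using u v by (auto simp: is_ts_span_def)
  show "finite (points ?P)"
    by (rule finite_subset[of _ "points (apex u) \<times> points (apex v)"])
       (use fin_gset_props(1)[OF fu] fin_gset_props(1)[OF fv] in \<open>auto simp: points_pb\<close>)
  show "act ?P g \<in> extensional (points ?P)" for g
    by (simp add: span_pullback_def Let_def)
  have cl: "act ?P g x \<in> points ?P" if "g \<in> carrier G" "x \<in> points ?P" for g x
    using that fin_gset_props(4)[OF fu] fin_gset_props(4)[OF fv] u v
    by (cases x) (auto simp: act_pb points_pb is_ts_span_def ts_map_def equivariant_def)
  then show "\<And>g x. g \<in> carrier G \<Longrightarrow> x \<in> points ?P \<Longrightarrow> act ?P g x \<in> points ?P" .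
  show "act ?P \<one>\<^bsub>G\<^esub> x = x" if "x \<in> points ?P" for x
    using that fin_gset_props(5)[OF fu] fin_gset_props(5)[OF fv]
    by (cases x) (auto simp: act_pb points_pb)
  show "act ?P (g \<otimes>\<^bsub>G\<^esub> h) x = act ?P g (act ?P h x)"
    if "g \<in> carrier G" "h \<in> carrier G" "x \<in> points ?P" for g h x
  proof -
    obtain a b where x: "x = (a, b)" by (cases x)
    have "act ?P h x \<in> points ?P" using cl that by blast
    then show ?thesis using that fin_gset_props(6)[OF fu] fin_gset_props(6)[OF fv]
      by (simp add: x act_pb) (auto simp: points_pb)
  qed
qed

lemma pb_ts_span:
  assumes u: "is_ts_span G \<O> S T u" and v: "is_ts_span G \<O> T W v"
  shows "is_ts_span G \<O> S W (span_pullback u v)"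
proof -
  let ?P = "apex (span_pullback u v)"
  have eq: "equivariant G ?P S (lleg (span_pullback u v))"
    "equivariant G ?P W (rleg (span_pullback u v))"
    using u v by (auto simp: equivariant_def is_ts_span_def ts_map_def legs_pb act_pb)
      (auto simp: points_pb legs_pb)
  have "(stab G ?P p, stab G W (rleg (span_pullback u v) p)) \<in> \<O>" if p: "p \<in> points ?P" for p
  proof -
    obtain x z where [simp]: "p = (x, z)" by (cases p)
    have xz: "x \<in> points (apex u)" "z \<in> points (apex v)" "rleg u x = lleg v z"
      using p by (auto simp: points_pb)
    have st: "stab G ?P p = stab G (apex u) x \<inter> stab G (apex v) z"
      using p by (auto simp: stab_def stabilizer_def act_pb)
    have "(stab G (apex u) x, stab G T (lleg v z)) \<in> \<O>"
      using u xz by (metis is_ts_span_def ts_map_def)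
    moreover have "stab G (apex v) z \<subseteq> stab G T (lleg v z)"
      using v xz stab_mono by (metis is_ts_span_def)
    moreover have "subgroup (stab G (apex v) z) G"
      using v xz stab_subgroup by (metis is_ts_span_def)
    ultimately have "(stab G ?P p, stab G (apex v) z) \<in> \<O>"
      unfolding st using transfer_system.restriction[OF TS] by blast
    moreover have "(stab G (apex v) z, stab G W (rleg v z)) \<in> \<O>"
      using v xz by (metis is_ts_span_def ts_map_def)
    ultimately show ?thesis using O_trans by (auto simp: legs_pb)
  qed
  then show ?thesis using eq pb_gset[OF u v] by (simp add: is_ts_span_def ts_map_def)
qed

lemma pb_cong:
  assumes "span_iso G u u'" "span_iso G v v'"
  shows "span_iso G (span_pullback u v) (span_pullback u' v')"
proof -
  obtain k where k: "equivariant G (apex u) (apex u') k" "bij_betw k (points (apex u)) (points (apex u'))"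
    "\<And>x. x \<in> points (apex u) \<Longrightarrow> lleg u' (k x) = lleg u x \<and> rleg u' (k x) = rleg u x"
    using assms unfolding span_iso_def by blast
  obtain l where l: "equivariant G (apex v) (apex v') l" "bij_betw l (points (apex v)) (points (apex v'))"
    "\<And>x. x \<in> points (apex v) \<Longrightarrow> lleg v' (l x) = lleg v x \<and> rleg v' (l x) = rleg v x"
    using assms unfolding span_iso_def by blast
  let ?m = "map_prod k l"
  let ?P = "points (apex (span_pullback u v))" let ?Q = "points (apex (span_pullback u' v'))"
  have m: "?m p \<in> ?Q" if "p \<in> ?P" for p
    using that k l by (auto simp: points_pb equivariant_def)
  have "inj_on ?m ?P"
    using k(2) l(2) by (auto simp: inj_on_def points_pb bij_betw_def)
  moreover have "?m ` ?P = ?Q"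
  proof
    show "?Q \<subseteq> ?m ` ?P"
    proof
      fix q assume q: "q \<in> ?Q"
      obtain a b where ab: "q = (a, b)" by (cases q)
      have h: "a \<in> points (apex u')" "b \<in> points (apex v')" "rleg u' a = lleg v' b"
        using q ab by (auto simp: points_pb)
      obtain x where x: "x \<in> points (apex u)" "k x = a" using k(2) h by (metis bij_betw_def imageE)
      obtain z where z: "z \<in> points (apex v)" "l z = b" using l(2) h by (metis bij_betw_def imageE)
      have "(x, z) \<in> ?P" using x z h k(3) l(3) by (auto simp: points_pb)
      then show "q \<in> ?m ` ?P" using x z ab by force
    qed
  qed (use m in auto)
  ultimately have bij: "bij_betw ?m ?P ?Q" by (simp add: bij_betw_def)
  have "?m (act (apex (span_pullback u v)) g p) = act (apex (span_pullback u' v')) g (?m p)"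
    if "g \<in> carrier G" "p \<in> ?P" for g p
  proof -
    obtain x z where p: "p = (x, z)" by (cases p)
    show ?thesis using m[OF that(2)] that k(1) l(1)
      by (simp add: p act_pb) (auto simp: points_pb equivariant_def)
  qed
  then have "equivariant G (apex (span_pullback u v)) (apex (span_pullback u' v')) ?m"
    using m by (simp add: equivariant_def)
  then show ?thesis unfolding span_iso_def using bij k(3) l(3)
    by (intro exI[of _ ?m]) (auto simp: legs_pb points_pb)
qed

lemma ts_span_iso:
  assumes "is_ts_span G \<O> S T u" "span_iso G u v" "is_finite_gset G (apex v)"
  shows "is_ts_span G \<O> S T v"
proof -
  obtain k where k: "equivariant G (apex v) (apex u) k" "bij_betw k (points (apex v)) (points (apex u))"
    "\<And>x. x \<in> points (apex v) \<Longrightarrow> lleg u (k x) = lleg v x \<and> rleg u (k x) = rleg v x"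
    using span_iso_sym[OF assms(2)] assms(1) unfolding span_iso_def is_ts_span_def by blast
  have kx: "k x \<in> points (apex u)" if "x \<in> points (apex v)" for x
    using k(1) that by (auto simp: equivariant_def)
  have "equivariant G (apex v) T' r" if "equivariant G (apex u) T' r'"
    "\<And>x. x \<in> points (apex v) \<Longrightarrow> r' (k x) = r x" for T' r r'
    unfolding equivariant_def
  proof (intro conjI ballI Pi_I)
    show "r x \<in> points T'" if "x \<in> points (apex v)" for x
      using \<open>equivariant G (apex u) T' r'\<close> kx[OF that] \<open>\<And>x. x \<in> points (apex v) \<Longrightarrow> r' (k x) = r x\<close>[OF that]
      by (auto simp: equivariant_def Pi_iff)
    show "r (act (apex v) g x) = act T' g (r x)" if "g \<in> carrier G" "x \<in> points (apex v)" for g x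
    proof -
      have "r (act (apex v) g x) = r' (k (act (apex v) g x))"
        using \<open>\<And>x. x \<in> points (apex v) \<Longrightarrow> r' (k x) = r x\<close> fin_gset_props(4)[OF assms(3) that] by simp
      also have "\<dots> = r' (act (apex u) g (k x))" using k(1) that by (simp add: equivariant_def)
      also have "\<dots> = act T' g (r' (k x))"
        using \<open>equivariant G (apex u) T' r'\<close> kx[OF that(2)] that(1) by (simp add: equivariant_def)
      finally show ?thesis using \<open>\<And>x. x \<in> points (apex v) \<Longrightarrow> r' (k x) = r x\<close> that by simp
    qed
  qed
  note tr = this
  have "equivariant G (apex v) S (lleg v)"
    by (rule tr[of _ "lleg u"]) (use assms(1) k(3) in \<open>auto simp: is_ts_span_def ts_map_def\<close>)
  moreover have "equivariant G (apex v) T (rleg v)"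
    by (rule tr[of _ "rleg u"]) (use assms(1) k(3) in \<open>auto simp: is_ts_span_def ts_map_def\<close>)
  moreover have "(stab G (apex v) x, stab G T (rleg v x)) \<in> \<O>" if "x \<in> points (apex v)" for x
    using stab_bij[OF k(1,2) that assms(3)] assms(1) kx[OF that] k(3)[OF that]
    by (auto simp: is_ts_span_def ts_map_def)
  ultimately show ?thesis using assms(3) by (simp add: is_ts_span_def ts_map_def)
qed

lemma nat_span:
  fixes u :: "('g, 'x::countable, nat) span"
  assumes u: "is_ts_span G \<O> S T u"
  obtains v :: "('g, nat, nat) span" where "is_ts_span G \<O> S T v" "span_iso G u v"
proof -
  have fu: "is_finite_gset G (apex u)" using u by (simp add: is_ts_span_def)
  let ?P = "to_nat ` points (apex u)"
  define v :: "('g, nat, nat) span" where "v = \<lparr>apex = \<lparr>points = ?P,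
      act = (\<lambda>g. \<lambda>n\<in>?P. to_nat (act (apex u) g (from_nat n)))\<rparr>,
    lleg = (\<lambda>n. lleg u (from_nat n)), rleg = (\<lambda>n. rleg u (from_nat n))\<rparr>"
  have fv: "is_finite_gset G (apex v)"
    by (rule is_finite_gsetI[OF G])
      (use fin_gset_props[OF fu] in \<open>auto simp: v_def monoid.m_closed[OF group.is_monoid]\<close>)
  have iso: "span_iso G u v"
    unfolding span_iso_def
    by (rule exI[of _ to_nat]) (auto simp: v_def equivariant_def bij_betw_def inj_on_def)
  show ?thesis using that ts_span_iso[OF u iso fv] iso by blast
qed

lemma class_self: "is_ts_span G \<O> S T u \<Longrightarrow> u \<in> span_class G \<O> S T u"
  by (simp add: span_class_def span_iso_refl)

lemma cmp_class:
  fixes u v :: "('g, nat, nat) span"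
  assumes u: "is_ts_span G \<O> S T u" and v: "is_ts_span G \<O> T W v"
  shows "Cmp (lindner G \<O>) S T W (span_class G \<O> T W v) (span_class G \<O> S T u) =
    span_class G \<O> S W (span_pullback u v)"
proof -
  have "span_class G \<O> S W (span_pullback u' v') = span_class G \<O> S W (span_pullback u v)"
    if "u' \<in> span_class G \<O> S T u" "v' \<in> span_class G \<O> T W v" for u' v'
  proof -
    have "span_iso G u u'" "span_iso G v v'" using that by (simp_all add: span_class_def)
    then show ?thesis using span_class_eq[OF pb_cong pb_gset[OF u v]] by metis
  qed
  then have "(\<Union>u' \<in> span_class G \<O> S T u. \<Union>v' \<in> span_class G \<O> T W v.
      span_class G \<O> S W (span_pullback u' v')) = span_class G \<O> S W (span_pullback u v)"
    using class_self[OF u] class_self[OF v] by blast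
  then show ?thesis by (simp add: lindner_def)
qed

lemma hom_class:
  fixes u :: "('g, 'x::countable, nat) span"
  assumes u: "is_ts_span G \<O> S T u"
  shows "span_class G \<O> S T u \<in> Hom (lindner G \<O>) S T"
proof -
  obtain v :: "('g, nat, nat) span" where v: "is_ts_span G \<O> S T v" "span_iso G u v"
    using nat_span[OF u] .
  have "span_class G \<O> S T u = span_class G \<O> S T v"
    by (rule span_class_eq[OF v(2)]) (use u in \<open>simp add: is_ts_span_def\<close>)
  then show ?thesis using v(1) unfolding lindner_def by auto
qed

lemma span_id_ts: "is_finite_gset G S \<Longrightarrow> is_ts_span G \<O> S S (span_id S)"
  by (simp add: span_id_def is_ts_span_def ts_map_def equivariant_def O_refl stab_subgroup)

lemma pb_idl:
  assumes "is_ts_span G \<O> S T u"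
  shows "span_iso G (span_pullback (span_id S) u) u"
proof -
  let ?P = "apex (span_pullback (span_id S) u)"
  have eq: "equivariant G (apex u) S (lleg u)" using assms by (simp add: is_ts_span_def)
  have bij: "bij_betw snd (points ?P) (points (apex u))"
    by (rule bij_betw_byWitness[where f' = "\<lambda>x. (lleg u x, x)"])
      (use eq in \<open>auto simp: points_pb span_id_def equivariant_def\<close>)
  moreover have "equivariant G ?P (apex u) snd"
    using bij_betw_imp_funcset[OF bij] by (auto simp: equivariant_def act_pb)
  ultimately show ?thesis unfolding span_iso_def
    by (intro exI[of _ snd]) (auto simp: legs_pb points_pb span_id_def)
qed

lemma pb_idr:
  assumes "is_ts_span G \<O> S T u"
  shows "span_iso G (span_pullback u (span_id T)) u"
proof -
  let ?P = "apex (span_pullback u (span_id T))"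
  have eq: "equivariant G (apex u) T (rleg u)" using assms by (simp add: is_ts_span_def ts_map_def)
  have bij: "bij_betw fst (points ?P) (points (apex u))"
    by (rule bij_betw_byWitness[where f' = "\<lambda>x. (x, rleg u x)"])
      (use eq in \<open>auto simp: points_pb span_id_def equivariant_def\<close>)
  moreover have "equivariant G ?P (apex u) fst"
    using bij_betw_imp_funcset[OF bij] by (auto simp: equivariant_def act_pb)
  ultimately show ?thesis unfolding span_iso_def
    by (intro exI[of _ fst]) (auto simp: legs_pb points_pb span_id_def)
qed

lemma pb_assoc:
  assumes "is_ts_span G \<O> S T u" "is_ts_span G \<O> T W v" "is_ts_span G \<O> W Z w"
  shows "span_iso G (span_pullback (span_pullback u v) w) (span_pullback u (span_pullback v w))"
proof -
  let ?A = "span_pullback (span_pullback u v) w" let ?B = "span_pullback u (span_pullback v w)"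
  let ?k = "\<lambda>((x, y), z). (x, (y, z))"
  have bij: "bij_betw ?k (points (apex ?A)) (points (apex ?B))"
    by (rule bij_betw_byWitness[where f' = "\<lambda>(x, (y, z)). ((x, y), z)"])
       (auto simp: points_pb legs_pb)
  have "?k (act (apex ?A) g p) = act (apex ?B) g (?k p)" if p: "p \<in> points (apex ?A)" for g p
  proof -
    obtain x y z where [simp]: "p = ((x, y), z)" by (metis prod.exhaust)
    have "?k p \<in> points (apex ?B)" using p bij bij_betwE by blast
    then show ?thesis using p
      by (auto simp: act_pb) (auto simp: act_pb points_pb legs_pb)
  qed
  then have "equivariant G (apex ?A) (apex ?B) ?k"
    using bij bij_betw_imp_funcset by (fastforce simp: equivariant_def)
  then show ?thesis unfolding span_iso_def using bij
    by (intro exI[of _ ?k]) (auto simp: legs_pb points_pb)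
qed

lemma hom_cases:
  assumes "\<alpha> \<in> Hom (lindner G \<O>) S T"
  obtains u :: "('g, nat, nat) span" where "is_ts_span G \<O> S T u" "\<alpha> = span_class G \<O> S T u"
  using assms by (auto simp: lindner_def)

theorem category_lindner: "category (lindner G \<O>)"
proof (rule category.intro)
  have idt: "Idt (lindner G \<O>) X = span_class G \<O> X X (span_id X)" for X by (simp add: lindner_def span_id_def)
  have ob: "is_finite_gset G X" if "X \<in> Obj (lindner G \<O>)" for X using that by (simp add: lindner_def)
  show "Idt (lindner G \<O>) X \<in> Hom (lindner G \<O>) X X" if "X \<in> Obj (lindner G \<O>)" for X
  proof -
    have "\<exists>u :: ('g, nat, nat) span. Idt (lindner G \<O>) X = span_class G \<O> X X u \<and> is_ts_span G \<O> X X u"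
      using idt span_id_ts[OF ob[OF that]] by blast
    then show ?thesis by (simp add: lindner_def)
  qed
  show "Cmp (lindner G \<O>) X X Y f (Idt (lindner G \<O>) X) = f" if "X \<in> Obj (lindner G \<O>)" "Y \<in> Obj (lindner G \<O>)" "f \<in> Hom (lindner G \<O>) X Y" for X Y f
  proof -
    from that(3) obtain u :: "('g, nat, nat) span" where u: "is_ts_span G \<O> X Y u" "f = span_class G \<O> X Y u"
      by (rule hom_cases)
    note i = span_id_ts[OF ob[OF that(1)]]
    have "Cmp (lindner G \<O>) X X Y f (Idt (lindner G \<O>) X) = span_class G \<O> X Y (span_pullback (span_id X) u)"
      using cmp_class[OF i u(1)] by (simp only: idt u(2))
    also have "\<dots> = f" using span_class_eq[OF pb_idl[OF u(1)] pb_gset[OF i u(1)]] by (simp only: u(2))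
    finally show ?thesis .
  qed
  show "Cmp (lindner G \<O>) X Y Y (Idt (lindner G \<O>) Y) f = f" if "X \<in> Obj (lindner G \<O>)" "Y \<in> Obj (lindner G \<O>)" "f \<in> Hom (lindner G \<O>) X Y" for X Y f
  proof -
    from that(3) obtain u :: "('g, nat, nat) span" where u: "is_ts_span G \<O> X Y u" "f = span_class G \<O> X Y u"
      by (rule hom_cases)
    note i = span_id_ts[OF ob[OF that(2)]]
    have "Cmp (lindner G \<O>) X Y Y (Idt (lindner G \<O>) Y) f = span_class G \<O> X Y (span_pullback u (span_id Y))"
      using cmp_class[OF u(1) i] by (simp only: idt u(2))
    also have "\<dots> = f" using span_class_eq[OF pb_idr[OF u(1)] pb_gset[OF u(1) i]] by (simp only: u(2))
    finally show ?thesis .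
  qed
  show "Cmp (lindner G \<O>) X Y Z g f \<in> Hom (lindner G \<O>) X Z" if "f \<in> Hom (lindner G \<O>) X Y" "g \<in> Hom (lindner G \<O>) Y Z" for X Y Z f g
  proof -
    from that(1) obtain u :: "('g, nat, nat) span" where u: "is_ts_span G \<O> X Y u" "f = span_class G \<O> X Y u"
      by (rule hom_cases)
    from that(2) obtain v :: "('g, nat, nat) span" where v: "is_ts_span G \<O> Y Z v" "g = span_class G \<O> Y Z v"
      by (rule hom_cases)
    have "Cmp (lindner G \<O>) X Y Z g f = span_class G \<O> X Z (span_pullback u v)"
      using cmp_class[OF u(1) v(1)] by (simp only: u(2) v(2))
    then show ?thesis using hom_class[OF pb_ts_span[OF u(1) v(1)]] by (simp only:)
  qed
  show "Cmp (lindner G \<O>) W Y Z h (Cmp (lindner G \<O>) W X Y g f) = Cmp (lindner G \<O>) W X Z (Cmp (lindner G \<O>) X Y Z h g) f"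
    if "f \<in> Hom (lindner G \<O>) W X" "g \<in> Hom (lindner G \<O>) X Y" "h \<in> Hom (lindner G \<O>) Y Z" for W X Y Z f g h
  proof -
    from that(1) obtain u :: "('g, nat, nat) span" where u: "is_ts_span G \<O> W X u" "f = span_class G \<O> W X u"
      by (rule hom_cases)
    from that(2) obtain v :: "('g, nat, nat) span" where v: "is_ts_span G \<O> X Y v" "g = span_class G \<O> X Y v"
      by (rule hom_cases)
    from that(3) obtain w :: "('g, nat, nat) span" where w: "is_ts_span G \<O> Y Z w" "h = span_class G \<O> Y Z w"
      by (rule hom_cases)
    note Puv = pb_gset[OF u(1) v(1)] and Pvw = pb_gset[OF v(1) w(1)]
    obtain uv :: "('g, nat, nat) span" where uv: "is_ts_span G \<O> W Y uv" "span_iso G (span_pullback u v) uv"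
      by (rule nat_span[OF pb_ts_span[OF u(1) v(1)]])
    obtain vw :: "('g, nat, nat) span" where vw: "is_ts_span G \<O> X Z vw" "span_iso G (span_pullback v w) vw"
      by (rule nat_span[OF pb_ts_span[OF v(1) w(1)]])
    have "Cmp (lindner G \<O>) W X Y g f = span_class G \<O> W Y uv"
      using cmp_class[OF u(1) v(1)] span_class_eq[OF uv(2) Puv] by (simp only: u(2) v(2))
    then have "Cmp (lindner G \<O>) W Y Z h (Cmp (lindner G \<O>) W X Y g f) = span_class G \<O> W Z (span_pullback uv w)"
      using cmp_class[OF uv(1) w(1)] by (simp only: w(2))
    also have "\<dots> = span_class G \<O> W Z (span_pullback (span_pullback u v) w)"
      by (rule span_class_eq[OF pb_cong[OF uv(2) span_iso_refl] pb_gset[OF pb_ts_span[OF u(1) v(1)] w(1)], symmetric])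
    also have "\<dots> = span_class G \<O> W Z (span_pullback u (span_pullback v w))"
      by (rule span_class_eq[OF pb_assoc[OF u(1) v(1) w(1)] pb_gset[OF pb_ts_span[OF u(1) v(1)] w(1)]])
    also have "\<dots> = span_class G \<O> W Z (span_pullback u vw)"
      by (rule span_class_eq[OF pb_cong[OF span_iso_refl vw(2)] pb_gset[OF u(1) pb_ts_span[OF v(1) w(1)]]])
    finally have 1: "Cmp (lindner G \<O>) W Y Z h (Cmp (lindner G \<O>) W X Y g f) = span_class G \<O> W Z (span_pullback u vw)" .
    have "Cmp (lindner G \<O>) X Y Z h g = span_class G \<O> X Z vw"
      using cmp_class[OF v(1) w(1)] span_class_eq[OF vw(2) Pvw] by (simp only: v(2) w(2))
    then have "Cmp (lindner G \<O>) W X Z (Cmp (lindner G \<O>) X Y Z h g) f = span_class G \<O> W Z (span_pullback u vw)"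
      using cmp_class[OF u(1) vw(1)] by (simp only: u(2))
    then show ?thesis using 1 by (simp only:)
  qed
qed

end

lemma category_Ab: "category Ab"
proof
  fix X Y Z :: "'a monoid" and f g
  assume XYZ: "X \<in> Obj Ab" "Y \<in> Obj Ab" "Z \<in> Obj Ab"
    and f: "f \<in> Hom Ab X Y" and g: "g \<in> Hom Ab Y Z"
  interpret X: comm_group X using XYZ by (simp add: Ab_def)
  show "Cmp Ab X Y Z g f \<in> Hom Ab X Z"
    using f g by (auto simp: Ab_def hom_def compose_def Pi_iff)
next
  fix X :: "'a monoid" assume "X \<in> Obj Ab"
  then interpret X: comm_group X by (simp add: Ab_def)
  show "Idt Ab X \<in> Hom Ab X X" by (auto simp: Ab_def hom_def)
qed (auto simp: Ab_def hom_def compose_def extensional_def fun_eq_iff Pi_iff)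

lemma category_functor_category:
  assumes "category C" "category D" shows "category (functor_category C D)"
proof -
  interpret C: category C by fact
  interpret D: category D by fact
  show ?thesis
    apply unfold_locales
    subgoal for F by (auto simp: functor_category_def nat_trans_def is_functor_def D.idt_in_hom D.cmp_idt_left D.cmp_idt_right)
    subgoal for F K M \<sigma> \<tau>
      apply (auto simp: functor_category_def nat_trans_def is_functor_def D.cmp_in_hom)
      by (smt (verit) D.cmp_assoc)
    subgoal by (auto simp: functor_category_def nat_trans_def is_functor_def D.cmp_idt_right extensional_def fun_eq_iff)
    subgoal by (auto simp: functor_category_def nat_trans_def is_functor_def D.cmp_idt_left extensional_def fun_eq_iff)
    subgoal by (auto simp: functor_category_def nat_trans_def is_functor_def D.cmp_assoc extensional_def fun_eq_iff)
    done
qed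

end

theory Submission
  imports Defs
begin

text \<open>
  Let \<open>w = |N H : H|\<close> and let \<open>p : X \<times> G/H \<rightarrow> X\<close> be the projection. It lies in the wide subcategory since
  \<open>H \<rightarrow> G\<close>, and all stabilisers of \<open>X \<times> G/H\<close> are subconjugate to \<open>H\<close>. On an above-\<open>[H]\<close> functor only the
  points with stabiliser above \<open>[H]\<close> matter, and over an \<open>X\<close> with stabilisers subconjugate to \<open>H\<close> these form
  a stabiliser preserving \<open>w\<close>-fold cover of the corresponding part of \<open>X\<close>; so restriction along \<open>p\<close>
  followed by transfer is multiplication by \<open>w\<close> on \<open>M(X)\<close>. Both maps are natural in \<open>X\<close> because
  \<open>- \<times> G/H\<close> is a base change. Hence, \<open>w\<close> being invertible on \<open>M\<close>, every map \<open>\<phi>\<close> from \<open>Res M\<close> to \<open>Res L\<close>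
  extends to \<open>transfer \<circ> \<phi> \<circ> restriction / w\<close> from \<open>M\<close> to \<open>L\<close>, and likewise for maps into \<open>Res M\<close>.
  The extension \<open>s\<close> of the unit \<open>Res M \<rightarrow> Res Ind Res M\<close> and the extension \<open>t\<close> of the counit
  \<open>Res CoInd Res M \<rightarrow> Res M\<close> satisfy \<open>s \<epsilon> = 1\<close>, \<open>\<eta>' t = 1\<close> and \<open>\<epsilon> s = t \<eta>'\<close>, the idempotent \<open>[G/H] / w\<close> of \<open>M\<close>;
  so \<open>s t\<close> is inverse to \<open>\<eta>' \<epsilon>\<close>. Only the universal properties of \<open>Ind\<close> and \<open>CoInd\<close> are used.
\<close>

section \<open>Finite \<open>G\<close>-sets and transfer systems\<close>

text \<open>Objects of the Lindner category have natural numbers as points. A finite point set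
  injects into \<open>nat\<close>, and the action is carried along the injection.\<close>

lemma nat_gset:
  fixes S :: "('g, 'x) gset"
  assumes "is_finite_gset G S"
  obtains T :: "('g, nat) gset" where "is_finite_gset G T" "gset_iso G S T"
proof -
  note S = fin_gset_props[OF assms]
  obtain f :: "'x \<Rightarrow> nat" where f: "inj_on f (points S)"
    using finite_imp_inj_to_nat_seg[OF S(1)] by blast
  define T where "T = \<lparr>points = f ` points S,
    act = (\<lambda>g. \<lambda>n \<in> f ` points S. f (act S g (inv_into (points S) f n)))\<rparr>"
  have act: "act T g (f x) = f (act S g x)" if "x \<in> points S" for g x
    using that f by (simp add: T_def)
  have pts: "points T = f ` points S" by (simp add: T_def)
  have "is_finite_gset G T"
  proof (rule is_finite_gsetI[OF S(2)])
    show "act T g \<in> extensional (points T)" for g by (simp add: T_def)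
  qed (use S in \<open>auto simp: pts act monoid.m_closed[OF group.is_monoid]\<close>)
  moreover have "gset_iso G S T"
    unfolding gset_iso_def
    by (rule exI[of _ f]) (auto simp: equivariant_def act pts bij_betw_def f)
  ultimately show ?thesis by (rule that)
qed

definition invariant_subset :: "('g, 'e) monoid_scheme \<Rightarrow> ('g, 'x) gset \<Rightarrow> 'x set \<Rightarrow> bool" where
  "invariant_subset G X A \<longleftrightarrow> A \<subseteq> points X \<and> (\<forall>g \<in> carrier G. \<forall>x \<in> A. act X g x \<in> A)"

text \<open>The action is cut off outside \<open>A\<close> because \<open>group_action\<close> takes
  values in \<open>BijGroup A\<close>, whose elements are extensional functions.\<close>

definition sub_gset :: "('g, 'x) gset \<Rightarrow> 'x set \<Rightarrow> ('g, 'x) gset" where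
  "sub_gset X A = \<lparr>points = A, act = (\<lambda>g. restrict (act X g) A)\<rparr>"

lemma points_sub_gset [simp]: "points (sub_gset X A) = A"
  by (simp add: sub_gset_def)

lemma act_sub_gset [simp]: "x \<in> A \<Longrightarrow> act (sub_gset X A) g x = act X g x"
  by (simp add: sub_gset_def)

definition orbit_set :: "('g, 'e) monoid_scheme \<Rightarrow> ('g, 'x) gset \<Rightarrow> 'x \<Rightarrow> 'x set" where
  "orbit_set G X x = (\<lambda>g. act X g x) ` carrier G"

locale finite_transfer_system = group G + transfer_system G \<O>
  for G :: "('g, 'e) monoid_scheme" (structure) and \<O> +
  assumes finite_carrier: "finite (carrier G)"
begin

lemmas ts_facts = is_group transfer_system_axioms

lemma \<O>_refl: "subgroup K G \<Longrightarrow> (K, K) \<in> \<O>"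
  by (rule O_refl[OF ts_facts])

lemma \<O>_trans: "(K, L) \<in> \<O> \<Longrightarrow> (L, J) \<in> \<O> \<Longrightarrow> (K, J) \<in> \<O>"
  by (rule O_trans[OF ts_facts])

lemma \<O>_subgroups: "(K, L) \<in> \<O> \<Longrightarrow> subgroup K G \<and> subgroup L G"
  using partial_order by (auto simp: partial_order_on_def preorder_on_def)

section \<open>Conjugate subgroups\<close>

lemma mem_conj_subgroup:
  assumes "g \<in> carrier G" "K \<subseteq> carrier G"
  shows "y \<in> conj_subgroup G g K \<longleftrightarrow> y \<in> carrier G \<and> inv g \<otimes> y \<otimes> g \<in> K"
proof
  assume "y \<in> conj_subgroup G g K"
  then obtain k where k: "k \<in> K" "y = g \<otimes> k \<otimes> inv g" by (auto simp: l_coset_def r_coset_def)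
  then have "k \<in> carrier G" using assms by blast
  then have "inv g \<otimes> y \<otimes> g = k" using assms k by (simp add: m_assoc) (simp flip: m_assoc)
  then show "y \<in> carrier G \<and> inv g \<otimes> y \<otimes> g \<in> K" using k assms \<open>k \<in> carrier G\<close> by simp
next
  assume y: "y \<in> carrier G \<and> inv g \<otimes> y \<otimes> g \<in> K"
  then have "g \<otimes> (inv g \<otimes> y \<otimes> g) \<otimes> inv g = (g \<otimes> inv g) \<otimes> y \<otimes> (g \<otimes> inv g)"
    using assms by (simp only: m_assoc inv_closed m_closed)
  then have "y = g \<otimes> (inv g \<otimes> y \<otimes> g) \<otimes> inv g"
    using y assms by simp
  then show "y \<in> conj_subgroup G g K"
    using y by (auto simp: l_coset_def r_coset_def)
qed

lemma conj_subgroup_closed: "g \<in> carrier G \<Longrightarrow> K \<subseteq> carrier G \<Longrightarrow> conj_subgroup G g K \<subseteq> carrier G"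
  using mem_conj_subgroup by blast

lemma card_conj_subgroup:
  assumes "g \<in> carrier G" "K \<subseteq> carrier G"
  shows "card (conj_subgroup G g K) = card K"
proof -
  have "conj_subgroup G g K = (\<lambda>k. g \<otimes> k \<otimes> inv g) ` K" by (auto simp: l_coset_def r_coset_def)
  moreover have "inj_on (\<lambda>k. g \<otimes> k \<otimes> inv g) K"
    using assms by (auto intro!: inj_onI simp: subset_iff)
  ultimately show ?thesis by (simp add: card_image)
qed

lemma conj_subgroup_conj:
  assumes "g \<in> carrier G" "h \<in> carrier G" "K \<subseteq> carrier G"
  shows "conj_subgroup G g (conj_subgroup G h K) = conj_subgroup G (g \<otimes> h) K"
proof -
  have "y \<in> conj_subgroup G g (conj_subgroup G h K) \<longleftrightarrow> y \<in> conj_subgroup G (g \<otimes> h) K" for y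
    unfolding mem_conj_subgroup[OF assms(1) conj_subgroup_closed[OF assms(2,3)]]
      mem_conj_subgroup[OF assms(2,3)] mem_conj_subgroup[OF m_closed[OF assms(1,2)] assms(3)]
    using assms by (auto simp: inv_mult_group m_assoc)
  then show ?thesis by blast
qed

lemma conj_subgroup_one: "K \<subseteq> carrier G \<Longrightarrow> conj_subgroup G \<one> K = K"
  by (simp add: coset_mult_one lcos_mult_one)

lemma conj_subgroup_carrier: "g \<in> carrier G \<Longrightarrow> conj_subgroup G g (carrier G) = carrier G"
  by (auto simp: mem_conj_subgroup)

text \<open>All conjugates of \<open>K\<close> have the same finite cardinality, so none lies
  properly inside another.\<close>

lemma conj_subgroup_subset_eq:
  assumes "g \<in> carrier G" "h \<in> carrier G" "K \<subseteq> carrier G"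
    "conj_subgroup G g K \<subseteq> conj_subgroup G h K"
  shows "conj_subgroup G g K = conj_subgroup G h K"
  using assms card_conj_subgroup conj_subgroup_closed finite_carrier
  by (metis card_subset_eq finite_subset)

text \<open>Makes the candidates for a hull closed under intersection: restrict
  \<open>K \<rightarrow> G\<close> to \<open>L\<close> and compose with
  \<open>L \<rightarrow> G\<close>.\<close>

lemma inter_to_top:
  assumes "(K, carrier G) \<in> \<O>" "(L, carrier G) \<in> \<O>"
  shows "(K \<inter> L, carrier G) \<in> \<O>"
proof -
  have "subgroup L G" using \<O>_subgroups[OF assms(2)] by simp
  then have "(K \<inter> L, L) \<in> \<O>" using restriction[OF assms(1)] subgroup.subset by blast
  then show ?thesis using assms(2) \<O>_trans by blast
qed

text \<open>The subgroups \<open>L \<rightarrow> G\<close> containing \<open>J\<close> form a finite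
  family that has \<open>carrier G\<close> as a member and is closed under intersection. The
  intersection of the family is its least member, so the \<open>THE\<close> in
  \<open>ts_hull\<close> is meaningful.\<close>

lemma ts_hull_properties:
  assumes "subgroup J G"
  shows "(ts_hull G \<O> J, carrier G) \<in> \<O> \<and> J \<subseteq> ts_hull G \<O> J \<and>
    (\<forall>L. (L, carrier G) \<in> \<O> \<and> J \<subseteq> L \<longrightarrow> ts_hull G \<O> J \<subseteq> L)"
proof -
  let ?F = "{L. (L, carrier G) \<in> \<O> \<and> J \<subseteq> L}"
  let ?P = "\<lambda>H. (H, carrier G) \<in> \<O> \<and> J \<subseteq> H \<and> (\<forall>H'. (H', carrier G) \<in> \<O> \<and> J \<subseteq> H' \<longrightarrow> H \<subseteq> H')"
  have "?F \<subseteq> Pow (carrier G)" using refines_inclusion by blast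
  then have "finite ?F" using finite_carrier by (meson finite_Pow_iff finite_subset)
  have "carrier G \<in> ?F" using \<O>_refl subgroup_self subgroup.subset[OF assms] by blast
  have "(\<Inter>E, carrier G) \<in> \<O>" if "finite E" "E \<noteq> {}" "E \<subseteq> ?F" for E
    using that by (induction E rule: finite_ne_induct) (auto intro: inter_to_top)
  then have "?P (\<Inter>?F)" using \<open>finite ?F\<close> \<open>carrier G \<in> ?F\<close> by blast
  then have "\<exists>!H. ?P H" by (metis (no_types, lifting) subset_antisym)
  from theI'[OF this] show ?thesis unfolding ts_hull_def by blast
qed

section \<open>Stabilisers, invariant subsets and orbits\<close>

lemma act_inv:
  assumes "is_finite_gset G X" "g \<in> carrier G" "x \<in> points X"
  shows "act X (inv g) (act X g x) = x" "act X g (act X (inv g) x) = x"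
  using fin_gset_props(5)[OF assms(1,3)] fin_gset_props(6)[OF assms(1) _ _ assms(3)] assms(2)
  by (metis inv_closed l_inv, metis inv_closed r_inv)

lemma mem_stab: "g \<in> stab G X x \<longleftrightarrow> g \<in> carrier G \<and> act X g x = x"
  by (simp add: stab_def stabilizer_def)

lemma stab_act:
  assumes "is_finite_gset G X" "g \<in> carrier G" "x \<in> points X"
  shows "stab G X (act X g x) = conj_subgroup G g (stab G X x)"
proof -
  have "y \<in> stab G X (act X g x) \<longleftrightarrow> y \<in> conj_subgroup G g (stab G X x)" for y
  proof -
    have "act X y (act X g x) = act X g x \<longleftrightarrow> act X (inv g) (act X y (act X g x)) = x" if "y \<in> carrier G"
      using act_inv[OF assms(1)] fin_gset_props(4)[OF assms(1)] assms that by metis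
    then show ?thesis
      using assms by (subst mem_conj_subgroup)
        (auto simp: mem_stab fin_gset_props(6)[OF assms(1)] fin_gset_props(4)[OF assms(1)] stab_def stabilizer_def)
  qed
  then show ?thesis by blast
qed

lemma invariant_iff:
  assumes "is_finite_gset G X" "invariant_subset G X A" "g \<in> carrier G" "x \<in> points X"
  shows "act X g x \<in> A \<longleftrightarrow> x \<in> A"
  using assms act_inv(1)[OF assms(1,3,4)] by (metis invariant_subset_def inv_closed)

lemma invariant_Diff:
  assumes "is_finite_gset G X" "invariant_subset G X A"
  shows "invariant_subset G X (points X - A)"
  using invariant_iff[OF assms] fin_gset_props(4)[OF assms(1)] by (auto simp: invariant_subset_def)

lemma invariant_vimage:
  assumes "is_finite_gset G X" "equivariant G X Y f" "invariant_subset G Y A"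
  shows "invariant_subset G X {x \<in> points X. f x \<in> A}"
  using assms fin_gset_props(4)[OF assms(1)] by (auto simp: invariant_subset_def equivariant_def)

lemma invariant_image:
  assumes "is_finite_gset G X" "equivariant G X Y f"
  shows "invariant_subset G Y (f ` points X)"
  using assms fin_gset_props(4)[OF assms(1)]
  by (auto simp: invariant_subset_def equivariant_def) (metis image_eqI)

lemma sub_gset_finite:
  assumes "is_finite_gset G X" "invariant_subset G X A"
  shows "is_finite_gset G (sub_gset X A)"
proof (rule is_finite_gsetI[OF is_group])
  have A: "A \<subseteq> points X" "\<And>g x. g \<in> carrier G \<Longrightarrow> x \<in> A \<Longrightarrow> act X g x \<in> A"
    using assms by (auto simp: invariant_subset_def)
  note X = fin_gset_props[OF assms(1)]
  show "finite (points (sub_gset X A))" using A X(1) finite_subset by auto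
  show "act (sub_gset X A) g \<in> extensional (points (sub_gset X A))" for g by (simp add: sub_gset_def)
qed (use assms fin_gset_props[OF assms(1)] in \<open>auto simp: invariant_subset_def subset_iff\<close>)

lemma sub_gset_incl: "invariant_subset G X A \<Longrightarrow> equivariant G (sub_gset X A) X (\<lambda>x. x)"
  by (auto simp: invariant_subset_def equivariant_def)

lemma stab_sub_gset [simp]: "x \<in> A \<Longrightarrow> stab G (sub_gset X A) x = stab G X x"
  by (auto simp: set_eq_iff mem_stab)

lemma orbit_invariant:
  assumes "is_finite_gset G X" "x \<in> points X"
  shows "invariant_subset G X (orbit_set G X x)"
  using fin_gset_props(4)[OF assms(1)] assms(2)
  by (auto simp: invariant_subset_def orbit_set_def)
    (metis fin_gset_props(6)[OF assms(1)] image_eqI m_closed)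

lemma orbit_self:
  assumes "is_finite_gset G X" "x \<in> points X"
  shows "x \<in> orbit_set G X x"
  using fin_gset_props(5)[OF assms] by (auto simp: orbit_set_def intro!: image_eqI[where x = \<one>])

lemma act_eq_iff:
  assumes "is_finite_gset G X" "x \<in> points X" "g \<in> carrier G" "h \<in> carrier G"
  shows "act X g x = act X h x \<longleftrightarrow> inv g \<otimes> h \<in> stab G X x"
proof -
  note cl = fin_gset_props(4)[OF assms(1)]
  have "act X g x = act X h x \<longleftrightarrow> x = act X (inv g) (act X h x)"
    using act_inv[OF assms(1,3)] cl assms(2-4) by (metis inv_closed)
  then show ?thesis
    using assms(2-4) fin_gset_props(6)[OF assms(1) inv_closed] by (auto simp: mem_stab)
qed

section \<open>Orbits as coset sets G/K\<close>

lemma lcosetE: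
  assumes "A \<in> lcosets K"
  obtains a where "a \<in> carrier G" "A = a <# K"
  using assms by (auto simp: LCOSETS_def)

lemma mem_lcoset:
  assumes "a \<in> carrier G" "K \<subseteq> carrier G"
  shows "b \<in> a <# K \<longleftrightarrow> b \<in> carrier G \<and> inv a \<otimes> b \<in> K"
proof
  assume "b \<in> a <# K"
  then show "b \<in> carrier G \<and> inv a \<otimes> b \<in> K"
    using assms by (auto simp: l_coset_def subset_iff simp flip: m_assoc)
next
  assume "b \<in> carrier G \<and> inv a \<otimes> b \<in> K"
  moreover have "b = a \<otimes> (inv a \<otimes> b)" if "b \<in> carrier G"
    using that assms by (simp flip: m_assoc)
  ultimately show "b \<in> a <# K" by (auto simp: l_coset_def)
qed

text \<open>The orbit-stabiliser theorem as an isomorphism of G-sets. Vanishing of a functor is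
  stated at \<open>coset_gset\<close>, whereas G-sets will be cut into orbits; this connects the
  two.\<close>

lemma coset_gset_orbit_iso:
  assumes X: "is_finite_gset G X" and x: "x \<in> points X"
  shows "gset_iso G (coset_gset G (stab G X x)) (sub_gset X (orbit_set G X x))"
proof -
  let ?K = "stab G X x" let ?C = "coset_gset G ?K" let ?O = "sub_gset X (orbit_set G X x)"
  \<comment> \<open>The choice is harmless: two representatives of a coset differ by an element of
    the stabiliser and so move \<open>x\<close> to the same point.\<close>
  define k where "k A = act X (SOME a. a \<in> A \<and> a \<in> carrier G) x" for A
  have K: "?K \<subseteq> carrier G" using stab_subgroup[OF X x] subgroup.subset by blast
  have k: "k (a <# ?K) = act X a x" if a: "a \<in> carrier G" for a
  proof -
    have "\<exists>b. b \<in> a <# ?K \<and> b \<in> carrier G" using a lcos_self stab_subgroup[OF X x] by blast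
    from someI_ex[OF this] show ?thesis unfolding k_def
      using act_eq_iff[OF X x a] mem_lcoset[OF a K] by metis
  qed
  have eq: "a <# ?K = b <# ?K" if "a \<in> carrier G" "b \<in> carrier G" "act X a x = act X b x" for a b
  proof -
    have "c \<in> a <# ?K \<longleftrightarrow> c \<in> b <# ?K" for c
      using that mem_lcoset[OF _ K] act_eq_iff[OF X x] by metis
    then show ?thesis by blast
  qed
  have lc: "a <# ?K \<in> lcosets ?K" if "a \<in> carrier G" for a using that by (auto simp: LCOSETS_def)
  have "equivariant G ?C ?O k"
    unfolding equivariant_def
  proof (intro conjI ballI Pi_I)
    fix A assume "A \<in> points ?C"
    then obtain a where a: "a \<in> carrier G" "A = a <# ?K" by (auto simp: coset_gset_def elim: lcosetE)
    then show kA: "k A \<in> points ?O" by (auto simp: k orbit_set_def)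
    fix g assume g: "g \<in> carrier G"
    have "act ?C g A = g <# A" using a lc by (simp add: coset_gset_def)
    also have "\<dots> = (g \<otimes> a) <# ?K" using a g K by (simp add: lcos_m_assoc)
    finally show "k (act ?C g A) = act ?O g (k A)"
      using kA a g x by (simp add: k fin_gset_props(6)[OF X])
  qed
  moreover have "bij_betw k (points ?C) (points ?O)"
    unfolding bij_betw_def
  proof
    show "inj_on k (points ?C)"
    proof (rule inj_onI)
      fix A B assume AB: "A \<in> points ?C" "B \<in> points ?C" "k A = k B"
      then obtain a b where "a \<in> carrier G" "A = a <# ?K" "b \<in> carrier G" "B = b <# ?K"
        by (auto simp: coset_gset_def elim!: lcosetE)
      then show "A = B" using AB(3) k eq by metis
    qed
    show "k ` points ?C = points ?O"
      using k lc by (auto simp: coset_gset_def orbit_set_def image_iff elim!: lcosetE) metis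
  qed
  ultimately show ?thesis unfolding gset_iso_def by blast
qed

lemma coset_gset_finite:
  assumes "subgroup K G"
  shows "is_finite_gset G (coset_gset G K)"
proof (rule is_finite_gsetI[OF is_group])
  have K: "K \<subseteq> carrier G" using assms subgroup.subset by blast
  have A: "A \<subseteq> carrier G" if "A \<in> lcosets K" for A
    using lcosets_subset_PowG[OF assms] that by blast
  show "finite (points (coset_gset G K))"
    using finite_carrier lcosets_subset_PowG[OF assms]
    by (simp add: coset_gset_def) (meson finite_Pow_iff finite_subset)
  have cl: "g <# A \<in> lcosets K" if "g \<in> carrier G" "A \<in> lcosets K" for g A
    using that K by (auto simp: LCOSETS_def lcos_m_assoc intro!: bexI[of _ "g \<otimes> _"])
  show "act (coset_gset G K) g \<in> extensional (points (coset_gset G K))" for g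
    by (simp add: coset_gset_def)
  show "act (coset_gset G K) g A \<in> points (coset_gset G K)"
    if "g \<in> carrier G" "A \<in> points (coset_gset G K)" for g A
    using that cl by (simp add: coset_gset_def)
  show "act (coset_gset G K) \<one> A = A" if "A \<in> points (coset_gset G K)" for A
    using that A by (simp add: coset_gset_def lcos_mult_one)
  show "act (coset_gset G K) (g \<otimes> h) A = act (coset_gset G K) g (act (coset_gset G K) h A)"
    if "g \<in> carrier G" "h \<in> carrier G" "A \<in> points (coset_gset G K)" for g h A
    using that A cl by (simp add: coset_gset_def lcos_m_assoc)
qed

lemma stab_coset_gset:
  assumes "subgroup K G" "a \<in> carrier G"
  shows "stab G (coset_gset G K) (a <# K) = conj_subgroup G a K"
proof -
  let ?C = "coset_gset G K"
  have Kc: "K \<subseteq> carrier G" using assms subgroup.subset by blast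
  have K: "K \<in> points ?C" using lcos_mult_one[OF Kc]
    by (auto simp: coset_gset_def LCOSETS_def intro!: bexI[of _ \<one>])
  have "stab G ?C K = K"
    using coset_join3[OF _ assms(1)] K Kc
    by (auto simp: mem_stab coset_gset_def) (metis assms(1) lcos_self)
  moreover have "act ?C a K = a <# K" using K by (simp add: coset_gset_def)
  ultimately show ?thesis using stab_act[OF coset_gset_finite[OF assms(1)] assms(2) K] by simp
qed

text \<open>A copy of G/K among the objects of the Lindner category, described by its stabilisers,
  which is how it enters the degree count.\<close>

lemma nat_gset_of_subgroup:
  assumes "subgroup K G"
  obtains Q :: "('g, nat) gset" where "is_finite_gset G Q"
    "\<And>q. q \<in> points Q \<Longrightarrow> \<exists>g \<in> carrier G. stab G Q q = conj_subgroup G g K"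
    "\<exists>q \<in> points Q. stab G Q q = K"
proof -
  let ?C = "coset_gset G K"
  have C: "is_finite_gset G ?C" by (rule coset_gset_finite[OF assms])
  obtain Q :: "('g, nat) gset" where Q: "is_finite_gset G Q" "gset_iso G ?C Q" using nat_gset[OF C] .
  then obtain k where k: "equivariant G ?C Q k" "bij_betw k (points ?C) (points Q)"
    unfolding gset_iso_def by blast
  have st: "stab G Q (k (a <# K)) = conj_subgroup G a K" "k (a <# K) \<in> points Q" if "a \<in> carrier G" for a
  proof -
    have "a <# K \<in> points ?C" using that by (auto simp: coset_gset_def LCOSETS_def)
    then show "stab G Q (k (a <# K)) = conj_subgroup G a K" "k (a <# K) \<in> points Q"
      using stab_bij[OF k _ C] stab_coset_gset[OF assms that] k(2) by (auto simp: bij_betw_def)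
  qed
  show ?thesis
  proof
    show "is_finite_gset G Q" by fact
    show "\<exists>g \<in> carrier G. stab G Q q = conj_subgroup G g K" if "q \<in> points Q" for q
    proof -
      have "q \<in> k ` points ?C" using that k(2) by (simp add: bij_betw_def)
      then show ?thesis using st by (auto simp: coset_gset_def elim!: lcosetE)
    qed
    show "\<exists>q \<in> points Q. stab G Q q = K"
      using st[of \<one>] conj_subgroup_one[OF subgroup.subset[OF assms]] by auto
  qed
qed

text \<open>Since \<open>H \<rightarrow> G\<close>, the subgroup \<open>H\<close> is its own hull,
  so a member \<open>I\<close> of the class inside \<open>J\<close> has a conjugate of
  \<open>H\<close> as hull. Every conjugate of \<open>H\<close> containing \<open>J\<close> is a
  candidate for this hull, hence contains it, and equals it by cardinality. This uniqueness later
  fixes the size of the fibres.\<close>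

lemma above_class_conj_unique:
  assumes H: "subgroup H G" "(H, carrier G) \<in> \<O>" and J: "above_class G \<O> H J"
    and b: "b \<in> carrier G" "J \<subseteq> conj_subgroup G b H"
    and d: "d \<in> carrier G" "J \<subseteq> conj_subgroup G d H"
  shows "conj_subgroup G b H = conj_subgroup G d H"
proof -
  have Hc: "H \<subseteq> carrier G" using H subgroup.subset by blast
  have "ts_hull G \<O> H = H" using ts_hull_properties[OF H(1)] H(2) by blast
  then obtain I c where I: "I \<subseteq> J" "subgroup I G" "c \<in> carrier G" "ts_hull G \<O> I = conj_subgroup G c H"
    using J by (auto simp: above_class_def insep_class_def inseparable_def)
  have "conj_subgroup G c H = conj_subgroup G e H" if e: "e \<in> carrier G" "J \<subseteq> conj_subgroup G e H" for e
  proof (rule conj_subgroup_subset_eq[OF I(3) e(1) Hc])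
    have "(conj_subgroup G e H, carrier G) \<in> \<O>"
      using conjugation[OF H(2) e(1)] conj_subgroup_carrier[OF e(1)] by simp
    then show "conj_subgroup G c H \<subseteq> conj_subgroup G e H"
      using ts_hull_properties[OF I(2)] I(1,4) e(2) by (metis subset_trans)
  qed
  from this[OF b] this[OF d] show ?thesis by simp
qed

lemma above_class_mono: "above_class G \<O> H J \<Longrightarrow> J \<subseteq> K \<Longrightarrow> above_class G \<O> H K"
  unfolding above_class_def by blast

end

section \<open>Spans in the Lindner category\<close>

text \<open>Restriction along \<open>f : A \<rightarrow> X\<close>, a morphism from \<open>X\<close>
  to \<open>A\<close>; the transfer \<open>tr_span A f\<close> goes from \<open>A\<close> to
  \<open>X\<close>.\<close>

definition res_span :: "('g, nat) gset \<Rightarrow> (nat \<Rightarrow> nat) \<Rightarrow> ('g, nat, nat) span" where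
  "res_span A f = \<lparr>apex = A, lleg = f, rleg = (\<lambda>x. x)\<rparr>"

definition tr_span :: "('g, nat) gset \<Rightarrow> (nat \<Rightarrow> nat) \<Rightarrow> ('g, nat, nat) span" where
  "tr_span A f = \<lparr>apex = A, lleg = (\<lambda>x. x), rleg = f\<rparr>"

lemma res_span_simps [simp]:
  "apex (res_span A f) = A" "lleg (res_span A f) = f" "rleg (res_span A f) = (\<lambda>x. x)"
  by (simp_all add: res_span_def)

lemma tr_span_simps [simp]:
  "apex (tr_span A f) = A" "lleg (tr_span A f) = (\<lambda>x. x)" "rleg (tr_span A f) = f"
  by (simp_all add: tr_span_def)

definition span_part :: "('g, 'x, 'y) span \<Rightarrow> 'x set \<Rightarrow> ('g, 'x, 'y) span" where
  "span_part u A = u\<lparr>apex := sub_gset (apex u) A\<rparr>"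

lemma span_part_simps [simp]:
  "apex (span_part u A) = sub_gset (apex u) A" "lleg (span_part u A) = lleg u"
  "rleg (span_part u A) = rleg u"
  by (simp_all add: span_part_def)

text \<open>The points lie in a sum type instead of \<open>nat\<close>. A sum of countable types is
  countable, which is enough for \<open>hom_class\<close> to yield a morphism.\<close>

definition sum_gset :: "('g, 'x) gset \<Rightarrow> ('g, 'y) gset \<Rightarrow> ('g, 'x + 'y) gset" where
  "sum_gset X Y = \<lparr>points = points X <+> points Y,
     act = (\<lambda>g. \<lambda>z \<in> points X <+> points Y. map_sum (act X g) (act Y g) z)\<rparr>"

lemma sum_gset_simps [simp]:
  "points (sum_gset X Y) = points X <+> points Y"
  "x \<in> points X \<Longrightarrow> act (sum_gset X Y) g (Inl x) = Inl (act X g x)"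
  "y \<in> points Y \<Longrightarrow> act (sum_gset X Y) g (Inr y) = Inr (act Y g y)"
  by (auto simp: sum_gset_def)

definition sum_span :: "('g, 'x, 'z) span \<Rightarrow> ('g, 'y, 'z) span \<Rightarrow> ('g, 'x + 'y, 'z) span" where
  "sum_span u v = \<lparr>apex = sum_gset (apex u) (apex v),
     lleg = case_sum (lleg u) (lleg v), rleg = case_sum (rleg u) (rleg v)\<rparr>"

lemma sum_span_simps [simp]:
  "apex (sum_span u v) = sum_gset (apex u) (apex v)"
  "lleg (sum_span u v) = case_sum (lleg u) (lleg v)"
  "rleg (sum_span u v) = case_sum (rleg u) (rleg v)"
  by (simp_all add: sum_span_def)

text \<open>The pairing function keeps products of G-sets inside \<open>nat\<close>, so that they
  are again objects of the Lindner category.\<close>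

definition pair :: "nat \<Rightarrow> nat \<Rightarrow> nat" where "pair x y = prod_encode (x, y)"
definition pr1 :: "nat \<Rightarrow> nat" where "pr1 n = fst (prod_decode n)"
definition pr2 :: "nat \<Rightarrow> nat" where "pr2 n = snd (prod_decode n)"

lemma pair_simps [simp]: "pr1 (pair x y) = x" "pr2 (pair x y) = y" "pair (pr1 n) (pr2 n) = n"
    "pair x y = pair x' y' \<longleftrightarrow> x = x' \<and> y = y'"
  by (simp_all add: pair_def pr1_def pr2_def)

lemma pair_eqI: "pr1 m = pr1 n \<Longrightarrow> pr2 m = pr2 n \<Longrightarrow> m = n"
  by (metis pair_simps(3))

definition prod_gset :: "('g, nat) gset \<Rightarrow> ('g, nat) gset \<Rightarrow> ('g, nat) gset" where
  "prod_gset X Y = \<lparr>points = {n. pr1 n \<in> points X \<and> pr2 n \<in> points Y},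
     act = (\<lambda>g. \<lambda>n \<in> {n. pr1 n \<in> points X \<and> pr2 n \<in> points Y}.
       pair (act X g (pr1 n)) (act Y g (pr2 n)))\<rparr>"

lemma points_prod_gset [simp]: "n \<in> points (prod_gset X Y) \<longleftrightarrow> pr1 n \<in> points X \<and> pr2 n \<in> points Y"
  by (simp add: prod_gset_def)

lemma act_prod_gset [simp]: "pr1 n \<in> points X \<Longrightarrow> pr2 n \<in> points Y \<Longrightarrow>
  act (prod_gset X Y) g n = pair (act X g (pr1 n)) (act Y g (pr2 n))"
  by (simp add: prod_gset_def)

text \<open>Supplies the morphism from \<open>prod_gset X Y\<close> to \<open>prod_gset X' Y\<close>
  that lies over a morphism from \<open>X\<close> to \<open>X'\<close>.\<close>

definition prod_span :: "('g, nat, nat) span \<Rightarrow> ('g, nat) gset \<Rightarrow> ('g, nat, nat) span" where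
  "prod_span u Y = \<lparr>apex = prod_gset (apex u) Y,
     lleg = (\<lambda>n. pair (lleg u (pr1 n)) (pr2 n)), rleg = (\<lambda>n. pair (rleg u (pr1 n)) (pr2 n))\<rparr>"

lemma prod_span_simps [simp]:
  "apex (prod_span u Y) = prod_gset (apex u) Y"
  "lleg (prod_span u Y) n = pair (lleg u (pr1 n)) (pr2 n)"
  "rleg (prod_span u Y) n = pair (rleg u (pr1 n)) (pr2 n)"
  by (simp_all add: prod_span_def)

section \<open>Equality and composition of span classes\<close>

context finite_transfer_system
begin

abbreviation lin where "lin \<equiv> lindner G \<O>"
abbreviation cls :: "'g lobj \<Rightarrow> 'g lobj \<Rightarrow> ('g, 'x, nat) span \<Rightarrow> 'g lmor" where
  "cls \<equiv> span_class G \<O>"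

lemma Obj_lin [simp]: "X \<in> Obj lin \<longleftrightarrow> is_finite_gset G X"
  by (simp add: lindner_def)

lemma Idt_lin: "Idt lin X = cls X X (span_id X)"
  by (simp add: lindner_def)

lemma cls_in_Hom:
  fixes u :: "('g, 'x::countable, nat) span"
  shows "is_ts_span G \<O> X Y u \<Longrightarrow> cls X Y u \<in> Hom lin X Y"
  by (rule hom_class[OF ts_facts])

lemma lin_homE:
  assumes "\<alpha> \<in> Hom lin X Y"
  obtains u :: "('g, nat, nat) span" where "is_ts_span G \<O> X Y u" "\<alpha> = cls X Y u"
  using hom_cases[OF ts_facts assms] .

text \<open>A class contains only spans with apex in \<open>nat\<close>, so it may not contain
  \<open>u\<close> itself. It does contain a copy \<open>u'\<close> of \<open>u\<close>, and
  equality of the classes puts \<open>u'\<close> into the class of \<open>v\<close>.\<close>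

lemma cls_eq_iff:
  fixes u :: "('g, 'x::countable, nat) span" and v :: "('g, 'z::countable, nat) span"
  assumes u: "is_ts_span G \<O> X Y u" and v: "is_ts_span G \<O> X Y v"
  shows "cls X Y u = cls X Y v \<longleftrightarrow> span_iso G u v"
proof
  have fu: "is_finite_gset G (apex u)" using u by (simp add: is_ts_span_def)
  show "span_iso G u v \<Longrightarrow> cls X Y u = cls X Y v" by (rule span_class_eq[OF _ fu])
  assume eq: "cls X Y u = cls X Y v"
  obtain u' :: "('g, nat, nat) span" where u': "is_ts_span G \<O> X Y u'" "span_iso G u u'"
    using nat_span[OF ts_facts u] .
  have "u' \<in> cls X Y v" using u' eq by (auto simp: span_class_def)
  then have "span_iso G v u'" by (simp add: span_class_def)
  then show "span_iso G u v"
    using span_iso_trans[OF u'(2) span_iso_sym] v by (auto simp: is_ts_span_def)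
qed

lemma Cmp_cls:
  fixes u :: "('g, 'x::countable, nat) span" and v :: "('g, 'z::countable, nat) span"
  assumes u: "is_ts_span G \<O> S T u" and v: "is_ts_span G \<O> T W v"
  shows "Cmp lin S T W (cls T W v) (cls S T u) = cls S W (span_pullback u v)"
proof -
  obtain u' :: "('g, nat, nat) span" where u': "is_ts_span G \<O> S T u'" "span_iso G u u'"
    using nat_span[OF ts_facts u] .
  obtain v' :: "('g, nat, nat) span" where v': "is_ts_span G \<O> T W v'" "span_iso G v v'"
    using nat_span[OF ts_facts v] .
  have "cls S T u = cls S T u'" "cls T W v = cls T W v'"
    using cls_eq_iff u v u' v' by blast+
  then show ?thesis
    using cmp_class[OF ts_facts u'(1) v'(1)] span_class_eq[OF pb_cong[OF ts_facts u'(2) v'(2)] pb_gset[OF ts_facts u v]]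
    by simp
qed

text \<open>Composites are computed by guessing the answer \<open>w\<close>: the pair
  \<open>(k, l)\<close> has to identify its apex with the fibre product, compatibly with the legs.
  This keeps the explicit pullback on pairs out of later arguments.\<close>

lemma pullback_span:
  fixes u :: "('g, 'x::countable, nat) span" and v :: "('g, 'z::countable, nat) span"
    and w :: "('g, 'y, nat) span"
  assumes u: "is_ts_span G \<O> S T u" and v: "is_ts_span G \<O> T W v"
    and w: "is_finite_gset G (apex w)"
    and k: "equivariant G (apex w) (apex u) k" and l: "equivariant G (apex w) (apex v) l"
    and legs: "\<And>x. x \<in> points (apex w) \<Longrightarrow>
      rleg u (k x) = lleg v (l x) \<and> lleg u (k x) = lleg w x \<and> rleg v (l x) = rleg w x"
    and inj: "\<And>x y. x \<in> points (apex w) \<Longrightarrow> y \<in> points (apex w) \<Longrightarrow> k x = k y \<Longrightarrow> l x = l y \<Longrightarrow> x = y"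
    and surj: "\<And>a b. a \<in> points (apex u) \<Longrightarrow> b \<in> points (apex v) \<Longrightarrow> rleg u a = lleg v b \<Longrightarrow>
      \<exists>x \<in> points (apex w). k x = a \<and> l x = b"
  shows "is_ts_span G \<O> S W w" "Cmp lin S T W (cls T W v) (cls S T u) = cls S W w"
proof -
  let ?P = "span_pullback u v" let ?m = "\<lambda>x. (k x, l x)"
  have m: "?m x \<in> points (apex ?P)" if "x \<in> points (apex w)" for x
    using that k l legs by (auto simp: points_pb equivariant_def)
  have "bij_betw ?m (points (apex w)) (points (apex ?P))"
    unfolding bij_betw_def
  proof
    show "inj_on ?m (points (apex w))" using inj by (auto intro!: inj_onI)
    show "?m ` points (apex w) = points (apex ?P)"
    proof
      show "points (apex ?P) \<subseteq> ?m ` points (apex w)"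
        using surj by (fastforce simp: points_pb)
    qed (use m in auto)
  qed
  moreover have "equivariant G (apex w) (apex ?P) ?m"
    unfolding equivariant_def
  proof (intro conjI ballI)
    show "?m (act (apex w) g x) = act (apex ?P) g (?m x)"
      if "g \<in> carrier G" "x \<in> points (apex w)" for g x
      using that k l m[OF that(2)] by (simp add: act_pb equivariant_def)
  qed (use m in auto)
  ultimately have iso: "span_iso G w ?P"
    unfolding span_iso_def using legs by (intro exI[of _ ?m]) (auto simp: legs_pb)
  show "is_ts_span G \<O> S W w"
    by (rule ts_span_iso[OF ts_facts pb_ts_span[OF ts_facts u v] span_iso_sym[OF iso w] w])
  show "Cmp lin S T W (cls T W v) (cls S T u) = cls S W w"
    using Cmp_cls[OF u v] span_class_eq[OF iso w] by simp
qed

lemma res_span_ts: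
  "is_finite_gset G A \<Longrightarrow> equivariant G A X f \<Longrightarrow> is_ts_span G \<O> X A (res_span A f)"
  by (simp add: is_ts_span_def ts_map_def equivariant_def \<O>_refl stab_subgroup)

lemma tr_span_ts:
  "is_finite_gset G A \<Longrightarrow> ts_map G \<O> A X f \<Longrightarrow> is_ts_span G \<O> A X (tr_span A f)"
  by (simp add: is_ts_span_def ts_map_def equivariant_def)

lemma ts_map_stab_preserving:
  assumes "is_finite_gset G A" "equivariant G A X f" "\<And>x. x \<in> points A \<Longrightarrow> stab G X (f x) = stab G A x"
  shows "ts_map G \<O> A X f"
  using assms by (simp add: ts_map_def \<O>_refl stab_subgroup)

lemma equivariant_id: "equivariant G X X (\<lambda>x. x)"
  by (simp add: equivariant_def)

lemma span_equivariant:
  assumes "is_ts_span G \<O> X Y u"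
  shows "is_finite_gset G (apex u)" "equivariant G (apex u) X (lleg u)" "equivariant G (apex u) Y (rleg u)"
    "ts_map G \<O> (apex u) Y (rleg u)"
  using assms by (auto simp: is_ts_span_def ts_map_def)

lemma equivariantD:
  assumes "equivariant G X Y f" "x \<in> points X"
  shows "f x \<in> points Y" "g \<in> carrier G \<Longrightarrow> f (act X g x) = act Y g (f x)"
  using assms by (auto simp: equivariant_def)

text \<open>A fibre product along an identity leg is the other apex, so a restriction only changes
  the left leg; likewise a transfer, in \<open>Cmp_tr\<close>, only changes the right leg.\<close>

lemma Cmp_res:
  fixes u :: "('g, nat, nat) span"
  assumes "is_finite_gset G A" "equivariant G A X f" "is_ts_span G \<O> A Y u"
  shows "is_ts_span G \<O> X Y (u\<lparr>lleg := \<lambda>x. f (lleg u x)\<rparr>)"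
    "Cmp lin X A Y (cls A Y u) (cls X A (res_span A f)) = cls X Y (u\<lparr>lleg := \<lambda>x. f (lleg u x)\<rparr>)"
proof -
  let ?w = "u\<lparr>lleg := \<lambda>x. f (lleg u x)\<rparr>"
  note P = pullback_span[OF res_span_ts[OF assms(1,2)] assms(3), where w = ?w and k = "lleg u" and l = "\<lambda>x. x"]
  show "is_ts_span G \<O> X Y ?w" by (rule P(1)) (use span_equivariant[OF assms(3)] equivariant_id in auto)
  show "Cmp lin X A Y (cls A Y u) (cls X A (res_span A f)) = cls X Y ?w"
    by (rule P(2)) (use span_equivariant[OF assms(3)] equivariant_id in auto)
qed

lemma Cmp_tr:
  fixes u :: "('g, nat, nat) span"
  assumes "is_finite_gset G A" "ts_map G \<O> A Y f" "is_ts_span G \<O> X A u"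
  shows "is_ts_span G \<O> X Y (u\<lparr>rleg := \<lambda>x. f (rleg u x)\<rparr>)"
    "Cmp lin X A Y (cls A Y (tr_span A f)) (cls X A u) = cls X Y (u\<lparr>rleg := \<lambda>x. f (rleg u x)\<rparr>)"
proof -
  let ?w = "u\<lparr>rleg := \<lambda>x. f (rleg u x)\<rparr>"
  note P = pullback_span[OF assms(3) tr_span_ts[OF assms(1,2)], where w = ?w and l = "rleg u" and k = "\<lambda>x. x"]
  show "is_ts_span G \<O> X Y ?w" by (rule P(1)) (use span_equivariant[OF assms(3)] equivariant_id in auto)
  show "Cmp lin X A Y (cls A Y (tr_span A f)) (cls X A u) = cls X Y ?w"
    by (rule P(2)) (use span_equivariant[OF assms(3)] equivariant_id in auto)
qed

text \<open>The standard factorisation of a span into a restriction followed by a transfer.\<close>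

lemma Cmp_tr_res:
  assumes "is_finite_gset G A" "equivariant G A X f" "ts_map G \<O> A Y r"
  shows "Cmp lin X A Y (cls A Y (tr_span A r)) (cls X A (res_span A f)) = cls X Y \<lparr>apex = A, lleg = f, rleg = r\<rparr>"
  using Cmp_tr(2)[OF assms(1,3) res_span_ts[OF assms(1,2)]] by (simp add: res_span_def)

lemma sub_incl_ts:
  assumes "is_finite_gset G X" "invariant_subset G X A"
  shows "ts_map G \<O> (sub_gset X A) X (\<lambda>x. x)"
  by (rule ts_map_stab_preserving[OF sub_gset_finite[OF assms] sub_gset_incl[OF assms(2)]]) simp

lemma span_part_ts:
  assumes u: "is_ts_span G \<O> X Y u" and A: "invariant_subset G (apex u) A"
  shows "is_ts_span G \<O> X Y (span_part u A)"
  using assms sub_gset_finite[OF span_equivariant(1)[OF u] A]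
  by (auto simp: is_ts_span_def ts_map_def equivariant_def invariant_subset_def subset_iff)

lemma span_part_sub_ts:
  assumes u: "is_ts_span G \<O> X Y u" and A: "invariant_subset G Y A"
  shows "is_ts_span G \<O> X (sub_gset Y A) (span_part u {x \<in> points (apex u). rleg u x \<in> A})"
  using assms sub_gset_finite[OF span_equivariant(1)[OF u] invariant_vimage[OF span_equivariant(1,3)[OF u] A]]
  by (auto simp: is_ts_span_def ts_map_def equivariant_def invariant_subset_def subset_iff)

text \<open>The fibre product with an inclusion is the preimage of the subset.\<close>

lemma Cmp_res_incl:
  fixes u :: "('g, 'x::countable, nat) span"
  assumes u: "is_ts_span G \<O> X Y u" and Y: "is_finite_gset G Y" and A: "invariant_subset G Y A"
  shows "Cmp lin X Y (sub_gset Y A) (cls Y (sub_gset Y A) (res_span (sub_gset Y A) (\<lambda>x. x))) (cls X Y u) =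
    cls X (sub_gset Y A) (span_part u {x \<in> points (apex u). rleg u x \<in> A})"
  using span_equivariant[OF u] span_equivariant[OF span_part_sub_ts[OF u A]]
    invariant_vimage[OF span_equivariant(1,3)[OF u] A]
  by (intro pullback_span(2)[OF u res_span_ts[OF sub_gset_finite[OF Y A] sub_gset_incl[OF A]],
        where k = "\<lambda>x. x" and l = "rleg u"])
    (auto intro: sub_gset_incl)

section \<open>Disjoint unions as products in the Lindner category\<close>

lemma span_iso_glue:
  assumes u: "is_ts_span G \<O> X Y u" and v: "is_ts_span G \<O> X Y v"
    and A: "span_iso G (span_part u {x \<in> points (apex u). rleg u x \<in> A}) (span_part v {x \<in> points (apex v). rleg v x \<in> A})"
    and B: "span_iso G (span_part u {x \<in> points (apex u). rleg u x \<in> points Y - A}) (span_part v {x \<in> points (apex v). rleg v x \<in> points Y - A})"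
    and inv: "invariant_subset G Y A" and Y: "is_finite_gset G Y"
  shows "span_iso G u v"
proof -
  let ?U = "\<lambda>A. {x \<in> points (apex u). rleg u x \<in> A}" and ?V = "\<lambda>A. {x \<in> points (apex v). rleg v x \<in> A}"
  let ?A' = "points Y - A"
  note ue = span_equivariant[OF u] and ve = span_equivariant[OF v]
  have invU: "invariant_subset G (apex u) (?U A)" by (rule invariant_vimage[OF ue(1,3) inv])
  obtain k where k: "equivariant G (sub_gset (apex u) (?U A)) (sub_gset (apex v) (?V A)) k"
    "bij_betw k (?U A) (?V A)"
    "\<And>x. x \<in> ?U A \<Longrightarrow> lleg v (k x) = lleg u x \<and> rleg v (k x) = rleg u x"
    using A unfolding span_iso_def by auto
  obtain l where l: "equivariant G (sub_gset (apex u) (?U ?A')) (sub_gset (apex v) (?V ?A')) l"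
    "bij_betw l (?U ?A') (?V ?A')"
    "\<And>x. x \<in> ?U ?A' \<Longrightarrow> lleg v (l x) = lleg u x \<and> rleg v (l x) = rleg u x"
    using B unfolding span_iso_def by auto
  define m where "m x = (if x \<in> ?U A then k x else l x)" for x
  have U: "points (apex u) = ?U A \<union> ?U ?A'" "?U A \<inter> ?U ?A' = {}"
    and V: "points (apex v) = ?V A \<union> ?V ?A'" "?V A \<inter> ?V ?A' = {}"
    using equivariantD(1)[OF ue(3)] equivariantD(1)[OF ve(3)] by auto
  have mk: "m x = k x" if "x \<in> ?U A" for x using that by (simp add: m_def)
  have ml: "m x = l x" if "x \<in> ?U ?A'" for x using that by (simp add: m_def)
  have bij: "bij_betw m (points (apex u)) (points (apex v))"
  proof (subst U(1), subst V(1), rule bij_betw_combine)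
    show "bij_betw m (?U A) (?V A)" by (subst bij_betw_cong[OF mk]) (use k(2) in auto)
    show "bij_betw m (?U ?A') (?V ?A')" by (subst bij_betw_cong[OF ml]) (use l(2) in auto)
  qed (rule V(2))
  have "m (act (apex u) g x) = act (apex v) g (m x)" if g: "g \<in> carrier G" and x: "x \<in> points (apex u)" for g x
  proof (cases "x \<in> ?U A")
    case True
    then have "k (act (apex u) g x) = act (apex v) g (k x)"
      using equivariantD[OF k(1), of x] g by simp
    moreover have "act (apex u) g x \<in> ?U A" using invU True g by (auto simp: invariant_subset_def)
    ultimately show ?thesis using True mk by simp
  next
    case False
    then have x': "x \<in> ?U ?A'" using x U by blast
    have "act (apex u) g x \<in> ?U ?A'"
      using invariant_iff[OF ue(1) invU g x] False fin_gset_props(4)[OF ue(1) g x] U by blast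
    moreover have "l (act (apex u) g x) = act (apex v) g (l x)"
      using equivariantD[OF l(1), of x] x' g by simp
    ultimately show ?thesis using x' ml by simp
  qed
  then have "equivariant G (apex u) (apex v) m"
    using bij_betw_imp_funcset[OF bij] by (simp add: equivariant_def)
  moreover have "lleg v (m x) = lleg u x \<and> rleg v (m x) = rleg u x" if "x \<in> points (apex u)" for x
  proof (cases "x \<in> ?U A")
    case True
    then show ?thesis using k(3) mk by simp
  next
    case False
    then have "x \<in> ?U ?A'" using that U by blast
    then show ?thesis using l(3) ml by simp
  qed
  ultimately show ?thesis unfolding span_iso_def using bij by blast
qed

lemma sum_gset_finite:
  assumes X: "is_finite_gset G X" and Y: "is_finite_gset G Y"
  shows "is_finite_gset G (sum_gset X Y)"
proof (rule is_finite_gsetI[OF is_group])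
  show "act (sum_gset X Y) g \<in> extensional (points (sum_gset X Y))" for g by (simp add: sum_gset_def)
qed (use fin_gset_props[OF X] fin_gset_props[OF Y] in auto)

lemma stab_sum_gset:
  "x \<in> points X \<Longrightarrow> stab G (sum_gset X Y) (Inl x) = stab G X x"
  "y \<in> points Y \<Longrightarrow> stab G (sum_gset X Y) (Inr y) = stab G Y y"
  by (auto simp: set_eq_iff mem_stab)

lemma sum_span_ts:
  assumes Y: "is_finite_gset G Y" and A: "invariant_subset G Y A"
    and u: "is_ts_span G \<O> X (sub_gset Y A) u" and v: "is_ts_span G \<O> X (sub_gset Y (points Y - A)) v"
  shows "is_ts_span G \<O> X Y (sum_span u v)"
  using A sum_gset_finite[OF span_equivariant(1)[OF u] span_equivariant(1)[OF v]] u v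
  by (auto simp: is_ts_span_def ts_map_def equivariant_def stab_sum_gset invariant_subset_def Pi_iff)

text \<open>The right leg of a span into \<open>X\<close> splits the apex into the preimages of
  \<open>A\<close> and of its complement. Composing with the projections cuts out these preimages,
  and \<open>sum_span\<close> puts them together again.\<close>

theorem sub_gset_product:
  assumes X: "is_finite_gset G X" and A: "invariant_subset G X A"
  shows "is_product lin (sub_gset X A) (sub_gset X (points X - A)) X
    (cls X (sub_gset X A) (res_span (sub_gset X A) (\<lambda>x. x)))
    (cls X (sub_gset X (points X - A)) (res_span (sub_gset X (points X - A)) (\<lambda>x. x)))"
proof -
  let ?B = "points X - A"
  let ?p = "cls X (sub_gset X A) (res_span (sub_gset X A) (\<lambda>x. x))"
  let ?q = "cls X (sub_gset X ?B) (res_span (sub_gset X ?B) (\<lambda>x. x))"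
  have B: "invariant_subset G X ?B" by (rule invariant_Diff[OF X A])
  have "\<exists>!h. h \<in> Hom lin Z X \<and> Cmp lin Z X (sub_gset X A) ?p h = f \<and> Cmp lin Z X (sub_gset X ?B) ?q h = g"
    if f: "f \<in> Hom lin Z (sub_gset X A)" and g: "g \<in> Hom lin Z (sub_gset X ?B)" for Z f g
  proof -
    obtain u :: "('g, nat, nat) span" where u: "is_ts_span G \<O> Z (sub_gset X A) u" "f = cls Z (sub_gset X A) u"
      using lin_homE[OF f] .
    obtain v :: "('g, nat, nat) span" where v: "is_ts_span G \<O> Z (sub_gset X ?B) v" "g = cls Z (sub_gset X ?B) v"
      using lin_homE[OF g] .
    let ?s = "sum_span u v"
    have s: "is_ts_span G \<O> Z X ?s" by (rule sum_span_ts[OF X A u(1) v(1)])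
    note ue = span_equivariant[OF u(1)] and ve = span_equivariant[OF v(1)]
    have ru: "rleg u x \<in> A" if "x \<in> points (apex u)" for x using equivariantD(1)[OF ue(3) that] by simp
    have rv: "rleg v x \<in> ?B" if "x \<in> points (apex v)" for x using equivariantD(1)[OF ve(3) that] by simp
    have "Cmp lin Z X (sub_gset X A) ?p (cls Z X ?s) = f"
      unfolding u(2)
      by (rule pullback_span(2)[OF s res_span_ts[OF sub_gset_finite[OF X A] sub_gset_incl[OF A]], where k = Inl and l = "rleg u"])
        (use ue ru rv in \<open>auto simp: equivariant_def\<close>)
    moreover have "Cmp lin Z X (sub_gset X ?B) ?q (cls Z X ?s) = g"
      unfolding v(2)
      by (rule pullback_span(2)[OF s res_span_ts[OF sub_gset_finite[OF X B] sub_gset_incl[OF B]], where k = Inr and l = "rleg v"])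
        (use ve ru rv in \<open>auto simp: equivariant_def\<close>)
    moreover have "h = cls Z X ?s" if h: "h \<in> Hom lin Z X" "Cmp lin Z X (sub_gset X A) ?p h = Cmp lin Z X (sub_gset X A) ?p (cls Z X ?s)"
        "Cmp lin Z X (sub_gset X ?B) ?q h = Cmp lin Z X (sub_gset X ?B) ?q (cls Z X ?s)" for h
    proof -
      obtain w :: "('g, nat, nat) span" where w: "is_ts_span G \<O> Z X w" "h = cls Z X w"
        using lin_homE[OF h(1)] .
      \<comment> \<open>Equal composites with a projection mean isomorphic parts of \<open>w\<close>
        and \<open>?s\<close> over that piece of \<open>X\<close>; the two isomorphisms are
        glued.\<close>
      have "span_iso G w ?s"
        by (rule span_iso_glue[OF w(1) s _ _ A X]; rule cls_eq_iff[THEN iffD1])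
          (use h(2,3) in \<open>simp_all only: w(2) Cmp_res_incl[OF w(1) X A] Cmp_res_incl[OF w(1) X B]
            Cmp_res_incl[OF s X A] Cmp_res_incl[OF s X B] span_part_sub_ts[OF w(1) A]
            span_part_sub_ts[OF w(1) B] span_part_sub_ts[OF s A] span_part_sub_ts[OF s B]\<close>)
      then show ?thesis using cls_eq_iff[OF w(1) s] w(2) by simp
    qed
    ultimately show ?thesis using cls_in_Hom[OF s] by metis
  qed
  then show ?thesis
    unfolding is_product_def
    using X sub_gset_finite[OF X A] sub_gset_finite[OF X B] sub_gset_incl[OF A] sub_gset_incl[OF B]
    by (auto intro!: cls_in_Hom res_span_ts)
qed

text \<open>A right leg into the empty set forces the apex to be empty.\<close>

theorem empty_gset_terminal:
  assumes E: "is_finite_gset G E" "points E = {}"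
  shows "is_terminal lin E"
proof -
  have "\<exists>!f. f \<in> Hom lin X E" if "is_finite_gset G X" for X
  proof (rule ex1I)
    have e: "is_ts_span G \<O> X E (tr_span E (\<lambda>x. x))"
      using E by (simp add: is_ts_span_def ts_map_def equivariant_def)
    show "cls X E (tr_span E (\<lambda>x. x)) \<in> Hom lin X E" by (rule cls_in_Hom[OF e])
    fix f assume "f \<in> Hom lin X E"
    then obtain u :: "('g, nat, nat) span" where u: "is_ts_span G \<O> X E u" "f = cls X E u"
      by (rule lin_homE)
    have "points (apex u) = {}" using u(1) E by (auto simp: is_ts_span_def ts_map_def equivariant_def)
    then have "span_iso G u (tr_span E (\<lambda>x. x))"
      using E by (simp add: span_iso_def equivariant_def bij_betw_def)
    then show "f = cls X E (tr_span E (\<lambda>x. x))" using cls_eq_iff[OF u(1) e] u(2) by simp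
  qed
  then show ?thesis using E(1) by (simp add: is_terminal_def)
qed

section \<open>Products with a fixed G-set as base change\<close>

lemma prod_gset_finite:
  assumes X: "is_finite_gset G X" and Y: "is_finite_gset G Y"
  shows "is_finite_gset G (prod_gset X Y)"
proof (rule is_finite_gsetI[OF is_group])
  have "n \<in> (\<lambda>(x, y). pair x y) ` (points X \<times> points Y)" if "n \<in> points (prod_gset X Y)" for n
    using that by (intro image_eqI[of _ _ "(pr1 n, pr2 n)"]) simp_all
  then have "points (prod_gset X Y) \<subseteq> (\<lambda>(x, y). pair x y) ` (points X \<times> points Y)" by blast
  then show "finite (points (prod_gset X Y))"
    using fin_gset_props(1)[OF X] fin_gset_props(1)[OF Y]
    by (meson finite_SigmaI finite_surj)
  show "act (prod_gset X Y) g \<in> extensional (points (prod_gset X Y))" for g by (simp add: prod_gset_def)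
qed (use fin_gset_props[OF X] fin_gset_props[OF Y] in auto)

lemma stab_prod_gset:
  "n \<in> points (prod_gset X Y) \<Longrightarrow> stab G (prod_gset X Y) n = stab G X (pr1 n) \<inter> stab G Y (pr2 n)"
  by (auto simp: set_eq_iff mem_stab) (metis pair_simps(1-3))+

lemma prod_gset_pr1: "equivariant G (prod_gset X Y) X pr1"
  by (simp add: equivariant_def)

lemma prod_span_ts:
  assumes u: "is_ts_span G \<O> X X' u" and Y: "is_finite_gset G Y"
  shows "is_ts_span G \<O> (prod_gset X Y) (prod_gset X' Y) (prod_span u Y)"
proof -
  note ue = span_equivariant[OF u]
  have eq: "equivariant G (apex (prod_span u Y)) (prod_gset X Y) (lleg (prod_span u Y))"
    "equivariant G (apex (prod_span u Y)) (prod_gset X' Y) (rleg (prod_span u Y))"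
    using ue(2,3) fin_gset_props(4)[OF Y] by (auto simp: equivariant_def Pi_iff)
  have "(stab G (apex (prod_span u Y)) n, stab G (prod_gset X' Y) (rleg (prod_span u Y) n)) \<in> \<O>"
    if n: "n \<in> points (apex (prod_span u Y))" for n
  proof -
    \<comment> \<open>\<open>?L\<close> is the stabiliser of the image of \<open>n\<close>.
      Restricting the relation of the right leg of \<open>u\<close> to \<open>?L\<close> produces
      the stabiliser of \<open>n\<close>, because the stabiliser of \<open>pr1 n\<close> lies in
      that of its image.\<close>
    let ?r = "rleg u (pr1 n)" let ?L = "stab G X' ?r \<inter> stab G Y (pr2 n)"
    have n': "pr1 n \<in> points (apex u)" "pr2 n \<in> points Y" using n by simp_all
    have r: "rleg u (pr1 n) \<in> points X'" using equivariantD(1)[OF ue(3) n'(1)] .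
    have O: "(stab G (apex u) (pr1 n), stab G X' ?r) \<in> \<O>" using ue(4) n'(1) by (simp add: ts_map_def)
    have "subgroup ?L G" using \<O>_subgroups[OF O] stab_subgroup[OF Y n'(2)] subgroups_Inter_pair by blast
    then have "(stab G (apex u) (pr1 n) \<inter> ?L, ?L) \<in> \<O>" using restriction[OF O] by blast
    moreover have "stab G (apex u) (pr1 n) \<inter> ?L = stab G (apex u) (pr1 n) \<inter> stab G Y (pr2 n)"
      using stab_mono[OF ue(3) n'(1)] by blast
    ultimately show ?thesis using n' r by (simp add: stab_prod_gset)
  qed
  then show ?thesis using eq prod_gset_finite[OF ue(1) Y] by (simp add: is_ts_span_def ts_map_def)
qed

text \<open>The relation from \<open>stab G Y y\<close> to \<open>carrier G\<close>, restricted to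
  \<open>stab G X x\<close>, is the required one. For \<open>Y\<close> a copy of G/H this is where
  \<open>H \<rightarrow> G\<close> makes a transfer along the projection available.\<close>

lemma pr1_ts_map:
  assumes X: "is_finite_gset G X" and Y: "is_finite_gset G Y"
    and top: "\<And>y. y \<in> points Y \<Longrightarrow> (stab G Y y, carrier G) \<in> \<O>"
  shows "ts_map G \<O> (prod_gset X Y) X pr1"
proof -
  have "(stab G X x \<inter> stab G Y y, stab G X x) \<in> \<O>" if "x \<in> points X" "y \<in> points Y" for x y
    using restriction[OF top[OF that(2)] stab_subgroup[OF X that(1)] subgroup.subset[OF stab_subgroup[OF X that(1)]]]
    by (subst Int_commute)
  then show ?thesis using prod_gset_pr1 by (simp add: ts_map_def stab_prod_gset)
qed

text \<open>With \<open>U\<close> the apex of \<open>u\<close>, the set U x Y is the pullback of U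
  to X' x Y along the projection; both composites are the span from X to X' x Y with this
  apex.\<close>

lemma prod_res_natural:
  assumes u: "is_ts_span G \<O> X X' u" and X: "is_finite_gset G X" and X': "is_finite_gset G X'"
    and Y: "is_finite_gset G Y"
  shows "Cmp lin X (prod_gset X Y) (prod_gset X' Y) (cls (prod_gset X Y) (prod_gset X' Y) (prod_span u Y))
      (cls X (prod_gset X Y) (res_span (prod_gset X Y) pr1)) =
    Cmp lin X X' (prod_gset X' Y) (cls X' (prod_gset X' Y) (res_span (prod_gset X' Y) pr1)) (cls X X' u)"
proof -
  let ?w = "(prod_span u Y)\<lparr>lleg := \<lambda>n. pr1 (lleg (prod_span u Y) n)\<rparr>"
  note ue = span_equivariant[OF u]
  note pe = span_equivariant[OF prod_span_ts[OF u Y]]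
  have "Cmp lin X X' (prod_gset X' Y) (cls X' (prod_gset X' Y) (res_span (prod_gset X' Y) pr1)) (cls X X' u) =
      cls X (prod_gset X' Y) ?w"
  proof (rule pullback_span(2)[OF u res_span_ts[OF prod_gset_finite[OF X' Y] prod_gset_pr1],
        where k = pr1 and l = "rleg (prod_span u Y)"])
    show "\<exists>x\<in>points (apex ?w). pr1 x = a \<and> rleg (prod_span u Y) x = b"
      if "a \<in> points (apex u)" "b \<in> points (apex (res_span (prod_gset X' Y) pr1))"
        "rleg u a = lleg (res_span (prod_gset X' Y) pr1) b" for a b
      using that by (intro bexI[of _ "pair a (pr2 b)"]) auto
  qed (use prod_gset_pr1 pe in \<open>auto intro: pair_eqI\<close>)
  then show ?thesis
    using Cmp_res(2)[OF prod_gset_finite[OF X Y] prod_gset_pr1 prod_span_ts[OF u Y]] by simp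
qed

text \<open>Now U x Y is the pullback of the left leg of \<open>u\<close> along the projection from
  X x Y to X; both composites are the span from X x Y to X' with this apex.\<close>

lemma prod_tr_natural:
  assumes u: "is_ts_span G \<O> X X' u" and X: "is_finite_gset G X" and X': "is_finite_gset G X'"
    and Y: "is_finite_gset G Y" and top: "\<And>y. y \<in> points Y \<Longrightarrow> (stab G Y y, carrier G) \<in> \<O>"
  shows "Cmp lin (prod_gset X Y) (prod_gset X' Y) X' (cls (prod_gset X' Y) X' (tr_span (prod_gset X' Y) pr1))
      (cls (prod_gset X Y) (prod_gset X' Y) (prod_span u Y)) =
    Cmp lin (prod_gset X Y) X X' (cls X X' u) (cls (prod_gset X Y) X (tr_span (prod_gset X Y) pr1))"
proof -
  let ?w = "(prod_span u Y)\<lparr>rleg := \<lambda>n. pr1 (rleg (prod_span u Y) n)\<rparr>"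
  note ue = span_equivariant[OF u]
  note pe = span_equivariant[OF prod_span_ts[OF u Y]]
  have "Cmp lin (prod_gset X Y) X X' (cls X X' u) (cls (prod_gset X Y) X (tr_span (prod_gset X Y) pr1)) =
      cls (prod_gset X Y) X' ?w"
  proof (rule pullback_span(2)[OF tr_span_ts[OF prod_gset_finite[OF X Y] pr1_ts_map[OF X Y top]] u,
        where l = pr1 and k = "lleg (prod_span u Y)"])
    show "\<exists>x\<in>points (apex ?w). lleg (prod_span u Y) x = a \<and> pr1 x = b"
      if "b \<in> points (apex u)" "a \<in> points (apex (tr_span (prod_gset X Y) pr1))"
        "rleg (tr_span (prod_gset X Y) pr1) a = lleg u b" for a b
      using that by (intro bexI[of _ "pair b (pr2 a)"]) (auto simp flip: that(3))
  qed (use prod_gset_pr1 pe in \<open>auto intro: pair_eqI\<close>)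
  then show ?thesis
    using Cmp_tr(2)[OF prod_gset_finite[OF X' Y] pr1_ts_map[OF X' Y top] prod_span_ts[OF u Y]] by simp
qed

end

section \<open>Functors to abelian groups\<close>

lemma Obj_Ab: "A \<in> Obj Ab \<longleftrightarrow> comm_group A"
  by (simp add: Ab_def)

lemma Hom_Ab: "f \<in> Hom Ab A B \<longleftrightarrow> f \<in> hom A B \<and> f \<in> extensional (carrier A)"
  by (simp add: Ab_def)

lemma Cmp_Ab: "Cmp Ab A B C g f = compose (carrier A) g f"
  by (simp add: Ab_def)

lemma Idt_Ab: "Idt Ab A = (\<lambda>x \<in> carrier A. x)"
  by (simp add: Ab_def)

lemma trivial_hom_Ab:
  assumes "comm_group A" "comm_group B"
  shows "(\<lambda>x \<in> carrier A. \<one>\<^bsub>B\<^esub>) \<in> Hom Ab A B"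
proof -
  interpret A: comm_group A by fact
  interpret B: comm_group B by fact
  show ?thesis by (auto simp: Hom_Ab hom_def)
qed

text \<open>The identity and the trivial map are both endomorphisms of a terminal object, hence
  equal.\<close>

lemma terminal_Ab:
  assumes "is_terminal Ab T"
  shows "carrier T = {\<one>\<^bsub>T\<^esub>}"
proof -
  have T: "comm_group T" using assms by (simp add: is_terminal_def Obj_Ab)
  interpret T: comm_group T by (rule T)
  have "(\<lambda>x \<in> carrier T. x) \<in> Hom Ab T T" by (auto simp: Hom_Ab hom_def)
  moreover have "\<exists>!f. f \<in> Hom Ab T T" using assms by (simp add: is_terminal_def)
  ultimately have eq: "(\<lambda>x \<in> carrier T. x) = (\<lambda>x \<in> carrier T. \<one>\<^bsub>T\<^esub>)"
    using trivial_hom_Ab[OF T T] by (metis (no_types))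
  have "x = \<one>\<^bsub>T\<^esub>" if "x \<in> carrier T" for x using fun_cong[OF eq, of x] that by simp
  then show ?thesis by auto
qed

lemma product_arrow_eqI:
  assumes "is_product C X Y P p q" "Z \<in> Obj C" "h \<in> Hom C Z P" "h' \<in> Hom C Z P"
    "Cmp C Z P X p h' \<in> Hom C Z X" "Cmp C Z P Y q h' \<in> Hom C Z Y"
    "Cmp C Z P X p h = Cmp C Z P X p h'" "Cmp C Z P Y q h = Cmp C Z P Y q h'"
  shows "h = h'"
proof -
  have "\<exists>!k. k \<in> Hom C Z P \<and> Cmp C Z P X p k = Cmp C Z P X p h' \<and> Cmp C Z P Y q k = Cmp C Z P Y q h'"
    using assms(1,2,5,6) by (simp add: is_product_def)
  then show ?thesis using assms(3,4,7,8) by auto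
qed

text \<open>The test object is the common kernel, which lives in the same universe type.\<close>

lemma product_Ab_kernel:
  assumes prod: "is_product Ab A B P p q" and x: "x \<in> carrier P" "p x = \<one>\<^bsub>A\<^esub>" "q x = \<one>\<^bsub>B\<^esub>"
  shows "x = \<one>\<^bsub>P\<^esub>"
proof -
  have grps: "comm_group A" "comm_group B" "comm_group P" and p: "p \<in> hom P A" and q: "q \<in> hom P B"
    using prod by (auto simp: is_product_def Obj_Ab Hom_Ab)
  interpret A: comm_group A by fact
  interpret B: comm_group B by fact
  interpret P: comm_group P by fact
  interpret p: group_hom P A p using p by unfold_locales
  interpret q: group_hom P B q using q by unfold_locales
  let ?D = "{x \<in> carrier P. p x = \<one>\<^bsub>A\<^esub> \<and> q x = \<one>\<^bsub>B\<^esub>}"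
  let ?K = "P\<lparr>carrier := ?D\<rparr>"
  have D: "subgroup ?D P"
  proof (rule P.subgroupI)
    show "?D \<noteq> {}" using p.hom_one q.hom_one by blast
  qed auto
  have K: "comm_group ?K"
    by (rule group.group_comm_groupI[OF P.subgroup_imp_group[OF D]]) (simp add: P.m_comm)
  \<comment> \<open>The inclusion \<open>?i\<close> and the trivial map \<open>?t\<close> agree
    after both projections, so the uniqueness in the product property identifies them.\<close>
  let ?i = "\<lambda>x \<in> ?D. x" and ?t = "\<lambda>x \<in> ?D. \<one>\<^bsub>P\<^esub>"
  have i: "?i \<in> Hom Ab ?K P" by (auto simp: Hom_Ab hom_def)
  have t: "?t \<in> Hom Ab ?K P" using trivial_hom_Ab[OF K grps(3)] by simp
  have pt: "Cmp Ab ?K P A p ?t \<in> Hom Ab ?K A" "Cmp Ab ?K P B q ?t \<in> Hom Ab ?K B"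
    by (auto simp: Cmp_Ab Hom_Ab compose_def hom_def)
  have "Cmp Ab ?K P A p ?i = Cmp Ab ?K P A p ?t" "Cmp Ab ?K P B q ?i = Cmp Ab ?K P B q ?t"
    by (auto simp: Cmp_Ab compose_def fun_eq_iff)
  then have "?i = ?t" using product_arrow_eqI[OF prod _ i t pt] K by (simp add: Obj_Ab)
  from fun_cong[OF this, of x] show ?thesis using x by simp
qed

lemma functor_Ab:
  assumes F: "is_functor C Ab F" and X: "X \<in> Obj C" and Y: "Y \<in> Obj C" and f: "f \<in> Hom C X Y"
  shows "comm_group (FObj F X)" "FArr F X Y f \<in> hom (FObj F X) (FObj F Y)"
    "FArr F X Y f \<in> extensional (carrier (FObj F X))"
    "m \<in> carrier (FObj F X) \<Longrightarrow> FArr F X Y f m \<in> carrier (FObj F Y)"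
proof -
  show "comm_group (FObj F X)" using F X by (simp add: is_functor_def Obj_Ab)
  have "FArr F X Y f \<in> Hom Ab (FObj F X) (FObj F Y)" using assms by (simp add: is_functor_def)
  then show "FArr F X Y f \<in> hom (FObj F X) (FObj F Y)" "FArr F X Y f \<in> extensional (carrier (FObj F X))"
    "m \<in> carrier (FObj F X) \<Longrightarrow> FArr F X Y f m \<in> carrier (FObj F Y)"
    by (auto simp: Hom_Ab hom_def)
qed

lemma functor_Ab_Cmp:
  assumes "is_functor C Ab F" "X \<in> Obj C" "Y \<in> Obj C" "Z \<in> Obj C" "f \<in> Hom C X Y" "g \<in> Hom C Y Z"
    "m \<in> carrier (FObj F X)"
  shows "FArr F X Z (Cmp C X Y Z g f) m = FArr F Y Z g (FArr F X Y f m)"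
  using assms by (simp add: is_functor_def Cmp_Ab compose_def)

lemma functor_Ab_Idt:
  assumes "is_functor C Ab F" "X \<in> Obj C" "m \<in> carrier (FObj F X)"
  shows "FArr F X X (Idt C X) m = m"
  using assms by (simp add: is_functor_def Idt_Ab)

section \<open>Additivity of Mackey functors\<close>

lemma sub_gset_sub [simp]: "B \<subseteq> A \<Longrightarrow> sub_gset (sub_gset X A) B = sub_gset X B"
  by (simp add: sub_gset_def Int_absorb1)

section \<open>Conjugation invariance of lying above a class\<close>

context finite_transfer_system
begin

lemma conj_subgroup_subgroup: "subgroup K G \<Longrightarrow> g \<in> carrier G \<Longrightarrow> subgroup (conj_subgroup G g K) G"
  using \<O>_refl conjugation \<O>_subgroups by blast

lemma conj_subgroup_mono: "K \<subseteq> L \<Longrightarrow> conj_subgroup G g K \<subseteq> conj_subgroup G g L"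
  by (auto simp: l_coset_def r_coset_def)

lemma conj_subgroup_inv:
  assumes "g \<in> carrier G" "K \<subseteq> carrier G"
  shows "conj_subgroup G (inv g) (conj_subgroup G g K) = K" "conj_subgroup G g (conj_subgroup G (inv g) K) = K"
  using assms by (simp_all only: conj_subgroup_conj inv_closed l_inv r_inv conj_subgroup_one)

text \<open>The conjugated hull is a candidate for the hull of the conjugate, which gives one
  inclusion; the other is the same inclusion for \<open>inv g\<close>, conjugated back.\<close>

lemma ts_hull_conj:
  assumes J: "subgroup J G" and g: "g \<in> carrier G"
  shows "ts_hull G \<O> (conj_subgroup G g J) = conj_subgroup G g (ts_hull G \<O> J)"
proof -
  have sub: "ts_hull G \<O> (conj_subgroup G g J) \<subseteq> conj_subgroup G g (ts_hull G \<O> J)"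
    if "subgroup J G" "g \<in> carrier G" for J g
    using ts_hull_properties[OF conj_subgroup_subgroup[OF that]] ts_hull_properties[OF that(1)]
      conjugation[of "ts_hull G \<O> J" "carrier G", OF _ that(2)] conj_subgroup_carrier[OF that(2)] conj_subgroup_mono
    by metis
  have Jc: "J \<subseteq> carrier G" using J subgroup.subset by blast
  have Jg: "subgroup (conj_subgroup G g J) G" by (rule conj_subgroup_subgroup[OF J g])
  have hc: "ts_hull G \<O> (conj_subgroup G g J) \<subseteq> carrier G"
    using ts_hull_properties[OF Jg] refines_inclusion by blast
  have "ts_hull G \<O> J \<subseteq> conj_subgroup G (inv g) (ts_hull G \<O> (conj_subgroup G g J))"
    using sub[OF Jg inv_closed[OF g]] by (simp only: conj_subgroup_inv[OF g Jc])
  then have "conj_subgroup G g (ts_hull G \<O> J) \<subseteq> ts_hull G \<O> (conj_subgroup G g J)"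
    using conj_subgroup_mono conj_subgroup_inv(2)[OF g hc] by metis
  then show ?thesis using sub[OF J g] by blast
qed

lemma above_class_conj:
  assumes "subgroup H G" "above_class G \<O> H L" "g \<in> carrier G"
  shows "above_class G \<O> H (conj_subgroup G g L)"
proof -
  obtain K c where K: "subgroup K G" "c \<in> carrier G" "ts_hull G \<O> K = conj_subgroup G c (ts_hull G \<O> H)" "K \<subseteq> L"
    using assms by (auto simp: above_class_def insep_class_def inseparable_def)
  have "ts_hull G \<O> H \<subseteq> carrier G" using ts_hull_properties[OF assms(1)] refines_inclusion by blast
  then have "ts_hull G \<O> (conj_subgroup G g K) = conj_subgroup G (g \<otimes> c) (ts_hull G \<O> H)"
    using ts_hull_conj[OF K(1) assms(3)] conj_subgroup_conj[OF assms(3) K(2)] K(3) by simp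
  then have "conj_subgroup G g K \<in> insep_class G \<O> H"
    using conj_subgroup_subgroup[OF K(1) assms(3)] assms(3) K(2)
    by (auto simp: insep_class_def inseparable_def)
  then show ?thesis using conj_subgroup_mono[OF K(4)] by (auto simp: above_class_def)
qed

lemma invariant_above:
  assumes "subgroup H G" "is_finite_gset G X"
  shows "invariant_subset G X {x \<in> points X. above_class G \<O> H (stab G X x)}"
  using above_class_conj[OF assms(1)] stab_act[OF assms(2)] fin_gset_props(4)[OF assms(2)]
  by (simp add: invariant_subset_def)

lemma orbit_act:
  assumes X: "is_finite_gset G X" and x: "x \<in> points X" and h: "h \<in> carrier G"
  shows "orbit_set G X (act X h x) = orbit_set G X x"
proof -
  have sub: "orbit_set G X (act X h x) \<subseteq> orbit_set G X x" if "x \<in> points X" "h \<in> carrier G" for x h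
    using orbit_invariant[OF X that(1)] that by (auto simp: invariant_subset_def orbit_set_def)
  show ?thesis
    using sub[OF x h] sub[OF fin_gset_props(4)[OF X h x] inv_closed[OF h]] act_inv(1)[OF X h x] by simp
qed

text \<open>The section is fixed on one representative of every orbit.\<close>

lemma equivariant_section:
  fixes p :: "'x \<Rightarrow> 'y"
  assumes V: "is_finite_gset G V" and X: "is_finite_gset G X" and p: "equivariant G V X p"
    and st: "\<And>v. v \<in> points V \<Longrightarrow> stab G X (p v) = stab G V v"
    and A: "invariant_subset G X A" "A \<subseteq> p ` points V"
  obtains s where "equivariant G (sub_gset X A) V s" "\<And>x. x \<in> A \<Longrightarrow> p (s x) = x"
proof -
  \<comment> \<open>The choice is made from the orbit as a set, so \<open>rep\<close> is constant on
    orbits by \<open>orbit_act\<close>.\<close>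
  define rep where "rep x = (SOME y. y \<in> orbit_set G X x)" for x
  define v where "v y = (SOME v. v \<in> points V \<and> p v = y)" for y
  define c where "c x = (SOME g. g \<in> carrier G \<and> act X g (rep x) = x)" for x
  define s where "s x = act V (c x) (v (rep x))" for x
  have Ap: "x \<in> points X" if "x \<in> A" for x using A(1) that by (auto simp: invariant_subset_def)
  have rep_orb: "rep x \<in> orbit_set G X x" if "x \<in> A" for x
    using orbit_self[OF X Ap[OF that]] by (auto simp: rep_def intro: someI)
  have rep: "rep x \<in> A" if "x \<in> A" for x
    using rep_orb[OF that] A(1) that by (auto simp: orbit_set_def invariant_subset_def)
  have v: "v y \<in> points V \<and> p (v y) = y" if "y \<in> A" for y
    unfolding v_def by (rule someI_ex) (use A(2) that in auto)
  have c: "c x \<in> carrier G \<and> act X (c x) (rep x) = x" if x: "x \<in> A" for x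
  proof -
    obtain g where "g \<in> carrier G" "rep x = act X g x" using rep_orb[OF x] by (auto simp: orbit_set_def)
    then have "\<exists>g. g \<in> carrier G \<and> act X g (rep x) = x" using act_inv(1)[OF X _ Ap[OF x]] inv_closed by metis
    then show ?thesis unfolding c_def by (rule someI_ex)
  qed
  have sV: "s x \<in> points V" if "x \<in> A" for x
    using fin_gset_props(4)[OF V] c[OF that] v[OF rep[OF that]] by (simp add: s_def)
  have "s (act X h x) = act V h (s x)" if h: "h \<in> carrier G" and x: "x \<in> A" for h x
  proof -
    let ?y = "act X h x" let ?r = "rep x"
    have y: "?y \<in> A" using A(1) h x by (auto simp: invariant_subset_def)
    have r: "rep ?y = ?r" by (simp only: rep_def orbit_act[OF X Ap[OF x] h])
    have cx: "c x \<in> carrier G" and cy: "c ?y \<in> carrier G" using c x y by auto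
    have vr: "v ?r \<in> points V" "p (v ?r) = ?r" using v[OF rep[OF x]] by auto
    have rX: "?r \<in> points X" by (rule Ap[OF rep[OF x]])
    \<comment> \<open>Group elements that agree at \<open>?r\<close> differ by its stabiliser, which
      is also that of \<open>v ?r\<close> by \<open>st\<close>; so they agree at
      \<open>v ?r\<close>, and \<open>s\<close> is equivariant in spite of the choice in
      \<open>c\<close>.\<close>
    have "act X (c ?y) ?r = act X (h \<otimes> c x) ?r"
      using c[OF y] c[OF x] r fin_gset_props(6)[OF X h cx rX] by simp
    then have "inv (c ?y) \<otimes> (h \<otimes> c x) \<in> stab G X ?r"
      using act_eq_iff[OF X rX cy] m_closed[OF h cx] by blast
    then have "act V (c ?y) (v ?r) = act V (h \<otimes> c x) (v ?r)"
      using act_eq_iff[OF V vr(1) cy] m_closed[OF h cx] st[OF vr(1)] vr(2) by simp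
    then show ?thesis using r fin_gset_props(6)[OF V h cx vr(1)] by (simp add: s_def)
  qed
  then have "equivariant G (sub_gset X A) V s" using sV by (simp add: equivariant_def)
  moreover have "p (s x) = x" if x: "x \<in> A" for x
    using equivariantD(2)[OF p] v[OF rep[OF x]] c[OF x] by (simp add: s_def)
  ultimately show ?thesis by (rule that)
qed

end

section \<open>Values of Mackey functors on decomposed G-sets\<close>

locale mackey_functor = finite_transfer_system G \<O>
  for G :: "('g, 'e) monoid_scheme" (structure) and \<O> +
  fixes M :: "('g, 'u) mackey"
  assumes mackey: "M \<in> Obj (Mackey G \<O>)"
begin

lemma M_functor: "is_functor lin Ab M" and M_products: "preserves_finite_products lin Ab M"
  using mackey by (simp_all add: Mackey_def product_functor_category_def full_subcategory_def functor_category_def)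

abbreviation val :: "'g lobj \<Rightarrow> 'u monoid" where "val X \<equiv> FObj M X"
abbreviation mar :: "'g lobj \<Rightarrow> 'g lobj \<Rightarrow> ('g, 'x, nat) span \<Rightarrow> 'u \<Rightarrow> 'u" where
  "mar X Y u \<equiv> FArr M X Y (cls X Y u)"

lemma val_group: "is_finite_gset G X \<Longrightarrow> comm_group (val X)"
  using M_functor by (simp add: is_functor_def Obj_Ab)

lemma mar_hom:
  fixes u :: "('g, 'x::countable, nat) span"
  assumes "is_finite_gset G X" "is_finite_gset G Y" "is_ts_span G \<O> X Y u"
  shows "group_hom (val X) (val Y) (mar X Y u)"
proof -
  interpret X: comm_group "val X" by (rule val_group[OF assms(1)])
  interpret Y: comm_group "val Y" by (rule val_group[OF assms(2)])
  show ?thesis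
    using functor_Ab(2)[OF M_functor _ _ cls_in_Hom[OF assms(3)]] assms
    by unfold_locales (simp add: hom_def)
qed

lemma mar_closed:
  fixes u :: "('g, 'x::countable, nat) span"
  assumes "is_finite_gset G X" "is_finite_gset G Y" "is_ts_span G \<O> X Y u" "m \<in> carrier (val X)"
  shows "mar X Y u m \<in> carrier (val Y)"
  using group_hom.hom_closed[OF mar_hom[OF assms(1-3)] assms(4)] .

lemma mar_Cmp:
  fixes u :: "('g, 'x::countable, nat) span" and v :: "('g, 'y::countable, nat) span"
  assumes "is_finite_gset G X" "is_finite_gset G Y" "is_finite_gset G Z"
    "is_ts_span G \<O> X Y u" "is_ts_span G \<O> Y Z v" "m \<in> carrier (val X)"
    "Cmp lin X Y Z (cls Y Z v) (cls X Y u) = \<gamma>"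
  shows "FArr M X Z \<gamma> m = mar Y Z v (mar X Y u m)"
  using functor_Ab_Cmp[OF M_functor _ _ _ cls_in_Hom[OF assms(4)] cls_in_Hom[OF assms(5)] assms(6)] assms(1-3,7)
  by simp

lemma mar_id:
  assumes "is_finite_gset G X" "m \<in> carrier (val X)"
  shows "mar X X (span_id X) m = m"
  using functor_Ab_Idt[OF M_functor] assms by (simp add: Idt_lin)

definition null :: "'g lobj \<Rightarrow> bool" where "null X \<longleftrightarrow> carrier (val X) = {\<one>\<^bsub>val X\<^esub>}"

lemma null_empty:
  assumes "is_finite_gset G X" "points X = {}"
  shows "null X"
  using M_products empty_gset_terminal[OF assms] terminal_Ab
  by (auto simp: preserves_finite_products_def null_def)

lemma span_factor:
  fixes u :: "('g, nat, nat) span"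
  assumes X: "is_finite_gset G X" and Y: "is_finite_gset G Y" and u: "is_ts_span G \<O> X Y u" and m: "m \<in> carrier (val X)"
  shows "mar X Y u m = mar (apex u) Y (tr_span (apex u) (rleg u)) (mar X (apex u) (res_span (apex u) (lleg u)) m)"
proof -
  note ue = span_equivariant[OF u]
  have eq: "\<lparr>apex = apex u, lleg = lleg u, rleg = rleg u\<rparr> = u" by simp
  then show ?thesis
    using mar_Cmp[OF X ue(1) Y res_span_ts[OF ue(1,2)] tr_span_ts[OF ue(1,4)] m Cmp_tr_res[OF ue(1,2,4)]]
    by (simp only: eq)
qed

text \<open>The arrow factors through the value at the apex.\<close>

lemma mar_null:
  fixes u :: "('g, nat, nat) span"
  assumes X: "is_finite_gset G X" and Y: "is_finite_gset G Y" and u: "is_ts_span G \<O> X Y u" and m: "m \<in> carrier (val X)"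
    and null: "null (apex u)"
  shows "mar X Y u m = \<one>\<^bsub>val Y\<^esub>"
proof -
  note ue = span_equivariant[OF u]
  have "mar X (apex u) (res_span (apex u) (lleg u)) m = \<one>\<^bsub>val (apex u)\<^esub>"
    using mar_closed[OF X ue(1) res_span_ts[OF ue(1,2)] m] null by (simp add: null_def)
  then show ?thesis
    using span_factor[OF X Y u m] group_hom.hom_one[OF mar_hom[OF ue(1) Y tr_span_ts[OF ue(1,4)]]] by simp
qed

text \<open>\<open>M\<close> carries the decomposition of \<open>X\<close> into \<open>A\<close> and
  its complement to a product of groups, where the common kernel of the projections is
  trivial.\<close>

lemma restriction_eqI:
  assumes X: "is_finite_gset G X" and A: "invariant_subset G X A" and m: "m \<in> carrier (val X)" "m' \<in> carrier (val X)"
    and eqA: "mar X (sub_gset X A) (res_span (sub_gset X A) (\<lambda>x. x)) m = mar X (sub_gset X A) (res_span (sub_gset X A) (\<lambda>x. x)) m'"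
    and eqB: "mar X (sub_gset X (points X - A)) (res_span (sub_gset X (points X - A)) (\<lambda>x. x)) m =
      mar X (sub_gset X (points X - A)) (res_span (sub_gset X (points X - A)) (\<lambda>x. x)) m'"
  shows "m = m'"
proof -
  let ?B = "points X - A"
  let ?p = "mar X (sub_gset X A) (res_span (sub_gset X A) (\<lambda>x. x))"
  let ?q = "mar X (sub_gset X ?B) (res_span (sub_gset X ?B) (\<lambda>x. x))"
  have B: "invariant_subset G X ?B" by (rule invariant_Diff[OF X A])
  note sA = sub_gset_finite[OF X A] and sB = sub_gset_finite[OF X B]
  interpret X: comm_group "val X" by (rule val_group[OF X])
  interpret p: group_hom "val X" "val (sub_gset X A)" ?p
    by (rule mar_hom[OF X sA res_span_ts[OF sA sub_gset_incl[OF A]]])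
  interpret q: group_hom "val X" "val (sub_gset X ?B)" ?q
    by (rule mar_hom[OF X sB res_span_ts[OF sB sub_gset_incl[OF B]]])
  have "m \<otimes>\<^bsub>val X\<^esub> inv\<^bsub>val X\<^esub> m' = \<one>\<^bsub>val X\<^esub>"
  proof (rule product_Ab_kernel)
    show "is_product Ab (val (sub_gset X A)) (val (sub_gset X ?B)) (val X) ?p ?q"
      using M_products sub_gset_product[OF X A] by (simp add: preserves_finite_products_def)
  qed (use m eqA eqB in simp_all)
  then show ?thesis using m by (metis X.inv_equality X.inv_inv X.inv_closed)
qed

text \<open>On the value at the apex, restricting to a piece and transferring back is an idempotent,
  and the idempotents of the two complementary pieces add up to the identity. Inserting this sum
  between the restriction and the transfer that make up \<open>u\<close> splits its action.\<close>

lemma mar_split: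
  fixes u :: "('g, nat, nat) span"
  assumes X: "is_finite_gset G X" and Y: "is_finite_gset G Y" and u: "is_ts_span G \<O> X Y u"
    and A: "invariant_subset G (apex u) A" and m: "m \<in> carrier (val X)"
  shows "mar X Y u m = mar X Y (span_part u A) m \<otimes>\<^bsub>val Y\<^esub> mar X Y (span_part u (points (apex u) - A)) m"
proof -
  let ?U = "apex u" let ?B = "points ?U - A"
  note ue = span_equivariant[OF u]
  have B: "invariant_subset G ?U ?B" by (rule invariant_Diff[OF ue(1) A])
  \<comment> \<open>\<open>R C\<close> restricts from the apex to its piece \<open>C\<close>, and
    \<open>T C\<close> transfers back.\<close>
  define S where "S C = sub_gset ?U C" for C
  define R where "R C = mar ?U (S C) (res_span (S C) (\<lambda>x. x))" for C
  define T where "T C = mar (S C) ?U (tr_span (S C) (\<lambda>x. x))" for C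
  have S: "is_finite_gset G (S C)" if "invariant_subset G ?U C" for C
    unfolding S_def by (rule sub_gset_finite[OF ue(1) that])
  have rs: "is_ts_span G \<O> ?U (S C) (res_span (S C) (\<lambda>x. x))" if C: "invariant_subset G ?U C" for C
    using res_span_ts[OF S[OF C]] sub_gset_incl[OF C] by (simp add: S_def)
  have ts: "is_ts_span G \<O> (S C) ?U (tr_span (S C) (\<lambda>x. x))" if C: "invariant_subset G ?U C" for C
    using tr_span_ts[OF S[OF C]] sub_incl_ts[OF ue(1) C] by (simp add: S_def)
  \<comment> \<open>The fibre product of two pieces is their intersection: the whole piece in
    \<open>same\<close>, empty in \<open>diff\<close>.\<close>
  have RT: "R D (T C a) = mar (S C) (S D) (span_part (tr_span (S C) (\<lambda>x. x)) {x \<in> C. x \<in> D}) a"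
    if C: "invariant_subset G ?U C" and D: "invariant_subset G ?U D" and a: "a \<in> carrier (val (S C))" for C D a
    using mar_Cmp[OF S[OF C] ue(1) S[OF D] ts[OF C] rs[OF D] a] Cmp_res_incl[OF ts[OF C] ue(1) D]
    by (simp add: S_def R_def T_def)
  have same: "R C (T C a) = a" if C: "invariant_subset G ?U C" and a: "a \<in> carrier (val (S C))" for C a
  proof -
    have "span_part (tr_span (S C) (\<lambda>x. x)) {x \<in> C. x \<in> C} = span_id (S C)"
      by (simp add: span_part_def tr_span_def span_id_def S_def)
    then show ?thesis using RT[OF C C a] mar_id[OF S[OF C] a] by simp
  qed
  have diff: "R D (T C a) = \<one>\<^bsub>val (S D)\<^esub>"
    if C: "invariant_subset G ?U C" and D: "invariant_subset G ?U D" and a: "a \<in> carrier (val (S C))" and disj: "C \<inter> D = {}" for C D a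
  proof -
    let ?w = "span_part (tr_span (S C) (\<lambda>x. x)) {x \<in> C. x \<in> D}"
    have w: "is_ts_span G \<O> (S C) (S D) ?w"
      using span_part_sub_ts[OF ts[OF C] D] by (simp add: S_def)
    have "null (apex ?w)"
      by (rule null_empty[OF span_equivariant(1)[OF w]]) (use disj in auto)
    then show ?thesis using RT[OF C D a] mar_null[OF S[OF C] S[OF D] w a] by simp
  qed
  have Rc: "R C y \<in> carrier (val (S C))" if "invariant_subset G ?U C" "y \<in> carrier (val ?U)" for C y
    unfolding R_def by (rule mar_closed[OF ue(1) S[OF that(1)] rs[OF that(1)] that(2)])
  have Tc: "T C a \<in> carrier (val ?U)" if "invariant_subset G ?U C" "a \<in> carrier (val (S C))" for C a
    unfolding T_def by (rule mar_closed[OF S[OF that(1)] ue(1) ts[OF that(1)] that(2)])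
  interpret U: comm_group "val ?U" by (rule val_group[OF ue(1)])
  \<comment> \<open>Both sides are compared after restriction to the two pieces, where
    \<open>same\<close> and \<open>diff\<close> evaluate the right-hand side.\<close>
  have dec: "y = T A (R A y) \<otimes>\<^bsub>val ?U\<^esub> T ?B (R ?B y)" if y: "y \<in> carrier (val ?U)" for y
  proof -
    interpret RA: group_hom "val ?U" "val (S A)" "R A"
      unfolding R_def by (rule mar_hom[OF ue(1) S[OF A] rs[OF A]])
    interpret RB: group_hom "val ?U" "val (S ?B)" "R ?B"
      unfolding R_def by (rule mar_hom[OF ue(1) S[OF B] rs[OF B]])
    note a = Rc[OF A y] and b = Rc[OF B y]
    note Ta = Tc[OF A a] and Tb = Tc[OF B b]
    have eqA: "R A y = R A (T A (R A y) \<otimes>\<^bsub>val ?U\<^esub> T ?B (R ?B y))"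
      using same[OF A a] diff[OF B A b Diff_disjoint[of A, unfolded Int_commute[of A]]] Ta Tb a by simp
    have eqB: "R ?B y = R ?B (T A (R A y) \<otimes>\<^bsub>val ?U\<^esub> T ?B (R ?B y))"
      using same[OF B b] diff[OF A B a Diff_disjoint] Ta Tb b by simp
    show ?thesis
    proof (rule restriction_eqI[OF ue(1) A y U.m_closed[OF Ta Tb]], fold S_def, fold R_def)
    qed (rule eqA, rule eqB)
  qed
  let ?y = "mar X ?U (res_span ?U (lleg u)) m" and ?t = "mar ?U Y (tr_span ?U (rleg u))"
  have y: "?y \<in> carrier (val ?U)" by (rule mar_closed[OF X ue(1) res_span_ts[OF ue(1,2)] m])
  interpret t: group_hom "val ?U" "val Y" ?t by (rule mar_hom[OF ue(1) Y tr_span_ts[OF ue(1,4)]])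
  \<comment> \<open>Passing through the piece \<open>C\<close> of the apex amounts to cutting the
    span down to \<open>C\<close>.\<close>
  have part: "?t (T C (R C ?y)) = mar X Y (span_part u C) m" if C: "invariant_subset G ?U C" for C
  proof -
    have w: "is_ts_span G \<O> X Y (span_part u C)" by (rule span_part_ts[OF u C])
    have l: "is_ts_span G \<O> X (S C) (res_span (S C) (lleg u))"
      using res_span_ts[OF S[OF C]] span_equivariant(2)[OF w] by (simp add: S_def)
    have r: "is_ts_span G \<O> (S C) Y (tr_span (S C) (rleg u))"
      using tr_span_ts[OF S[OF C]] span_equivariant(4)[OF w] by (simp add: S_def)
    have "R C ?y = mar X (S C) (res_span (S C) (lleg u)) m"
      using mar_Cmp[OF X ue(1) S[OF C] res_span_ts[OF ue(1,2)] rs[OF C] m] Cmp_res(2)[OF ue(1,2) rs[OF C]]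
      by (simp add: R_def res_span_def)
    moreover have "?t (T C a) = mar (S C) Y (tr_span (S C) (rleg u)) a" if a: "a \<in> carrier (val (S C))" for a
      using mar_Cmp[OF S[OF C] ue(1) Y ts[OF C] tr_span_ts[OF ue(1,4)] a] Cmp_tr(2)[OF ue(1,4) ts[OF C]]
      by (simp add: T_def tr_span_def)
    moreover have "mar X Y (span_part u C) m = mar (S C) Y (tr_span (S C) (rleg u)) (mar X (S C) (res_span (S C) (lleg u)) m)"
      using span_factor[OF X Y w m] by (simp add: S_def)
    ultimately show ?thesis using Rc[OF C y] by simp
  qed
  have "mar X Y u m = ?t ?y" by (rule span_factor[OF X Y u m])
  also have "\<dots> = ?t (T A (R A ?y) \<otimes>\<^bsub>val ?U\<^esub> T ?B (R ?B ?y))" using dec[OF y] by simp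
  also have "\<dots> = ?t (T A (R A ?y)) \<otimes>\<^bsub>val Y\<^esub> ?t (T ?B (R ?B ?y))"
    using Tc[OF A Rc[OF A y]] Tc[OF B Rc[OF B y]] by simp
  finally show ?thesis by (simp only: part[OF A] part[OF B])
qed

end

section \<open>Extension of natural transformations\<close>

text \<open>In multiplicative notation the scalar \<open>of_nat k\<close> acts as the
  \<open>k\<close>-th power, so the scalar \<open>1 / of_nat n\<close> inverts the
  \<open>n\<close>-th power map.\<close>

lemma rational_group_unique_root:
  fixes A :: "'u monoid" and n :: nat
  assumes rat: "rational_group A" and A: "comm_group A" and n: "n > 0" and x: "x \<in> carrier A"
  shows "\<exists>!y. y \<in> carrier A \<and> y [^]\<^bsub>A\<^esub> n = x"
proof -
  interpret A: comm_group A by (rule A)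
  obtain s :: "rat \<Rightarrow> 'u \<Rightarrow> 'u" where s: "module rat_ring
      \<lparr>carrier = carrier A, mult = undefined, one = undefined, zero = one A, add = mult A, smult = s\<rparr>"
    using rat by (auto simp: rational_group_def)
  have cl: "s a y \<in> carrier A" if "y \<in> carrier A" for a y
    using module.smult_closed[OF s] that by (simp add: rat_ring_def)
  have dist: "s (a + b) y = s a y \<otimes>\<^bsub>A\<^esub> s b y" if "y \<in> carrier A" for a b y
    using module.smult_l_distr[OF s] that by (simp add: rat_ring_def)
  have assoc: "s (a * b) y = s a (s b y)" if "y \<in> carrier A" for a b y
    using module.smult_assoc1[OF s] that by (simp add: rat_ring_def)
  have one: "s 1 y = y" if "y \<in> carrier A" for y
    using module.smult_one[OF s] that by (simp add: rat_ring_def)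
  have pow: "s (of_nat k) y = y [^]\<^bsub>A\<^esub> k" if y: "y \<in> carrier A" for k y
  proof (induction k)
    case 0
    have "s 0 y \<otimes>\<^bsub>A\<^esub> s 0 y = s 0 y" using dist[OF y, of 0 0] by simp
    then show ?case using cl[OF y] A.l_cancel_one by simp
  next
    case (Suc k)
    then show ?case using dist[OF y, of "of_nat k" 1] one[OF y] by (simp add: add.commute)
  qed
  show ?thesis
  proof (rule ex1I)
    show "s (1 / of_nat n) x \<in> carrier A \<and> s (1 / of_nat n) x [^]\<^bsub>A\<^esub> n = x"
      using cl[OF x] pow[of "s (1 / of_nat n) x" n] assoc[OF x, of "of_nat n" "1 / of_nat n"] one[OF x] n by simp
    show "y = s (1 / of_nat n) x" if "y \<in> carrier A \<and> y [^]\<^bsub>A\<^esub> n = x" for y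
      using that pow[of y n] assoc[of y "1 / of_nat n" "of_nat n"] one[of y] n by simp
  qed
qed

section \<open>Transposes under adjunctions and split idempotents\<close>

lemma category_full_subcategory: "category C \<Longrightarrow> category (full_subcategory C P)"
  unfolding category_def full_subcategory_def by auto

text \<open>A map \<open>h\<close> out of \<open>L X\<close> is recovered from its transpose as
  \<open>\<epsilon> Y \<circ> L (R h \<circ> \<eta> X)\<close>, by the triangle identity at
  \<open>L X\<close> and naturality of the counit.\<close>

lemma adjunction_left_unique:
  assumes adj: "adjunction C D L R \<eta> \<epsilon>" and C: "category C" and D: "category D"
    and X: "X \<in> Obj C" and Y: "Y \<in> Obj D" and f: "f \<in> Hom D (FObj L X) Y" and g: "g \<in> Hom D (FObj L X) Y"
    and eq: "Cmp C X (FObj R (FObj L X)) (FObj R Y) (FArr R (FObj L X) Y f) (\<eta> X) =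
      Cmp C X (FObj R (FObj L X)) (FObj R Y) (FArr R (FObj L X) Y g) (\<eta> X)"
  shows "f = g"
proof -
  let ?LX = "FObj L X" let ?RLX = "FObj R ?LX" let ?W = "FObj L ?RLX"
  interpret C: category C by fact
  interpret D: category D by fact
  have L: "is_functor C D L" and R: "is_functor D C R"
    and eta: "\<eta> X \<in> Hom C X ?RLX" and epsY: "\<epsilon> Y \<in> Hom D (FObj L (FObj R Y)) Y"
    and LX: "?LX \<in> Obj D"
    and tri: "Cmp D ?LX ?W ?LX (\<epsilon> ?LX) (FArr L X ?RLX (\<eta> X)) = Idt D ?LX"
    using adj X Y by (auto simp: adjunction_def nat_trans_def functor_id_def functor_comp_def is_functor_def)
  have epsX: "\<epsilon> ?LX \<in> Hom D ?W ?LX"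
    using adj LX by (auto simp: adjunction_def nat_trans_def functor_id_def functor_comp_def)
  have objs: "?RLX \<in> Obj C" "?W \<in> Obj D" "FObj R Y \<in> Obj C" "FObj L (FObj R Y) \<in> Obj D"
    using L R LX Y by (simp_all add: is_functor_def)
  have Leta: "FArr L X ?RLX (\<eta> X) \<in> Hom D ?LX ?W" using L X objs eta by (simp add: is_functor_def)
  have key: "h = Cmp D ?LX (FObj L (FObj R Y)) Y (\<epsilon> Y)
      (FArr L X (FObj R Y) (Cmp C X ?RLX (FObj R Y) (FArr R ?LX Y h) (\<eta> X)))" if h: "h \<in> Hom D ?LX Y" for h
  proof -
    have Rh: "FArr R ?LX Y h \<in> Hom C ?RLX (FObj R Y)" using R LX Y h by (simp add: is_functor_def)
    then have LRh: "FArr L ?RLX (FObj R Y) (FArr R ?LX Y h) \<in> Hom D ?W (FObj L (FObj R Y))"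
      using L objs by (simp add: is_functor_def)
    have nat: "Cmp D ?W ?LX Y h (\<epsilon> ?LX) =
        Cmp D ?W (FObj L (FObj R Y)) Y (\<epsilon> Y) (FArr L ?RLX (FObj R Y) (FArr R ?LX Y h))"
      using adj LX Y h by (simp add: adjunction_def nat_trans_def functor_id_def functor_comp_def)
    have "h = Cmp D ?LX ?LX Y h (Cmp D ?LX ?W ?LX (\<epsilon> ?LX) (FArr L X ?RLX (\<eta> X)))"
      using D.cmp_idt_right[OF LX Y h] by (simp add: tri)
    also have "\<dots> = Cmp D ?LX ?W Y (Cmp D ?W ?LX Y h (\<epsilon> ?LX)) (FArr L X ?RLX (\<eta> X))"
      by (rule D.cmp_assoc[OF LX objs(2) LX Y Leta epsX h])
    also have "\<dots> = Cmp D ?LX (FObj L (FObj R Y)) Y (\<epsilon> Y)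
        (Cmp D ?LX ?W (FObj L (FObj R Y)) (FArr L ?RLX (FObj R Y) (FArr R ?LX Y h)) (FArr L X ?RLX (\<eta> X)))"
      unfolding nat by (rule D.cmp_assoc[OF LX objs(2,4) Y Leta LRh epsY, symmetric])
    finally show ?thesis using L X objs eta Rh by (simp add: is_functor_def)
  qed
  show ?thesis using key[OF f] key[OF g] by (simp only: eq)
qed

text \<open>Dually, a map \<open>h\<close> into \<open>R Y\<close> equals
  \<open>R (\<epsilon> Y \<circ> L h) \<circ> \<eta> X\<close>, by the triangle identity at
  \<open>R Y\<close> and naturality of the unit.\<close>

lemma adjunction_right_unique:
  assumes adj: "adjunction C D L R \<eta> \<epsilon>" and C: "category C" and D: "category D"
    and X: "X \<in> Obj C" and Y: "Y \<in> Obj D" and f: "f \<in> Hom C X (FObj R Y)" and g: "g \<in> Hom C X (FObj R Y)"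
    and eq: "Cmp D (FObj L X) (FObj L (FObj R Y)) Y (\<epsilon> Y) (FArr L X (FObj R Y) f) =
      Cmp D (FObj L X) (FObj L (FObj R Y)) Y (\<epsilon> Y) (FArr L X (FObj R Y) g)"
  shows "f = g"
proof -
  let ?RY = "FObj R Y" let ?LRY = "FObj L ?RY" let ?W = "FObj R ?LRY"
  interpret C: category C by fact
  interpret D: category D by fact
  have L: "is_functor C D L" and R: "is_functor D C R"
    and eps: "\<epsilon> Y \<in> Hom D ?LRY Y" and etaX: "\<eta> X \<in> Hom C X (FObj R (FObj L X))"
    and RY: "?RY \<in> Obj C"
    and tri: "Cmp C ?RY ?W ?RY (FArr R ?LRY Y (\<epsilon> Y)) (\<eta> ?RY) = Idt C ?RY"
    using adj X Y by (auto simp: adjunction_def nat_trans_def functor_id_def functor_comp_def is_functor_def)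
  have etaY: "\<eta> ?RY \<in> Hom C ?RY ?W"
    using adj RY by (auto simp: adjunction_def nat_trans_def functor_id_def functor_comp_def)
  have objs: "?LRY \<in> Obj D" "?W \<in> Obj C" "FObj L X \<in> Obj D" "FObj R (FObj L X) \<in> Obj C"
    using L R RY X by (simp_all add: is_functor_def)
  have Reps: "FArr R ?LRY Y (\<epsilon> Y) \<in> Hom C ?W ?RY" using R Y objs eps by (simp add: is_functor_def)
  have key: "h = Cmp C X (FObj R (FObj L X)) ?RY
      (FArr R (FObj L X) Y (Cmp D (FObj L X) ?LRY Y (\<epsilon> Y) (FArr L X ?RY h))) (\<eta> X)" if h: "h \<in> Hom C X ?RY" for h
  proof -
    have Lh: "FArr L X ?RY h \<in> Hom D (FObj L X) ?LRY" using L RY X h by (simp add: is_functor_def)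
    then have RLh: "FArr R (FObj L X) ?LRY (FArr L X ?RY h) \<in> Hom C (FObj R (FObj L X)) ?W"
      using R objs by (simp add: is_functor_def)
    have nat: "Cmp C X ?RY ?W (\<eta> ?RY) h =
        Cmp C X (FObj R (FObj L X)) ?W (FArr R (FObj L X) ?LRY (FArr L X ?RY h)) (\<eta> X)"
      using adj RY X h by (simp add: adjunction_def nat_trans_def functor_id_def functor_comp_def)
    have "h = Cmp C X ?RY ?RY (Cmp C ?RY ?W ?RY (FArr R ?LRY Y (\<epsilon> Y)) (\<eta> ?RY)) h"
      using C.cmp_idt_left[OF X RY h] by (simp add: tri)
    also have "\<dots> = Cmp C X ?W ?RY (FArr R ?LRY Y (\<epsilon> Y)) (Cmp C X ?RY ?W (\<eta> ?RY) h)"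
      by (rule C.cmp_assoc[OF X RY objs(2) RY h etaY Reps, symmetric])
    also have "\<dots> = Cmp C X (FObj R (FObj L X)) ?RY
        (Cmp C (FObj R (FObj L X)) ?W ?RY (FArr R ?LRY Y (\<epsilon> Y)) (FArr R (FObj L X) ?LRY (FArr L X ?RY h))) (\<eta> X)"
      unfolding nat by (rule C.cmp_assoc[OF X objs(4,2) RY etaX RLh Reps])
    finally show ?thesis using R Y objs eps Lh by (simp add: is_functor_def)
  qed
  show ?thesis using key[OF f] key[OF g] by (simp only: eq)
qed

text \<open>\<open>A\<close> and \<open>D\<close> both split the same idempotent of
  \<open>B\<close>, and two splittings are canonically isomorphic; the inverse is
  \<open>s \<circ> t\<close>.\<close>

lemma (in category) iso_of_common_idempotent:
  assumes obj: "A \<in> Obj C" "B \<in> Obj C" "D \<in> Obj C"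
    and p: "p \<in> Hom C A B" and s: "s \<in> Hom C B A" and q: "q \<in> Hom C B D" and t: "t \<in> Hom C D B"
    and sp: "Cmp C A B A s p = Idt C A" and qt: "Cmp C D B D q t = Idt C D"
    and e: "Cmp C B A B p s = Cmp C B D B t q"
  shows "is_isomorphism C A D (Cmp C A B D q p)"
proof -
  let ?f = "Cmp C A B D q p" and ?g = "Cmp C D B A s t"
  have f: "?f \<in> Hom C A D" and g: "?g \<in> Hom C D A"
    using cmp_in_hom obj p q s t by blast+
  have qe: "Cmp C B B D q (Cmp C B D B t q) = q"
    using cmp_assoc[OF obj(2,3,2,3) q t q] qt cmp_idt_left[OF obj(2,3) q] by simp
  have ep: "Cmp C A B B (Cmp C B A B p s) p = p"
    using cmp_assoc[OF obj(1,2,1,2) p s p] sp cmp_idt_right[OF obj(1,2) p] by simp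
  have ee: "Cmp C B A B p s \<in> Hom C B B" using cmp_in_hom obj p s by blast
  have "Cmp C D A D ?f ?g = Cmp C D B D q (Cmp C D A B p ?g)"
    by (rule cmp_assoc[OF obj(3,1,2,3) g p q, symmetric])
  also have "Cmp C D A B p ?g = Cmp C D B B (Cmp C B A B p s) t"
    by (rule cmp_assoc[OF obj(3,2,1,2) t s p])
  also have "Cmp C D B D q \<dots> = Cmp C D B D (Cmp C B B D q (Cmp C B A B p s)) t"
    by (rule cmp_assoc[OF obj(3,2,2,3) t ee q])
  finally have fg: "Cmp C D A D ?f ?g = Idt C D" by (simp add: e qe qt)
  have "Cmp C A D A ?g ?f = Cmp C A B A s (Cmp C A D B t ?f)"
    by (rule cmp_assoc[OF obj(1,3,2,1) f t s, symmetric])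
  also have "Cmp C A D B t ?f = Cmp C A B B (Cmp C B D B t q) p"
    by (rule cmp_assoc[OF obj(1,2,3,2) p q t])
  finally have gf: "Cmp C A D A ?g ?f = Idt C A" by (simp add: ep sp flip: e)
  show ?thesis unfolding is_isomorphism_def using obj f g fg gf by blast
qed

lemma nat_trans_AbI:
  assumes "is_functor C Ab F" "\<tau> \<in> extensional (Obj C)"
    "\<And>X. X \<in> Obj C \<Longrightarrow> \<tau> X \<in> hom (FObj F X) (FObj K X)"
    "\<And>X. X \<in> Obj C \<Longrightarrow> \<tau> X \<in> extensional (carrier (FObj F X))"
    "\<And>X Y f m. X \<in> Obj C \<Longrightarrow> Y \<in> Obj C \<Longrightarrow> f \<in> Hom C X Y \<Longrightarrow> m \<in> carrier (FObj F X) \<Longrightarrow>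
      \<tau> Y (FArr F X Y f m) = FArr K X Y f (\<tau> X m)"
  shows "\<tau> \<in> nat_trans C Ab F K"
  using assms by (auto simp: nat_trans_def Hom_Ab Cmp_Ab compose_def fun_eq_iff)

lemma nat_trans_AbD:
  assumes "\<tau> \<in> nat_trans C Ab F K" "X \<in> Obj C"
  shows "\<tau> X \<in> hom (FObj F X) (FObj K X)" "\<tau> X \<in> extensional (carrier (FObj F X))"
    "m \<in> carrier (FObj F X) \<Longrightarrow> \<tau> X m \<in> carrier (FObj K X)"
  using assms by (auto simp: nat_trans_def Hom_Ab hom_def)

lemma nat_trans_Ab_natural:
  assumes "\<tau> \<in> nat_trans C Ab F K" "X \<in> Obj C" "Y \<in> Obj C" "f \<in> Hom C X Y" "m \<in> carrier (FObj F X)"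
  shows "\<tau> Y (FArr F X Y f m) = FArr K X Y f (\<tau> X m)"
proof -
  have "compose (carrier (FObj F X)) (\<tau> Y) (FArr F X Y f) = compose (carrier (FObj F X)) (FArr K X Y f) (\<tau> X)"
    using assms(1-4) by (simp add: nat_trans_def Cmp_Ab)
  from fun_cong[OF this, of m] show ?thesis using assms(5) by (simp add: compose_def)
qed

section \<open>The categories of Mackey functors and restriction\<close>

lemma functor_comp_lindner_incl [simp]:
  fixes M :: "('g, 'u) mackey"
  shows "functor_comp M lindner_incl = M"
  by (simp add: functor_comp_def lindner_incl_def)

text \<open>A functor record does not store its domain, and \<open>lindner_incl\<close> is the
  identity on objects and arrows. So restriction returns \<open>M\<close> unchanged, and only
  transformations are cut down to the smaller set of objects.\<close>

lemma Res_simps [simp]: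
  "FObj (Res G \<O> H) M = M"
  "FArr (Res G \<O> H) M N \<tau> = restrict \<tau> (Obj (lindner_sub G \<O> H))"
  by (simp_all add: Res_def lindner_incl_def functor_comp_def)

lemma lindner_sub_simps [simp]:
  "Hom (lindner_sub G \<O> H) = Hom (lindner G \<O>)" "Cmp (lindner_sub G \<O> H) = Cmp (lindner G \<O>)"
  "Idt (lindner_sub G \<O> H) = Idt (lindner G \<O>)"
  by (simp_all add: lindner_sub_def full_subcategory_def)

lemma Above_Mackey_simps:
  "Hom (Above_Mackey G \<O> H) = nat_trans (lindner G \<O>) Ab"
  "Idt (Above_Mackey G \<O> H) = (\<lambda>F. \<lambda>X \<in> Obj (lindner G \<O>). Idt Ab (FObj F X))"
  "Cmp (Above_Mackey G \<O> H) = (\<lambda>F K L \<tau> \<sigma>. \<lambda>X \<in> Obj (lindner G \<O>). Cmp Ab (FObj F X) (FObj K X) (FObj L X) (\<tau> X) (\<sigma> X))"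
  by (simp_all add: Above_Mackey_def Mackey_def product_functor_category_def full_subcategory_def functor_category_def)

lemma Class_Mackey_simps:
  "Hom (Class_Mackey G \<O> H) = nat_trans (lindner_sub G \<O> H) Ab"
  "Idt (Class_Mackey G \<O> H) = (\<lambda>F. \<lambda>X \<in> Obj (lindner_sub G \<O> H). Idt Ab (FObj F X))"
  "Cmp (Class_Mackey G \<O> H) = (\<lambda>F K L \<tau> \<sigma>. \<lambda>X \<in> Obj (lindner_sub G \<O> H). Cmp Ab (FObj F X) (FObj K X) (FObj L X) (\<tau> X) (\<sigma> X))"
  by (simp_all add: Class_Mackey_def product_functor_category_def full_subcategory_def functor_category_def)

lemma Above_Mackey_functor: "M \<in> Obj (Above_Mackey G \<O> H) \<Longrightarrow> is_functor (lindner G \<O>) Ab M"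
  by (simp add: Above_Mackey_def Mackey_def product_functor_category_def full_subcategory_def functor_category_def)

lemma (in finite_transfer_system) Obj_lindner_sub:
  "X \<in> Obj (lindner_sub G \<O> H) \<longleftrightarrow> is_finite_gset G X \<and> (\<forall>x \<in> points X. subconjugate G (stab G X x) H)"
  by (simp add: lindner_sub_def full_subcategory_def lindner_def)

lemma (in finite_transfer_system) categories:
  "category (Above_Mackey G \<O> H)" "category (Class_Mackey G \<O> H)"
proof -
  have "category lin" by (rule category_lindner[OF ts_facts])
  then have "category (functor_category lin Ab)" "category (functor_category (lindner_sub G \<O> H) Ab)"
    by (auto simp: lindner_sub_def intro!: category_functor_category category_full_subcategory category_Ab)
  then show "category (Above_Mackey G \<O> H)" "category (Class_Mackey G \<O> H)"
    unfolding Above_Mackey_def Class_Mackey_def Mackey_def product_functor_category_def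
    by (auto intro!: category_full_subcategory)
qed

section \<open>Functors above [H] and covers of G-sets\<close>

locale rational_above_mackey = mackey_functor G \<O> M
  for G :: "('g, 'e) monoid_scheme" (structure) and \<O> and M :: "('g, 'u) mackey" +
  fixes H :: "'g set" and Q :: "('g, nat) gset"
  assumes H: "subgroup H G" "(H, carrier G) \<in> \<O>"
    and above: "M \<in> Obj (Above_Mackey G \<O> H)" and rational: "rational_mackey G \<O> M"
    and Q: "is_finite_gset G Q" and Q_stab: "\<And>q. q \<in> points Q \<Longrightarrow> \<exists>g \<in> carrier G. stab G Q q = conj_subgroup G g H"
    and Q_base: "\<exists>q \<in> points Q. stab G Q q = H"
begin

lemma H_carrier: "H \<subseteq> carrier G"
  using H subgroup.subset by blast

text \<open>Induction on the number of points. One orbit is a coset set at which \<open>M\<close>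
  vanishes by definition; the rest is smaller, and an element is determined by its restrictions to
  the two pieces.\<close>

lemma null_not_above:
  "is_finite_gset G X \<Longrightarrow> (\<And>x. x \<in> points X \<Longrightarrow> \<not> above_class G \<O> H (stab G X x)) \<Longrightarrow> null X"
proof (induction "card (points X)" arbitrary: X rule: less_induct)
  case less
  note X = less.prems(1)
  show ?case
  proof (cases "points X = {}")
    case True
    then show ?thesis using null_empty X by blast
  next
    case False
    then obtain x where x: "x \<in> points X" by blast
    let ?A = "orbit_set G X x" let ?B = "points X - ?A"
    have A: "invariant_subset G X ?A" by (rule orbit_invariant[OF X x])
    have B: "invariant_subset G X ?B" by (rule invariant_Diff[OF X A])
    note SA = sub_gset_finite[OF X A] and SB = sub_gset_finite[OF X B]
    have "vanishes_at G lin M (stab G X x)"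
      using above stab_subgroup[OF X x] less.prems(2)[OF x] by (simp add: Above_Mackey_def full_subcategory_def)
    then have nA: "null (sub_gset X ?A)"
      using coset_gset_orbit_iso[OF X x] SA by (simp add: vanishes_at_def null_def)
    have nB: "null (sub_gset X ?B)"
    proof (rule less.hyps[OF _ SB])
      show "card (points (sub_gset X ?B)) < card (points X)"
        using orbit_self[OF X x] x fin_gset_props(1)[OF X] by (auto intro: psubset_card_mono)
    qed (use less.prems(2) in auto)
    interpret X: comm_group "val X" by (rule val_group[OF X])
    have one: "m' = m''" if "null Y" "m' \<in> carrier (val Y)" "m'' \<in> carrier (val Y)" for Y m' m''
      using that by (simp add: null_def)
    have "m = \<one>\<^bsub>val X\<^esub>" if m: "m \<in> carrier (val X)" for m
      by (rule restriction_eqI[OF X A m X.one_closed]; rule one[OF nA] one[OF nB];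
          rule mar_closed[OF X SA res_span_ts[OF SA sub_gset_incl[OF A]]] mar_closed[OF X SB res_span_ts[OF SB sub_gset_incl[OF B]]];
          use m in simp)
    then show ?thesis by (auto simp: null_def)
  qed
qed

text \<open>In \<open>mar_split\<close> the summand outside \<open>A\<close> passes through an
  object at which \<open>M\<close> vanishes.\<close>

lemma span_part_above:
  fixes u :: "('g, nat, nat) span"
  assumes X: "is_finite_gset G X" and Y: "is_finite_gset G Y" and u: "is_ts_span G \<O> X Y u" and m: "m \<in> carrier (val X)"
    and A: "invariant_subset G (apex u) A"
    and bad: "\<And>x. x \<in> points (apex u) - A \<Longrightarrow> \<not> above_class G \<O> H (stab G (apex u) x)"
  shows "mar X Y u m = mar X Y (span_part u A) m"
proof -
  note ue = span_equivariant[OF u]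
  have B: "invariant_subset G (apex u) (points (apex u) - A)" by (rule invariant_Diff[OF ue(1) A])
  interpret Y: comm_group "val Y" by (rule val_group[OF Y])
  have "null (sub_gset (apex u) (points (apex u) - A))"
    by (rule null_not_above[OF sub_gset_finite[OF ue(1) B]]) (use bad in auto)
  then have "mar X Y (span_part u (points (apex u) - A)) m = \<one>\<^bsub>val Y\<^esub>"
    using mar_null[OF X Y span_part_ts[OF u B] m] by simp
  then show ?thesis using mar_split[OF X Y u A m] mar_closed[OF X Y span_part_ts[OF u A] m] by simp
qed

text \<open>\<open>V\<close> is an \<open>n\<close>-fold cover of \<open>A\<close> that preserves
  stabilisers. Induction on \<open>n\<close>: an equivariant section splits off one sheet, which
  acts as the identity of \<open>M\<close> because only points outside \<open>A\<close> are lost,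
  and the remaining sheets form a cover of degree one less.\<close>

lemma cover_degree:
  fixes V X :: "'g lobj"
  assumes X: "is_finite_gset G X" and m: "m \<in> carrier (val X)" and A: "invariant_subset G X A"
    and bad: "\<And>x. x \<in> points X - A \<Longrightarrow> \<not> above_class G \<O> H (stab G X x)"
  shows "is_finite_gset G V \<Longrightarrow> equivariant G V X p \<Longrightarrow> (\<And>v. v \<in> points V \<Longrightarrow> p v \<in> A \<and> stab G X (p v) = stab G V v) \<Longrightarrow>
    (\<And>x. x \<in> A \<Longrightarrow> card {v \<in> points V. p v = x} = n) \<Longrightarrow>
    mar X X \<lparr>apex = V, lleg = p, rleg = p\<rparr> m = m [^]\<^bsub>val X\<^esub> n"
proof (induction n arbitrary: V)
  case (0 V)
  note V = 0(1) and p = 0(2)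
  have "is_ts_span G \<O> X X \<lparr>apex = V, lleg = p, rleg = p\<rparr>"
    using V p ts_map_stab_preserving[OF V p] 0(3) by (simp add: is_ts_span_def)
  \<comment> \<open>All points of \<open>V\<close> map into \<open>A\<close>, where the fibres are
    empty.\<close>
  moreover have "points V = {}"
  proof (rule equals0I)
    fix v assume v: "v \<in> points V"
    have "finite {w \<in> points V. p w = p v}" using fin_gset_props(1)[OF V] by simp
    then show False using 0(3)[OF v] 0(4)[of "p v"] v by auto
  qed
  ultimately show ?case using mar_null[OF X X _ m] null_empty[OF V] by simp
next
  case (Suc n V)
  note V = Suc.prems(1) and p = Suc.prems(2) and st = Suc.prems(3) and fib = Suc.prems(4)
  interpret X: comm_group "val X" by (rule val_group[OF X])
  let ?u = "\<lparr>apex = V, lleg = p, rleg = p\<rparr>"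
  have u: "is_ts_span G \<O> X X ?u"
    using V p ts_map_stab_preserving[OF V p] st by (simp add: is_ts_span_def)
  have "A \<subseteq> p ` points V"
  proof
    fix x assume "x \<in> A"
    then have "{v \<in> points V. p v = x} \<noteq> {}" using fib[of x] by (metis card.empty nat.distinct(1))
    then show "x \<in> p ` points V" by blast
  qed
  then obtain s where s: "equivariant G (sub_gset X A) V s" "\<And>x. x \<in> A \<Longrightarrow> p (s x) = x"
    using equivariant_section[OF V X p _ A] st by blast
  let ?S = "s ` A" let ?R = "points V - ?S"
  note SX = sub_gset_finite[OF X A]
  have S: "invariant_subset G V ?S" using invariant_image[OF SX s(1)] by simp
  have R: "invariant_subset G V ?R" by (rule invariant_Diff[OF V S])
  have sV: "s x \<in> points V" if "x \<in> A" for x using equivariantD(1)[OF s(1)] that by simp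
  have iA: "is_ts_span G \<O> X X (span_part (span_id X) A)"
    by (rule span_part_ts[OF span_id_ts[OF ts_facts X]]) (use A in \<open>simp add: span_id_def\<close>)
  \<comment> \<open>As \<open>p\<close> is the identity after \<open>s\<close>, the section turns
    both legs on the sheet \<open>?S\<close> into the inclusion of \<open>A\<close>.\<close>
  have "span_iso G (span_part (span_id X) A) (span_part ?u ?S)"
    unfolding span_iso_def
  proof (intro exI[of _ s] conjI ballI)
    show "equivariant G (apex (span_part (span_id X) A)) (apex (span_part ?u ?S)) s"
      using s(1) by (auto simp: equivariant_def span_id_def)
    have "inj_on s A" using s(2) by (metis inj_onI)
    then show "bij_betw s (points (apex (span_part (span_id X) A))) (points (apex (span_part ?u ?S)))"
      by (simp add: bij_betw_def)
  qed (use s(2) in \<open>auto simp: span_id_def\<close>)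
  moreover have "is_ts_span G \<O> X X (span_part ?u ?S)" by (rule span_part_ts[OF u]) (use S in simp)
  ultimately have "mar X X (span_part ?u ?S) m = mar X X (span_part (span_id X) A) m"
    using cls_eq_iff[OF iA] by metis
  also have "\<dots> = m"
    using span_part_above[OF X X span_id_ts[OF ts_facts X] m, of A] A bad mar_id[OF X m] by (simp add: span_id_def)
  finally have 1: "mar X X (span_part ?u ?S) m = m" .
  have "mar X X \<lparr>apex = sub_gset V ?R, lleg = p, rleg = p\<rparr> m = m [^]\<^bsub>val X\<^esub> n"
  proof (rule Suc.IH)
    show "is_finite_gset G (sub_gset V ?R)" by (rule sub_gset_finite[OF V R])
    show "equivariant G (sub_gset V ?R) X p" using p R by (auto simp: equivariant_def invariant_subset_def)
    show "p v \<in> A \<and> stab G X (p v) = stab G (sub_gset V ?R) v" if "v \<in> points (sub_gset V ?R)" for v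
      using st that by simp
    show "card {v \<in> points (sub_gset V ?R). p v = x} = n" if x: "x \<in> A" for x
    proof -
      \<comment> \<open>\<open>s x\<close> is the only point of the removed sheet over
        \<open>x\<close>.\<close>
      have "{v \<in> points (sub_gset V ?R). p v = x} = {v \<in> points V. p v = x} - {s x}"
        using s(2) x by auto
      then show ?thesis using fib[OF x] sV[OF x] s(2)[OF x] by simp
    qed
  qed
  then have 2: "mar X X (span_part ?u ?R) m = m [^]\<^bsub>val X\<^esub> n" by (simp add: span_part_def)
  show ?case using mar_split[OF X X u, of ?S m] S m 1 2 by (simp add: X.m_comm)
qed

text \<open>For \<open>Q\<close> a copy of G/H this is the index of \<open>H\<close> in its
  normaliser.\<close>

definition w :: nat where "w = card {q \<in> points Q. stab G Q q = H}"

lemma w_pos: "w > 0"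
  unfolding w_def using Q_base fin_gset_props(1)[OF Q] by (auto simp: card_gt_0_iff)

text \<open>Acting by \<open>d\<close> conjugates stabilisers, so it carries the points counted by
  \<open>w\<close> to those with the conjugate stabiliser.\<close>

lemma card_stab_eq_conj:
  assumes d: "d \<in> carrier G"
  shows "card {q \<in> points Q. stab G Q q = conj_subgroup G d H} = w"
proof -
  note cl = fin_gset_props(4)[OF Q]
  have "bij_betw (act Q d) {q \<in> points Q. stab G Q q = H} {q \<in> points Q. stab G Q q = conj_subgroup G d H}"
  proof (rule bij_betw_byWitness[where f' = "act Q (inv d)"])
    show "act Q d ` {q \<in> points Q. stab G Q q = H} \<subseteq> {q \<in> points Q. stab G Q q = conj_subgroup G d H}"
      using cl stab_act[OF Q] d by auto
    show "act Q (inv d) ` {q \<in> points Q. stab G Q q = conj_subgroup G d H} \<subseteq> {q \<in> points Q. stab G Q q = H}"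
      using cl stab_act[OF Q inv_closed[OF d]] d conj_subgroup_inv(1)[OF d H_carrier] by (auto simp del: inv_inv)
  qed (use act_inv[OF Q] d in auto)
  from bij_betw_same_card[OF this] show ?thesis by (simp add: w_def)
qed

section \<open>Restriction and transfer along the projection from X x G/H\<close>

abbreviation T :: "'g lobj \<Rightarrow> 'g lobj" where "T X \<equiv> prod_gset X Q"
abbreviation pull :: "'g lobj \<Rightarrow> 'g lmor" where "pull X \<equiv> cls X (T X) (res_span (T X) pr1)"
abbreviation push :: "'g lobj \<Rightarrow> 'g lmor" where "push X \<equiv> cls (T X) X (tr_span (T X) pr1)"

lemma Q_top: "q \<in> points Q \<Longrightarrow> (stab G Q q, carrier G) \<in> \<O>"
  using Q_stab conjugation[OF H(2)] conj_subgroup_carrier by metis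

lemma T_finite: "is_finite_gset G X \<Longrightarrow> is_finite_gset G (T X)"
  by (rule prod_gset_finite[OF _ Q])

lemma T_sub: "is_finite_gset G X \<Longrightarrow> T X \<in> Obj (lindner_sub G \<O> H)"
  using Q_stab T_finite by (force simp: Obj_lindner_sub subconjugate_def stab_prod_gset)

lemma pull_ts: "is_finite_gset G X \<Longrightarrow> is_ts_span G \<O> X (T X) (res_span (T X) pr1)"
  by (rule res_span_ts[OF T_finite prod_gset_pr1])

lemma push_ts: "is_finite_gset G X \<Longrightarrow> is_ts_span G \<O> (T X) X (tr_span (T X) pr1)"
  by (rule tr_span_ts[OF T_finite pr1_ts_map[OF _ Q Q_top]])

text \<open>The composite is the span with apex \<open>T X\<close> and both legs \<open>pr1\<close>.
  Cutting it down to the points above [H] leaves a cover of the part \<open>?A\<close> of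
  \<open>X\<close>, to which \<open>cover_degree\<close> applies.\<close>

lemma push_pull_degree:
  assumes X: "X \<in> Obj (lindner_sub G \<O> H)" and m: "m \<in> carrier (val X)"
  shows "FArr M (T X) X (push X) (FArr M X (T X) (pull X) m) = m [^]\<^bsub>val X\<^esub> w"
proof -
  have fX: "is_finite_gset G X" and subc: "\<And>x. x \<in> points X \<Longrightarrow> \<exists>d \<in> carrier G. stab G X x \<subseteq> conj_subgroup G d H"
    using X by (auto simp: Obj_lindner_sub subconjugate_def)
  let ?u = "\<lparr>apex = T X, lleg = pr1, rleg = pr1\<rparr>"
  let ?A = "{x \<in> points X. above_class G \<O> H (stab G X x)}"
  let ?V = "{n \<in> points (T X). above_class G \<O> H (stab G (T X) n)}"
  note TX = T_finite[OF fX]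
  have u: "is_ts_span G \<O> X X ?u"
    using TX prod_gset_pr1 pr1_ts_map[OF fX Q Q_top] by (simp add: is_ts_span_def)
  have A: "invariant_subset G X ?A" by (rule invariant_above[OF H(1) fX])
  have V: "invariant_subset G (T X) ?V" by (rule invariant_above[OF H(1) TX])
  \<comment> \<open>Subconjugacy provides one conjugate of \<open>H\<close> containing the
    stabiliser of \<open>x\<close>, and \<open>above_class_conj_unique\<close> says it is the only
    one. So exactly those \<open>q\<close> count whose stabiliser is this conjugate.\<close>
  have good: "above_class G \<O> H (stab G X x \<inter> stab G Q q) \<longleftrightarrow> stab G Q q = conj_subgroup G d H"
    if x: "x \<in> ?A" and q: "q \<in> points Q" and d: "d \<in> carrier G" "stab G X x \<subseteq> conj_subgroup G d H" for x q d
  proof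
    obtain b where b: "b \<in> carrier G" "stab G Q q = conj_subgroup G b H" using Q_stab[OF q] by blast
    assume "above_class G \<O> H (stab G X x \<inter> stab G Q q)"
    then have "conj_subgroup G b H = conj_subgroup G d H"
      by (rule above_class_conj_unique[OF H _ b(1) _ d(1)]) (use b d in auto)
    then show "stab G Q q = conj_subgroup G d H" using b by simp
  next
    assume "stab G Q q = conj_subgroup G d H"
    then have "stab G X x \<inter> stab G Q q = stab G X x" using d by blast
    then show "above_class G \<O> H (stab G X x \<inter> stab G Q q)" using x by simp
  qed
  \<comment> \<open>For such a pair the stabiliser of \<open>pr1 n\<close> already fixes
    \<open>pr2 n\<close>, so the projection preserves stabilisers on \<open>?V\<close>.\<close>
  have VA: "pr1 n \<in> ?A \<and> stab G X (pr1 n) = stab G (T X) n" if n: "n \<in> ?V" for n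
  proof -
    have n': "pr1 n \<in> points X" "pr2 n \<in> points Q" and ab: "above_class G \<O> H (stab G X (pr1 n) \<inter> stab G Q (pr2 n))"
      using n stab_prod_gset[of n X Q] by auto
    have A': "pr1 n \<in> ?A" using n' above_class_mono[OF ab] by blast
    obtain d where d: "d \<in> carrier G" "stab G X (pr1 n) \<subseteq> conj_subgroup G d H" using subc[OF n'(1)] by blast
    have "stab G X (pr1 n) \<subseteq> stab G Q (pr2 n)" using good[OF A' n'(2) d] ab d(2) by simp
    then show ?thesis using A' n stab_prod_gset[of n X Q] by auto
  qed
  have "FArr M (T X) X (push X) (FArr M X (T X) (pull X) m) = mar X X ?u m"
    using mar_Cmp[OF fX TX fX pull_ts[OF fX] push_ts[OF fX] m Cmp_tr_res[OF TX prod_gset_pr1 pr1_ts_map[OF fX Q Q_top]]] by simp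
  also have "\<dots> = mar X X (span_part ?u ?V) m"
    using span_part_above[OF fX fX u m, of ?V] V by simp
  also have "\<dots> = m [^]\<^bsub>val X\<^esub> w"
    unfolding span_part_def
  proof (simp only: span.simps, rule cover_degree[OF fX m A])
    show "is_finite_gset G (sub_gset (T X) ?V)" by (rule sub_gset_finite[OF TX V])
    show "equivariant G (sub_gset (T X) ?V) X pr1"
      using V by (auto simp: equivariant_def)
    show "pr1 n \<in> ?A \<and> stab G X (pr1 n) = stab G (sub_gset (T X) ?V) n" if "n \<in> points (sub_gset (T X) ?V)" for n
    proof -
      have "n \<in> ?V" using that by (simp only: points_sub_gset)
      then show ?thesis using VA by (simp only: stab_sub_gset)
    qed
    show "card {n \<in> points (sub_gset (T X) ?V). pr1 n = x} = w" if x: "x \<in> ?A" for x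
    proof -
      obtain d where d: "d \<in> carrier G" "stab G X x \<subseteq> conj_subgroup G d H" using subc x by blast
      \<comment> \<open>By \<open>good\<close>, the fibre over \<open>x\<close> consists of the
        points of \<open>Q\<close> with one fixed conjugate of \<open>H\<close> as stabiliser, and
        there are \<open>w\<close> of these.\<close>
      have "bij_betw pr2 {n \<in> points (sub_gset (T X) ?V). pr1 n = x}
          {q \<in> points Q. above_class G \<O> H (stab G X x \<inter> stab G Q q)}"
        by (rule bij_betw_byWitness[where f' = "pair x"]) (use x in \<open>auto simp: stab_prod_gset\<close>)
      moreover have "{q \<in> points Q. above_class G \<O> H (stab G X x \<inter> stab G Q q)} =
          {q \<in> points Q. stab G Q q = conj_subgroup G d H}"
        using good[OF x _ d] by blast
      ultimately have "bij_betw pr2 {n \<in> points (sub_gset (T X) ?V). pr1 n = x}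
          {q \<in> points Q. stab G Q q = conj_subgroup G d H}" by simp
      from bij_betw_same_card[OF this] show ?thesis by (simp only: card_stab_eq_conj[OF d(1)])
    qed
  qed auto
  finally show ?thesis .
qed

section \<open>Division by \<open>w\<close>, written as a \<open>w\<close>-th root\<close>

definition rt :: "'g lobj \<Rightarrow> 'u \<Rightarrow> 'u" where
  "rt X m = (THE y. y \<in> carrier (val X) \<and> y [^]\<^bsub>val X\<^esub> w = m)"

lemma unique_root:
  "is_finite_gset G X \<Longrightarrow> m \<in> carrier (val X) \<Longrightarrow> \<exists>!y. y \<in> carrier (val X) \<and> y [^]\<^bsub>val X\<^esub> w = m"
  using rational_group_unique_root[OF _ val_group w_pos] rational by (simp add: rational_mackey_def)

lemma rt:
  assumes "is_finite_gset G X" "m \<in> carrier (val X)"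
  shows "rt X m \<in> carrier (val X)" "rt X m [^]\<^bsub>val X\<^esub> w = m"
  using theI'[OF unique_root[OF assms]] by (simp_all add: rt_def)

lemma rt_eqI:
  assumes "is_finite_gset G X" "y \<in> carrier (val X)" "y [^]\<^bsub>val X\<^esub> w = m"
  shows "rt X m = y"
proof -
  interpret X: comm_group "val X" by (rule val_group[OF assms(1)])
  have "m \<in> carrier (val X)" using assms by auto
  from the1_equality[OF unique_root[OF assms(1) this]] assms show ?thesis by (simp add: rt_def)
qed

lemma rt_mult:
  assumes "is_finite_gset G X" "m \<in> carrier (val X)" "n \<in> carrier (val X)"
  shows "rt X (m \<otimes>\<^bsub>val X\<^esub> n) = rt X m \<otimes>\<^bsub>val X\<^esub> rt X n"
proof -
  interpret X: comm_group "val X" by (rule val_group[OF assms(1)])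
  show ?thesis using rt[OF assms(1,2)] rt[OF assms(1,3)]
    by (intro rt_eqI[OF assms(1)]) (simp_all add: X.pow_mult_distrib X.m_comm)
qed

text \<open>Homomorphisms preserve \<open>w\<close>-th powers, and roots are unique.\<close>

lemma rt_natural:
  assumes X: "is_finite_gset G X" and Y: "is_finite_gset G Y" and f: "f \<in> Hom lin X Y" and m: "m \<in> carrier (val X)"
  shows "FArr M X Y f (rt X m) = rt Y (FArr M X Y f m)"
proof -
  obtain u :: "('g, nat, nat) span" where u: "is_ts_span G \<O> X Y u" "f = cls X Y u" by (rule lin_homE[OF f])
  interpret f: group_hom "val X" "val Y" "FArr M X Y f" unfolding u(2) by (rule mar_hom[OF X Y u(1)])
  show ?thesis using rt[OF X m] by (intro rt_eqI[OF Y, symmetric]) (simp_all flip: f.hom_nat_pow)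
qed

text \<open>\<open>f'\<close> is the product of \<open>f\<close> with \<open>Q\<close>. The same
  \<open>f'\<close> serves both squares, which lets a transformation be inserted between restriction
  and transfer without losing naturality.\<close>

lemma pull_push_natural:
  assumes X: "is_finite_gset G X" and Y: "is_finite_gset G Y" and f: "f \<in> Hom lin X Y"
  obtains f' where "f' \<in> Hom lin (T X) (T Y)"
    "Cmp lin X (T X) (T Y) f' (pull X) = Cmp lin X Y (T Y) (pull Y) f"
    "Cmp lin (T X) (T Y) Y (push Y) f' = Cmp lin (T X) X Y f (push X)"
proof -
  obtain u :: "('g, nat, nat) span" where u: "is_ts_span G \<O> X Y u" "f = cls X Y u" by (rule lin_homE[OF f])
  show ?thesis
    by (rule that[OF cls_in_Hom[OF prod_span_ts[OF u(1) Q]]])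
      (simp_all only: u(2) prod_res_natural[OF u(1) X Y Q] prod_tr_natural[OF u(1) X Y Q Q_top])
qed

lemma pull_in_Hom: "is_finite_gset G X \<Longrightarrow> pull X \<in> Hom lin X (T X)"
  and push_in_Hom: "is_finite_gset G X \<Longrightarrow> push X \<in> Hom lin (T X) X"
  by (rule cls_in_Hom, rule pull_ts push_ts, assumption)+

text \<open>
  The division by \<open>w\<close> (\<open>rt\<close>) always takes place in \<open>M\<close>, as \<open>L\<close> need not be rational.
\<close>

definition extend :: "('g, 'u) mackey \<Rightarrow> ('g, 'u) mackey_hom \<Rightarrow> ('g, 'u) mackey_hom" where
  "extend L \<phi> = (\<lambda>X \<in> Obj lin. \<lambda>m \<in> carrier (val X).
     FArr L (T X) X (push X) (\<phi> (T X) (FArr M X (T X) (pull X) (rt X m))))"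

definition coextend :: "('g, 'u) mackey \<Rightarrow> ('g, 'u) mackey_hom \<Rightarrow> ('g, 'u) mackey_hom" where
  "coextend L \<psi> = (\<lambda>X \<in> Obj lin. \<lambda>m \<in> carrier (FObj L X).
     rt X (FArr M (T X) X (push X) (\<psi> (T X) (FArr L X (T X) (pull X) m))))"

lemma extend_apply: "is_finite_gset G X \<Longrightarrow> m \<in> carrier (val X) \<Longrightarrow>
    extend L \<phi> X m = FArr L (T X) X (push X) (\<phi> (T X) (FArr M X (T X) (pull X) (rt X m)))"
  by (simp add: extend_def)

lemma coextend_apply: "is_finite_gset G X \<Longrightarrow> m \<in> carrier (FObj L X) \<Longrightarrow>
    coextend L \<psi> X m = rt X (FArr M (T X) X (push X) (\<psi> (T X) (FArr L X (T X) (pull X) m)))"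
  by (simp add: coextend_def)

lemma sub_lin: "X \<in> Obj (lindner_sub G \<O> H) \<Longrightarrow> is_finite_gset G X"
  by (simp add: Obj_lindner_sub)

section \<open>Naturality, restriction and composites of the two extensions\<close>

context
  fixes L :: "('g, 'u) mackey"
  assumes L: "is_functor lin Ab L"
begin

text \<open>\<open>T X\<close> and \<open>T Y\<close> lie in the full subcategory on which
  \<open>\<phi>\<close> is natural, so \<open>\<phi>\<close> commutes with \<open>f'\<close>; the
  two squares of \<open>pull_push_natural\<close> and \<open>rt_natural\<close> handle the other
  factors.\<close>

lemma extend_nat_trans:
  assumes \<phi>: "\<phi> \<in> nat_trans (lindner_sub G \<O> H) Ab M L"
  shows "extend L \<phi> \<in> nat_trans lin Ab M L"
proof (rule nat_trans_AbI[OF M_functor])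
  show "extend L \<phi> \<in> extensional (Obj lin)" by (simp add: extend_def)
  fix X assume X': "X \<in> Obj lin"
  then have X: "is_finite_gset G X" by simp
  have TX': "T X \<in> Obj lin" using T_finite[OF X] by simp
  note pl = functor_Ab[OF M_functor X' TX' pull_in_Hom[OF X]]
  note ps = functor_Ab[OF L TX' X' push_in_Hom[OF X]]
  note ph = nat_trans_AbD[OF \<phi> T_sub[OF X]]
  show "extend L \<phi> X \<in> extensional (carrier (val X))" using X by (simp add: extend_def)
  interpret X: comm_group "val X" by (rule val_group[OF X])
  show "extend L \<phi> X \<in> hom (val X) (FObj L X)"
  proof (rule homI)
    fix m n assume m: "m \<in> carrier (val X)" and n: "n \<in> carrier (val X)"
    note rm = rt(1)[OF X m] and rn = rt(1)[OF X n]
    show "extend L \<phi> X (m \<otimes>\<^bsub>val X\<^esub> n) = extend L \<phi> X m \<otimes>\<^bsub>FObj L X\<^esub> extend L \<phi> X n"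
      using hom_mult[OF pl(2) rm rn] hom_mult[OF ph(1) pl(4)[OF rm] pl(4)[OF rn]]
        hom_mult[OF ps(2) ph(3)[OF pl(4)[OF rm]] ph(3)[OF pl(4)[OF rn]]]
      by (simp add: extend_apply[OF X] m n rt_mult[OF X])
  qed (use rt(1)[OF X] pl(4) ph(3) ps(4) in \<open>simp add: extend_apply[OF X]\<close>)
  fix Y f m assume Y': "Y \<in> Obj lin" and f: "f \<in> Hom lin X Y" and m: "m \<in> carrier (val X)"
  have Y: "is_finite_gset G Y" using Y' by simp
  have TY': "T Y \<in> Obj lin" using T_finite[OF Y] by simp
  obtain f' where f': "f' \<in> Hom lin (T X) (T Y)"
    "Cmp lin X (T X) (T Y) f' (pull X) = Cmp lin X Y (T Y) (pull Y) f"
    "Cmp lin (T X) (T Y) Y (push Y) f' = Cmp lin (T X) X Y f (push X)"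
    by (rule pull_push_natural[OF X Y f])
  let ?r = "rt X m" let ?a = "FArr M X (T X) (pull X) ?r"
  have r: "?r \<in> carrier (val X)" by (rule rt(1)[OF X m])
  note a = pl(4)[OF r]
  have "extend L \<phi> Y (FArr M X Y f m) = FArr L (T Y) Y (push Y) (\<phi> (T Y) (FArr M Y (T Y) (pull Y) (FArr M X Y f ?r)))"
    using functor_Ab(4)[OF M_functor X' Y' f m] by (simp add: extend_apply[OF Y] rt_natural[OF X Y f m])
  also have "FArr M Y (T Y) (pull Y) (FArr M X Y f ?r) = FArr M (T X) (T Y) f' ?a"
    using functor_Ab_Cmp[OF M_functor X' Y' TY' f pull_in_Hom[OF Y] r]
      functor_Ab_Cmp[OF M_functor X' TX' TY' pull_in_Hom[OF X] f'(1) r] f'(2) by simp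
  also have "\<phi> (T Y) \<dots> = FArr L (T X) (T Y) f' (\<phi> (T X) ?a)"
    using nat_trans_Ab_natural[OF \<phi> T_sub[OF X] T_sub[OF Y], of f'] f'(1) a by simp
  also have "FArr L (T Y) Y (push Y) \<dots> = FArr L X Y f (FArr L (T X) X (push X) (\<phi> (T X) ?a))"
    using functor_Ab_Cmp[OF L TX' TY' Y' f'(1) push_in_Hom[OF Y] ph(3)[OF a]]
      functor_Ab_Cmp[OF L TX' X' Y' push_in_Hom[OF X] f ph(3)[OF a]] f'(3) by simp
  finally show "extend L \<phi> Y (FArr M X Y f m) = FArr L X Y f (extend L \<phi> X m)"
    using m by (simp add: extend_apply[OF X])
qed

lemma coextend_nat_trans:
  assumes \<psi>: "\<psi> \<in> nat_trans (lindner_sub G \<O> H) Ab L M"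
  shows "coextend L \<psi> \<in> nat_trans lin Ab L M"
proof (rule nat_trans_AbI[OF L])
  show "coextend L \<psi> \<in> extensional (Obj lin)" by (simp add: coextend_def)
  fix X assume X': "X \<in> Obj lin"
  then have X: "is_finite_gset G X" by simp
  have TX': "T X \<in> Obj lin" using T_finite[OF X] by simp
  note pl = functor_Ab[OF L X' TX' pull_in_Hom[OF X]]
  note ps = functor_Ab[OF M_functor TX' X' push_in_Hom[OF X]]
  note ph = nat_trans_AbD[OF \<psi> T_sub[OF X]]
  show "coextend L \<psi> X \<in> extensional (carrier (FObj L X))" using X by (simp add: coextend_def)
  interpret X: comm_group "FObj L X" by (rule pl(1))
  show "coextend L \<psi> X \<in> hom (FObj L X) (val X)"
  proof (rule homI)
    fix m n assume m: "m \<in> carrier (FObj L X)" and n: "n \<in> carrier (FObj L X)"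
    show "coextend L \<psi> X (m \<otimes>\<^bsub>FObj L X\<^esub> n) = coextend L \<psi> X m \<otimes>\<^bsub>val X\<^esub> coextend L \<psi> X n"
      using hom_mult[OF pl(2) m n] hom_mult[OF ph(1) pl(4)[OF m] pl(4)[OF n]]
        hom_mult[OF ps(2) ph(3)[OF pl(4)[OF m]] ph(3)[OF pl(4)[OF n]]]
        rt_mult[OF X ps(4)[OF ph(3)[OF pl(4)[OF m]]] ps(4)[OF ph(3)[OF pl(4)[OF n]]]]
      by (simp add: coextend_apply[OF X] m n)
  qed (use rt(1)[OF X] pl(4) ph(3) ps(4) in \<open>simp add: coextend_apply[OF X]\<close>)
  fix Y f m assume Y': "Y \<in> Obj lin" and f: "f \<in> Hom lin X Y" and m: "m \<in> carrier (FObj L X)"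
  have Y: "is_finite_gset G Y" using Y' by simp
  have TY': "T Y \<in> Obj lin" using T_finite[OF Y] by simp
  obtain f' where f': "f' \<in> Hom lin (T X) (T Y)"
    "Cmp lin X (T X) (T Y) f' (pull X) = Cmp lin X Y (T Y) (pull Y) f"
    "Cmp lin (T X) (T Y) Y (push Y) f' = Cmp lin (T X) X Y f (push X)"
    by (rule pull_push_natural[OF X Y f])
  let ?a = "FArr L X (T X) (pull X) m"
  note a = pl(4)[OF m]
  note b = ph(3)[OF a]
  have "FArr L Y (T Y) (pull Y) (FArr L X Y f m) = FArr L (T X) (T Y) f' ?a"
    using functor_Ab_Cmp[OF L X' Y' TY' f pull_in_Hom[OF Y] m]
      functor_Ab_Cmp[OF L X' TX' TY' pull_in_Hom[OF X] f'(1) m] f'(2) by simp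
  moreover have "\<psi> (T Y) (FArr L (T X) (T Y) f' ?a) = FArr M (T X) (T Y) f' (\<psi> (T X) ?a)"
    using nat_trans_Ab_natural[OF \<psi> T_sub[OF X] T_sub[OF Y], of f'] f'(1) a by simp
  moreover have "FArr M (T Y) Y (push Y) (FArr M (T X) (T Y) f' (\<psi> (T X) ?a)) =
      FArr M X Y f (FArr M (T X) X (push X) (\<psi> (T X) ?a))"
    using functor_Ab_Cmp[OF M_functor TX' TY' Y' f'(1) push_in_Hom[OF Y] b]
      functor_Ab_Cmp[OF M_functor TX' X' Y' push_in_Hom[OF X] f b] f'(3) by simp
  ultimately show "coextend L \<psi> Y (FArr L X Y f m) = FArr M X Y f (coextend L \<psi> X m)"
    using functor_Ab(4)[OF L X' Y' f m] rt_natural[OF X Y f ps(4)[OF b]] m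
    by (simp add: coextend_apply[OF X] coextend_apply[OF Y])
qed

text \<open>Over such an \<open>X\<close> the transfer \<open>push X\<close> is itself a morphism of
  the subcategory. So \<open>\<phi>\<close> can be applied after it, to the \<open>w\<close>-th
  power of the root of \<open>m\<close>.\<close>

lemma extend_restricts:
  assumes \<phi>: "\<phi> \<in> nat_trans (lindner_sub G \<O> H) Ab M L" and X: "X \<in> Obj (lindner_sub G \<O> H)" and m: "m \<in> carrier (val X)"
  shows "extend L \<phi> X m = \<phi> X m"
proof -
  have X': "is_finite_gset G X" by (rule sub_lin[OF X])
  note r = rt[OF X' m]
  have a: "FArr M X (T X) (pull X) (rt X m) \<in> carrier (val (T X))"
    by (rule mar_closed[OF X' T_finite[OF X'] pull_ts[OF X'] r(1)])
  show ?thesis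
    unfolding extend_apply[OF X' m]
    by (subst nat_trans_Ab_natural[OF \<phi> T_sub[OF X'] X _ a, symmetric])
      (simp_all add: push_in_Hom[OF X'] push_pull_degree[OF X r(1)] r(2))
qed

text \<open>Here \<open>\<psi>\<close> is moved in front of the restriction \<open>pull X\<close>,
  and \<open>rt\<close> undoes the \<open>w\<close>-th power of \<open>\<psi> X m\<close>.\<close>

lemma coextend_restricts:
  assumes \<psi>: "\<psi> \<in> nat_trans (lindner_sub G \<O> H) Ab L M" and X: "X \<in> Obj (lindner_sub G \<O> H)" and m: "m \<in> carrier (FObj L X)"
  shows "coextend L \<psi> X m = \<psi> X m"
proof -
  have X': "is_finite_gset G X" by (rule sub_lin[OF X])
  have b: "\<psi> X m \<in> carrier (val X)" by (rule nat_trans_AbD(3)[OF \<psi> X m])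
  show ?thesis
    using nat_trans_Ab_natural[OF \<psi> X T_sub[OF X'], of "pull X"] pull_in_Hom[OF X'] m push_pull_degree[OF X b]
      rt_eqI[OF X' b]
    by (simp add: coextend_apply[OF X' m])
qed

text \<open>\<open>l\<close> commutes with the transfer and cancels \<open>\<phi>\<close> at
  \<open>T X\<close>. The root is moved to the outside, leaving an expression in \<open>M\<close>
  alone that can be compared with \<open>then_coextend\<close>.\<close>

lemma extend_then:
  assumes \<phi>: "\<phi> \<in> nat_trans (lindner_sub G \<O> H) Ab M L" and l: "l \<in> nat_trans lin Ab L M"
    and inv: "\<And>X m. X \<in> Obj (lindner_sub G \<O> H) \<Longrightarrow> m \<in> carrier (val X) \<Longrightarrow> l X (\<phi> X m) = m"
    and X: "is_finite_gset G X" and m: "m \<in> carrier (val X)"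
  shows "l X (extend L \<phi> X m) = rt X (FArr M (T X) X (push X) (FArr M X (T X) (pull X) m))"
proof -
  have objs: "X \<in> Obj lin" "T X \<in> Obj lin" using X T_finite by auto
  note r = rt[OF X m]
  have a: "FArr M X (T X) (pull X) (rt X m) \<in> carrier (val (T X))"
    by (rule mar_closed[OF X T_finite[OF X] pull_ts[OF X] r(1)])
  have am: "FArr M X (T X) (pull X) m \<in> carrier (val (T X))"
    by (rule mar_closed[OF X T_finite[OF X] pull_ts[OF X] m])
  have "l X (extend L \<phi> X m) = FArr M (T X) X (push X) (FArr M X (T X) (pull X) (rt X m))"
    using nat_trans_Ab_natural[OF l objs(2,1) push_in_Hom[OF X] nat_trans_AbD(3)[OF \<phi> T_sub[OF X] a]] inv[OF T_sub[OF X] a]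
    by (simp add: extend_apply[OF X m])
  then show ?thesis
    using rt_natural[OF X T_finite[OF X] pull_in_Hom[OF X] m] rt_natural[OF T_finite[OF X] X push_in_Hom[OF X] am] by simp
qed

text \<open>\<open>l\<close> commutes with the restriction, and \<open>\<psi>\<close> cancels it at
  \<open>T X\<close>; the result is the same expression as in \<open>extend_then\<close>.\<close>

lemma then_coextend:
  assumes \<psi>: "\<psi> \<in> nat_trans (lindner_sub G \<O> H) Ab L M" and l: "l \<in> nat_trans lin Ab M L"
    and inv: "\<And>X m. X \<in> Obj (lindner_sub G \<O> H) \<Longrightarrow> m \<in> carrier (val X) \<Longrightarrow> \<psi> X (l X m) = m"
    and X: "is_finite_gset G X" and m: "m \<in> carrier (val X)"
  shows "coextend L \<psi> X (l X m) = rt X (FArr M (T X) X (push X) (FArr M X (T X) (pull X) m))"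
proof -
  have objs: "X \<in> Obj lin" "T X \<in> Obj lin" using X T_finite by auto
  have a: "FArr M X (T X) (pull X) m \<in> carrier (val (T X))"
    by (rule mar_closed[OF X T_finite[OF X] pull_ts[OF X] m])
  show ?thesis
    using nat_trans_Ab_natural[OF l objs pull_in_Hom[OF X] m] inv[OF T_sub[OF X] a] nat_trans_AbD(3)[OF l objs(1) m]
    by (simp add: coextend_apply[OF X] flip: nat_trans_Ab_natural[OF l objs pull_in_Hom[OF X] m])
qed

end

section \<open>The comparison of Ind and CoInd\<close>

theorem Ind_CoInd_isomorphism:
  assumes adj1: "adjunction (Class_Mackey G \<O> H) (Above_Mackey G \<O> H) Ind (Res G \<O> H) \<eta> \<epsilon>"
    and adj2: "adjunction (Above_Mackey G \<O> H) (Class_Mackey G \<O> H) (Res G \<O> H) CoInd \<eta>' \<epsilon>'"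
  shows "is_isomorphism (Above_Mackey G \<O> H) (FObj Ind M) (FObj CoInd M)
    (Cmp (Above_Mackey G \<O> H) (FObj Ind M) M (FObj CoInd M) (\<eta>' M) (\<epsilon> M))"
proof -
  let ?A = "Above_Mackey G \<O> H" let ?C = "Class_Mackey G \<O> H" let ?sub = "lindner_sub G \<O> H"
  let ?I = "FObj Ind M" let ?J = "FObj CoInd M"
  note cat = categories[of H]
  interpret A: category ?A by (rule cat(1))
  \<comment> \<open>The object part of \<open>Res\<close>, which leaves the record \<open>M\<close>
    unchanged, has values in the class category.\<close>
  have MC: "M \<in> Obj ?C" using adj1 above by (auto simp: adjunction_def is_functor_def)
  have IA: "?I \<in> Obj ?A" and JA: "?J \<in> Obj ?A" using adj1 adj2 MC by (auto simp: adjunction_def is_functor_def)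
  have I: "is_functor lin Ab ?I" and J: "is_functor lin Ab ?J" using IA JA Above_Mackey_functor by blast+
  have eta: "\<eta> M \<in> nat_trans ?sub Ab M ?I" and eps: "\<epsilon> M \<in> nat_trans lin Ab ?I M"
    and tri: "Cmp ?C M ?I M (restrict (\<epsilon> M) (Obj ?sub)) (\<eta> M) = Idt ?C M"
    using adj1 MC above unfolding adjunction_def nat_trans_def[of ?C ?C] nat_trans_def[of ?A ?A]
    by (simp_all add: functor_id_def functor_comp_def Above_Mackey_simps(1) Class_Mackey_simps(1))
  have eta': "\<eta>' M \<in> nat_trans lin Ab M ?J" and eps': "\<epsilon>' M \<in> nat_trans ?sub Ab ?J M"
    and tri': "Cmp ?C M ?J M (\<epsilon>' M) (restrict (\<eta>' M) (Obj ?sub)) = Idt ?C M"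
    using adj2 MC above unfolding adjunction_def nat_trans_def[of ?C ?C] nat_trans_def[of ?A ?A]
    by (simp_all add: functor_id_def functor_comp_def Above_Mackey_simps(1) Class_Mackey_simps(1))
  \<comment> \<open>One triangle identity of each adjunction, evaluated pointwise at
    \<open>M\<close>.\<close>
  have inv: "\<epsilon> M X (\<eta> M X m) = m" if X: "X \<in> Obj ?sub" and m: "m \<in> carrier (val X)" for X m
    using fun_cong[OF fun_cong[OF tri, of X], of m] X m
    by (simp add: Class_Mackey_simps Cmp_Ab Idt_Ab compose_def)
  have inv': "\<epsilon>' M X (\<eta>' M X m) = m" if X: "X \<in> Obj ?sub" and m: "m \<in> carrier (val X)" for X m
    using fun_cong[OF fun_cong[OF tri', of X], of m] X m
    by (simp add: Class_Mackey_simps Cmp_Ab Idt_Ab compose_def)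
  let ?s = "extend ?I (\<eta> M)" and ?t = "coextend ?J (\<epsilon>' M)"
  have s: "?s \<in> nat_trans lin Ab M ?I" by (rule extend_nat_trans[OF I eta])
  have t: "?t \<in> nat_trans lin Ab ?J M" by (rule coextend_nat_trans[OF J eps'])
  have hom: "\<epsilon> M \<in> Hom ?A ?I M" "?s \<in> Hom ?A M ?I" "\<eta>' M \<in> Hom ?A M ?J" "?t \<in> Hom ?A ?J M"
    using eps s eta' t by (simp_all add: Above_Mackey_simps)
  \<comment> \<open>Both composites evaluate to \<open>rt\<close> of transfer after restriction on
    \<open>M\<close>.\<close>
  have e: "Cmp ?A M ?I M (\<epsilon> M) ?s = Cmp ?A M ?J M ?t (\<eta>' M)"
    using extend_then[OF I eta eps inv] then_coextend[OF J eps' eta' inv']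
    by (auto simp: Above_Mackey_simps Cmp_Ab compose_def fun_eq_iff)
  \<comment> \<open>It suffices to compare transposes. On the subcategory \<open>?s\<close> is
    \<open>\<eta> M\<close> and \<open>\<epsilon> M\<close> cancels \<open>\<eta> M\<close>, so both
    transposes equal \<open>\<eta> M\<close>.\<close>
  have "Cmp ?A ?I M ?I ?s (\<epsilon> M) = Idt ?A ?I"
  proof (rule adjunction_left_unique[OF adj1 cat(2,1) MC IA])
    show "Cmp ?A ?I M ?I ?s (\<epsilon> M) \<in> Hom ?A ?I ?I" by (rule A.cmp_in_hom[OF IA above IA hom(1,2)])
    show "Idt ?A ?I \<in> Hom ?A ?I ?I" by (rule A.idt_in_hom[OF IA])
    show "Cmp ?C M (FObj (Res G \<O> H) ?I) (FObj (Res G \<O> H) ?I) (FArr (Res G \<O> H) ?I ?I (Cmp ?A ?I M ?I ?s (\<epsilon> M))) (\<eta> M) =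
      Cmp ?C M (FObj (Res G \<O> H) ?I) (FObj (Res G \<O> H) ?I) (FArr (Res G \<O> H) ?I ?I (Idt ?A ?I)) (\<eta> M)"
      using extend_restricts[OF I eta] inv nat_trans_AbD(3)[OF eta] sub_lin
      by (auto simp: Class_Mackey_simps Above_Mackey_simps Cmp_Ab Idt_Ab compose_def fun_eq_iff)
  qed
  \<comment> \<open>Dually, on the subcategory \<open>?t\<close> is \<open>\<epsilon>' M\<close>,
    which cancels \<open>\<eta>' M\<close>, so both transposes equal
    \<open>\<epsilon>' M\<close>.\<close>
  moreover have "Cmp ?A ?J M ?J (\<eta>' M) ?t = Idt ?A ?J"
  proof (rule adjunction_right_unique[OF adj2 cat JA MC])
    show "Cmp ?A ?J M ?J (\<eta>' M) ?t \<in> Hom ?A ?J ?J" by (rule A.cmp_in_hom[OF JA above JA hom(4,3)])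
    show "Idt ?A ?J \<in> Hom ?A ?J ?J" by (rule A.idt_in_hom[OF JA])
    show "Cmp ?C (FObj (Res G \<O> H) ?J) (FObj (Res G \<O> H) ?J) M (\<epsilon>' M) (FArr (Res G \<O> H) ?J ?J (Cmp ?A ?J M ?J (\<eta>' M) ?t)) =
      Cmp ?C (FObj (Res G \<O> H) ?J) (FObj (Res G \<O> H) ?J) M (\<epsilon>' M) (FArr (Res G \<O> H) ?J ?J (Idt ?A ?J))"
      using coextend_restricts[OF J eps'] inv' nat_trans_AbD(3)[OF eps'] sub_lin
      by (auto simp: Class_Mackey_simps Above_Mackey_simps Cmp_Ab Idt_Ab compose_def fun_eq_iff)
  qed
  ultimately show ?thesis by (rule A.iso_of_common_idempotent[OF IA above JA hom _ _ e])
qed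

end

theorem theorem5p28:
  fixes G :: "('g, 'e) monoid_scheme"
    and \<O> :: "('g set \<times> 'g set) set"
    and H :: "'g set"
    and M :: "('g, 'u) mackey"
  assumes "group G" and "finite (carrier G)"
    and "transfer_system G \<O>"
    and "subgroup H G" and "(H, carrier G) \<in> \<O>"
    and "adjunction (Class_Mackey G \<O> H) (Above_Mackey G \<O> H) Ind (Res G \<O> H) \<eta> \<epsilon>"
    and "adjunction (Above_Mackey G \<O> H) (Class_Mackey G \<O> H) (Res G \<O> H) CoInd \<eta>' \<epsilon>'"
    and "M \<in> Obj (Above_Mackey G \<O> H)"
    and "rational_mackey G \<O> M"
  shows "is_isomorphism (Above_Mackey G \<O> H)
           (FObj Ind (FObj (Res G \<O> H) M))
           (FObj CoInd (FObj (Res G \<O> H) M))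
           (Cmp (Above_Mackey G \<O> H)
              (FObj Ind (FObj (Res G \<O> H) M)) M (FObj CoInd (FObj (Res G \<O> H) M))
              (\<eta>' M) (\<epsilon> M))"
proof -
  interpret finite_transfer_system G \<O>
    using assms(1-3) by (simp add: finite_transfer_system_def finite_transfer_system_axioms_def)
  \<comment> \<open>\<open>Q\<close> is a copy of G/H with natural numbers as points.\<close>
  obtain Q :: "('g, nat) gset" where Q: "is_finite_gset G Q"
    "\<And>q. q \<in> points Q \<Longrightarrow> \<exists>g \<in> carrier G. stab G Q q = conj_subgroup G g H"
    "\<exists>q \<in> points Q. stab G Q q = H"
    by (rule nat_gset_of_subgroup[OF assms(4)]) blast
  have "M \<in> Obj (Mackey G \<O>)" using assms(8) by (simp add: Above_Mackey_def full_subcategory_def)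
  then interpret rational_above_mackey G \<O> M H Q
    using assms Q by (intro rational_above_mackey.intro mackey_functor.intro mackey_functor_axioms.intro
        rational_above_mackey_axioms.intro finite_transfer_system_axioms) simp_all
  show ?thesis using Ind_CoInd_isomorphism[OF assms(6,7)] by simp
qed

end
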